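(* Let $k\ge 0$ be an integer and let $F$ be a polygon. The sequence $$\mathbb{R}\xrightarrow{\ \underline I_{\mathbf{grad},F}^k\ }\underline X_{\mathbf{grad},F}^k\xrightarrow{\ \underline{\mathbf G}_F^k\ }\underline{\mathbf X}_{\mathrm{rot},F}^k\xrightarrow{\ C_F^k\ }\mathcal P^k(F)\xrightarrow{\ 0\ }\{0\}$$ is exact, that is: $\underline I_{\mathbf{grad},F}^k\mathbb R=\operatorname{Ker}\underline{\mathbf G}_F^k$, $\operatorname{Im}\underline{\mathbf G}_F^k=\operatorname{Ker}C_F^k$, and $\operatorname{Im}C_F^k=\mathcal P^k(F)$ (real numbers being identified with constant functions on $F$).
   Context: Geometry. A polygon $F$ is a connected set that is the interior (in its plane) of a finite union of triangles; it is assumed simply connected, with connected Lipschitz-continuous boundary $\partial F$. Its plane is oriented by a unit normal $\mathbf n_F$; tangent vector fields on $F$ are regarded as $\mathbb R^2$-valued. $\mathcal E_F$ and $\mathcal V_F$ are the sets of edges and vertices of $F$; $\mathbf x_V$ is the coordinate vector of a vertex $V$. Each edge $E$ has a fixed unit tangent $\mathbf t_E$, and $'$ denotes the derivative along $\mathbf t_E$ of functions on $E$. $\mathbf n_{FE}$ is the unit normal to $E$ in the plane of $F$ such that $(\mathbf t_E,\mathbf n_{FE},\mathbf n_F)$ is right-handed. $\partial F$ is oriented counter-clockwise with respect to $\mathbf n_F$; $\omega_{FE}=1$ if $\mathbf t_E$ points in the direction opposite to the orientation of $\partial F$, $\omega_{FE}=-1$ otherwise (so $\omega_{FE}\mathbf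 n_{FE}$ points out of $F$). Polynomials. $\mathcal P^\ell(X)$ is the space of restrictions to $X$ (edge or polygon) of polynomials of total degree $\le\ell$, with $\mathcal P^{-1}(X)=\{0\}$; $\pi_{\mathcal P,X}^\ell$ is the $L^2$-orthogonal projector on $\mathcal P^\ell(X)$. $\mathcal P^\ell(\mathcal E_F)$ is the space of functions on $\partial F$ whose restriction to each $E\in\mathcal E_F$ is in $\mathcal P^\ell(E)$ (no continuity required), and $\mathcal P_c^\ell(\partial F)=\mathcal P^\ell(\mathcal E_F)\cap C^0(\partial F)$. $\mathbf{grad}_F$, $\mathrm{div}_F$ are the tangential gradient and divergence on $F$, and $\mathbf{rot}_F r=\varrho_{-\pi/2}(\mathbf{grad}_F r)$, where $\varrho_{-\pi/2}$ is the rotation of angle $-\pi/2$ in the oriented plane of $F$. $\boldsymbol{\mathcal R}^\ell(F)=\mathbf{rot}_F\mathcal P^{\ell+1}(F)$ and $\boldsymbol{\mathcal R}^\ell(F)^\perp$ is its $L^2$-orthogonal complement in $\mathcal P^\ell(F)^2$; the $L^2$-orthogonal projectors on these spaces are $\boldsymbol\pi_{\mathcal R,F}^\ell$ and $\boldsymbol\pi_{\mathcal R,F}^{\perp,\ell}$. Spaces. $\underline X_{\mathbf{grad},F}^k=\mathcal P^{k-1}(F)\times\mathcal P_c^{k+1}(\partial F)$, with elements $\underline q_F=(q_F,q_{\partial F})$. $\underline{\mathbf X}_{\mathrm{rot},F}^k=\big(\boldsymbol{\mathcal R}^{k-1}(F)\oplus\boldsymbol{\mathcal R}^k(F)^\perp\big)\times\mathcal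 P^k(\mathcal E_F)$, with elements $\underline{\mathbf v}_F=(\mathbf v_F=\mathbf v_{\mathcal R,F}+\mathbf v_{\mathcal R,F}^\perp,\,v_{\partial F})$. Interpolator. For $q\in C^0(\overline F)$, $\underline I_{\mathbf{grad},F}^kq=(q_F,q_{\partial F})$ with $q_F=\pi_{\mathcal P,F}^{k-1}q$, $\pi_{\mathcal P,E}^{k-1}(q_{\partial F})_{|E}=\pi_{\mathcal P,E}^{k-1}q_{|E}$ for all $E\in\mathcal E_F$, and $q_{\partial F}(\mathbf x_V)=q(\mathbf x_V)$ for all $V\in\mathcal V_F$ (this determines $q_{\partial F}\in\mathcal P_c^{k+1}(\partial F)$ uniquely). Operators. The full gradient $\mathring{\mathbf G}_F^k:\underline X_{\mathbf{grad},F}^k\to\mathcal P^k(F)^2$ is defined by $$\int_F\mathring{\mathbf G}_F^k\underline q_F\cdot\mathbf w_F=-\int_Fq_F\,\mathrm{div}_F\mathbf w_F+\sum_{E\in\mathcal E_F}\omega_{FE}\int_Eq_{\partial F}(\mathbf w_F\cdot\mathbf n_{FE})\quad\forall\mathbf w_F\in\mathcal P^k(F)^2,$$ and $G_{\partial F}^kq_{\partial F}\in\mathcal P^k(\mathcal E_F)$ by $(G_{\partial F}^kq_{\partial F})_{|E}=(q_{\partial F})_{|E}'$ for all $E\in\mathcal E_F$. The discrete gradient is $$\underline{\mathbf G}_F^k\underline q_F=\big(\boldsymbol\pi_{\mathcal R,F}^{k-1}(\mathring{\mathbf G}_F^k\underline q_F)+\boldsymbol\pi_{\mathcal R,F}^{\perp,k}(\mathring{\mathbf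 G}_F^k\underline q_F),\ G_{\partial F}^kq_{\partial F}\big).$$ The discrete curl $C_F^k:\underline{\mathbf X}_{\mathrm{rot},F}^k\to\mathcal P^k(F)$ is defined by $$\int_FC_F^k\underline{\mathbf v}_F\,r_F=\int_F\mathbf v_{\mathcal R,F}\cdot\mathbf{rot}_Fr_F-\sum_{E\in\mathcal E_F}\omega_{FE}\int_Ev_{\partial F}\,r_F\quad\forall r_F\in\mathcal P^k(F).$$ *)

theory Defs
  imports "HOL-Analysis.Analysis"
begin

text \<open>
  The plane of the polygon is identified with \<open>real \<times> real\<close> by means of an orthonormal frame
  \<open>(e\<^sub>1, e\<^sub>2)\<close> for which \<open>(e\<^sub>1, e\<^sub>2, n\<^sub>F)\<close> is right-handed; rotations by positive angles are
  therefore counter-clockwise with respect to \<open>n\<^sub>F\<close>.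
\<close>

type_synonym point = "real \<times> real"

definition rotation :: "real \<Rightarrow> point \<Rightarrow> point" where
  "rotation \<theta> v = (cos \<theta> * fst v - sin \<theta> * snd v, sin \<theta> * fst v + cos \<theta> * snd v)"

subsection \<open>Polygons\<close>

definition triangle :: "point set \<Rightarrow> bool" where
  "triangle T \<longleftrightarrow> (\<exists>a b c. \<not> collinear {a, b, c} \<and> T = convex hull {a, b, c})"

text \<open>Locally, up to a choice of orthonormal axes, a Lipschitz domain is a strict subgraph.\<close>

definition lipschitz_boundary :: "point set \<Rightarrow> bool" where
  "lipschitz_boundary F \<longleftrightarrow>
     (\<forall>x\<in>frontier F. \<exists>U a b L. \<exists>g :: real \<Rightarrow> real.
        open U \<and> x \<in> U \<and> norm a = 1 \<and> norm b = 1 \<and> a \<bullet> b = 0 \<and>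
        L-lipschitz_on UNIV g \<and> F \<inter> U = {y \<in> U. y \<bullet> b < g (y \<bullet> a)})"

definition polygon :: "point set \<Rightarrow> bool" where
  "polygon F \<longleftrightarrow>
     F \<noteq> {} \<and> connected F \<and> simply_connected F \<and>
     connected (frontier F) \<and> lipschitz_boundary F \<and>
     (\<exists>\<T>. finite \<T> \<and> (\<forall>T\<in>\<T>. triangle T) \<and> F = interior (\<Union>\<T>))"

text \<open>
  The corners are the boundary points near which the boundary is not a straight line. A vertex
  set contains all corners, and may also contain finitely many further boundary points (flat
  vertices, as they occur when \<open>F\<close> is a face of a mesh with aligned edges).
\<close>

definition corners :: "point set \<Rightarrow> point set" where
  "corners F = {x \<in> frontier F. \<not> (\<exists>r>0. \<exists>d. d \<noteq> 0 \<and>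
     frontier F \<inter> ball x r = range (\<lambda>s. x + s *\<^sub>R d) \<inter> ball x r)}"

definition vertex_set :: "point set \<Rightarrow> point set \<Rightarrow> bool" where
  "vertex_set F V \<longleftrightarrow> finite V \<and> corners F \<subseteq> V \<and> V \<subseteq> frontier F"

definition edges :: "point set \<Rightarrow> point set \<Rightarrow> point set set" where
  "edges F V = {closed_segment a b | a b. a \<in> V \<and> b \<in> V \<and> a \<noteq> b \<and>
     closed_segment a b \<subseteq> frontier F \<and> open_segment a b \<inter> V = {}}"

definition unit_tangent :: "point set \<Rightarrow> point \<Rightarrow> bool" where
  "unit_tangent E \<tau> \<longleftrightarrow> norm \<tau> = 1 \<and> (\<forall>x\<in>E. \<forall>y\<in>E. \<exists>c. y - x = c *\<^sub>R \<tau>)"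

text \<open>
  The counter-clockwise orientation of the boundary is the one for which \<open>F\<close> lies on the left.
\<close>

definition ccw_direction :: "point set \<Rightarrow> point set \<Rightarrow> point \<Rightarrow> bool" where
  "ccw_direction F E \<tau> \<longleftrightarrow>
     (\<forall>x\<in>rel_interior E. \<forall>\<^sub>F \<epsilon> in at_right 0. x + \<epsilon> *\<^sub>R rotation (pi/2) \<tau> \<in> F)"

definition edge_sign :: "point set \<Rightarrow> (point set \<Rightarrow> point) \<Rightarrow> point set \<Rightarrow> real" where
  "edge_sign F t E = (if ccw_direction F E (- t E) then 1 else -1)"

text \<open>The unit normal \<open>n\<close> to \<open>E\<close> for which \<open>(t E, n, n\<^sub>F)\<close> is right-handed.\<close>

definition edge_normal :: "(point set \<Rightarrow> point) \<Rightarrow> point set \<Rightarrow> point" where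
  "edge_normal t E = rotation (pi/2) (t E)"

subsection \<open>Integration and differentiation\<close>

definition face_integral :: "point set \<Rightarrow> (point \<Rightarrow> real) \<Rightarrow> real" where
  "face_integral F f = (LINT z:F|lborel. f z)"

text \<open>Arc-length integral over a segment; it does not depend on the order of the end points.\<close>

definition edge_integral :: "point set \<Rightarrow> (point \<Rightarrow> real) \<Rightarrow> real" where
  "edge_integral E f = (THE I. \<forall>a b. E = closed_segment a b \<longrightarrow>
     I = dist a b * (LINT s:{0..1}|lborel. f (linepath a b s)))"

definition grad :: "(point \<Rightarrow> real) \<Rightarrow> point \<Rightarrow> point" where
  "grad f z = (THE D. GDERIV f z :> D)"

definition rot :: "(point \<Rightarrow> real) \<Rightarrow> point \<Rightarrow> point" where
  "rot f z = rotation (- pi/2) (grad f z)"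

definition divergence :: "(point \<Rightarrow> point) \<Rightarrow> point \<Rightarrow> real" where
  "divergence w z = (\<Sum>b\<in>Basis. frechet_derivative w (at z) b \<bullet> b)"

text \<open>Derivative along \<open>\<tau>\<close> of a function on the segment \<open>E\<close> (one-sided at the end points).\<close>

definition edge_deriv :: "point set \<Rightarrow> point \<Rightarrow> (point \<Rightarrow> real) \<Rightarrow> point \<Rightarrow> real" where
  "edge_deriv E \<tau> q x =
     vector_derivative (\<lambda>s. q (x + s *\<^sub>R \<tau>)) (at 0 within {s. x + s *\<^sub>R \<tau> \<in> E})"

subsection \<open>Polynomial spaces\<close>

text \<open>
  Polynomials on the whole plane come first. Functions on a set \<open>X\<close> are represented by extensional
  functions, so that two elements of a space on \<open>X\<close> are equal iff they agree on \<open>X\<close>. Degrees are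
  integers; for a negative degree the sum is empty and the space is zero.
\<close>

definition polys :: "int \<Rightarrow> (point \<Rightarrow> real) set" where
  "polys l = {p. \<exists>c :: nat \<Rightarrow> nat \<Rightarrow> real. \<forall>x y.
     p (x, y) = (\<Sum>(i, j)\<in>{(i, j). int i + int j \<le> l}. c i j * x ^ i * y ^ j)}"

definition vpolys :: "int \<Rightarrow> (point \<Rightarrow> point) set" where
  "vpolys l = {(\<lambda>z. (p z, q z)) | p q. p \<in> polys l \<and> q \<in> polys l}"

definition P_space :: "int \<Rightarrow> point set \<Rightarrow> (point \<Rightarrow> real) set" where
  "P_space l X = (\<lambda>p. restrict p X) ` polys l"

definition P_vec :: "int \<Rightarrow> point set \<Rightarrow> (point \<Rightarrow> point) set" where
  "P_vec l F = (\<lambda>w. restrict w F) ` vpolys l"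

text \<open>
  Elements of the broken space on the boundary are families indexed by the edges: no compatibility
  is required at a vertex shared by two (closed) edges.
\<close>

definition P_edges :: "int \<Rightarrow> point set \<Rightarrow> point set \<Rightarrow> (point set \<Rightarrow> point \<Rightarrow> real) set" where
  "P_edges l F V = (\<Pi>\<^sub>E E\<in>edges F V. P_space l E)"

definition Pc_boundary :: "int \<Rightarrow> point set \<Rightarrow> point set \<Rightarrow> (point \<Rightarrow> real) set" where
  "Pc_boundary l F V = {q \<in> extensional (frontier F). continuous_on (frontier F) q \<and>
     (\<forall>E\<in>edges F V. restrict q E \<in> P_space l E)}"

definition R_space :: "int \<Rightarrow> point set \<Rightarrow> (point \<Rightarrow> point) set" where
  "R_space l F = (\<lambda>p. restrict (rot p) F) ` polys (l + 1)"

definition R_perp :: "int \<Rightarrow> point set \<Rightarrow> (point \<Rightarrow> point) set" where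
  "R_perp l F = {w \<in> P_vec l F. \<forall>v\<in>R_space l F. face_integral F (\<lambda>z. w z \<bullet> v z) = 0}"

text \<open>\<open>J\<close> is the integral over the domain of the functions in \<open>W\<close>.\<close>

definition L2_projector ::
    "((point \<Rightarrow> real) \<Rightarrow> real) \<Rightarrow> (point \<Rightarrow> 'b::real_inner) set \<Rightarrow> (point \<Rightarrow> 'b) \<Rightarrow> point \<Rightarrow> 'b" where
  "L2_projector J W f = (THE p. p \<in> W \<and> (\<forall>w\<in>W. J (\<lambda>z. (f z - p z) \<bullet> w z) = 0))"

subsection \<open>Discrete spaces and operators\<close>

definition X_grad ::
    "nat \<Rightarrow> point set \<Rightarrow> point set \<Rightarrow> ((point \<Rightarrow> real) \<times> (point \<Rightarrow> real)) set" where
  "X_grad k F V = P_space (int k - 1) F \<times> Pc_boundary (int k + 1) F V"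

definition X_rot ::
    "nat \<Rightarrow> point set \<Rightarrow> point set \<Rightarrow> ((point \<Rightarrow> point) \<times> (point set \<Rightarrow> point \<Rightarrow> real)) set" where
  "X_rot k F V =
     {(\<lambda>z\<in>F. v z + w z) | v w. v \<in> R_space (int k - 1) F \<and> w \<in> R_perp (int k) F}
       \<times> P_edges (int k) F V"

definition R_component :: "nat \<Rightarrow> point set \<Rightarrow> (point \<Rightarrow> point) \<Rightarrow> point \<Rightarrow> point" where
  "R_component k F v = (THE vR. vR \<in> R_space (int k - 1) F \<and>
     (\<exists>w\<in>R_perp (int k) F. v = (\<lambda>z\<in>F. vR z + w z)))"

definition interpolator ::
    "nat \<Rightarrow> point set \<Rightarrow> point set \<Rightarrow> (point \<Rightarrow> real) \<Rightarrow> (point \<Rightarrow> real) \<times> (point \<Rightarrow> real)" where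
  "interpolator k F V q =
     (L2_projector (face_integral F) (P_space (int k - 1) F) q,
      THE qb. qb \<in> Pc_boundary (int k + 1) F V \<and>
        (\<forall>E\<in>edges F V.
           L2_projector (edge_integral E) (P_space (int k - 1) E) qb =
           L2_projector (edge_integral E) (P_space (int k - 1) E) q) \<and>
        (\<forall>x\<in>V. qb x = q x))"

text \<open>
  Test functions range over polynomials on the whole plane, since both their restrictions to the
  open set \<open>F\<close> and their traces on the edges are needed.
\<close>

definition full_gradient ::
    "nat \<Rightarrow> point set \<Rightarrow> point set \<Rightarrow> (point set \<Rightarrow> point) \<Rightarrow>
     (point \<Rightarrow> real) \<times> (point \<Rightarrow> real) \<Rightarrow> point \<Rightarrow> point" where
  "full_gradient k F V t = (\<lambda>(qF, qb). THE g. g \<in> P_vec (int k) F \<and>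
     (\<forall>w\<in>vpolys (int k).
        face_integral F (\<lambda>z. g z \<bullet> w z) =
          - face_integral F (\<lambda>z. qF z * divergence w z)
          + (\<Sum>E\<in>edges F V. edge_sign F t E *
               edge_integral E (\<lambda>z. qb z * (w z \<bullet> edge_normal t E)))))"

definition boundary_gradient ::
    "point set \<Rightarrow> point set \<Rightarrow> (point set \<Rightarrow> point) \<Rightarrow>
     (point \<Rightarrow> real) \<Rightarrow> point set \<Rightarrow> point \<Rightarrow> real" where
  "boundary_gradient F V t qb = (\<lambda>E\<in>edges F V. \<lambda>x\<in>E. edge_deriv E (t E) qb x)"

definition discrete_gradient ::
    "nat \<Rightarrow> point set \<Rightarrow> point set \<Rightarrow> (point set \<Rightarrow> point) \<Rightarrow>
     (point \<Rightarrow> real) \<times> (point \<Rightarrow> real) \<Rightarrow>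
     (point \<Rightarrow> point) \<times> (point set \<Rightarrow> point \<Rightarrow> real)" where
  "discrete_gradient k F V t q =
     (let g = full_gradient k F V t q in
      ((\<lambda>z\<in>F. L2_projector (face_integral F) (R_space (int k - 1) F) g z +
               L2_projector (face_integral F) (R_perp (int k) F) g z),
       boundary_gradient F V t (snd q)))"

definition discrete_curl ::
    "nat \<Rightarrow> point set \<Rightarrow> point set \<Rightarrow> (point set \<Rightarrow> point) \<Rightarrow>
     (point \<Rightarrow> point) \<times> (point set \<Rightarrow> point \<Rightarrow> real) \<Rightarrow> point \<Rightarrow> real" where
  "discrete_curl k F V t = (\<lambda>(vF, vb). THE c. c \<in> P_space (int k) F \<and>
     (\<forall>r\<in>polys (int k).
        face_integral F (\<lambda>z. c z * r z) =
          face_integral F (\<lambda>z. R_component k F vF z \<bullet> rot r z)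
          - (\<Sum>E\<in>edges F V. edge_sign F t E * edge_integral E (\<lambda>z. vb E z * r z))))"

definition zero_rot ::
    "point set \<Rightarrow> point set \<Rightarrow> (point \<Rightarrow> point) \<times> (point set \<Rightarrow> point \<Rightarrow> real)" where
  "zero_rot F V = ((\<lambda>z\<in>F. 0), (\<lambda>E\<in>edges F V. \<lambda>x\<in>E. 0))"

end

theory Submission
  imports Defs "HOL-Library.Function_Algebras"
begin

text \<open>
  Near a boundary point the Lipschitz condition makes \<open>F\<close> the region below a piecewise linear
  graph. So exactly one edge leaves and exactly one edge enters each vertex when every edge is
  directed with \<open>F\<close> on its left, and as the boundary is connected, the edges form one cycle.
  Fubini then gives the divergence theorem \<open>\<integral>\<^sub>F div w = \<Sum>\<^sub>E \<omega>\<^sub>F\<^sub>E \<integral>\<^sub>E w \<bullet> n\<^sub>F\<^sub>E\<close> for polynomial fields,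
  and the cycle gives \<open>\<Sum>\<^sub>E \<omega>\<^sub>F\<^sub>E \<integral>\<^sub>E q' = 0\<close> for continuous \<open>q\<close> as well as a continuous primitive for
  every \<open>v\<close> on the boundary with \<open>\<Sum>\<^sub>E \<omega>\<^sub>F\<^sub>E \<integral>\<^sub>E v = 0\<close>.

  A discrete field in the kernel of the gradient has constant trace \<open>c\<close>, its full gradient is
  orthogonal to itself, and then \<open>div\<close> being onto \<open>P\<^sup>k\<^sup>-\<^sup>1\<close> forces \<open>q\<^sub>F = \<pi> c\<close>. If the curl of
  \<open>(rot p + w, v)\<close> vanishes, testing with \<open>1\<close> yields a boundary primitive of \<open>v\<close>, and \<open>q\<^sub>F = div u\<close>
  comes from the Riesz representation for \<open>\<integral> div u div u'\<close> on the orthogonal complement of the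
  rotated gradients, which is definite because divergence-free polynomial fields are rotated
  gradients. For the surjectivity of the curl, boundary data supported on one edge match the mean,
  and the Riesz representation for \<open>\<integral> rot p \<bullet> rot r\<close> does the rest.
\<close>

section \<open>Inner product forms on finite-dimensional function spaces\<close>

text \<open>The operators are mostly definite descriptions over extensional functions on
  \<open>F\<close> or on an edge. The arguments take place among polynomials on the whole plane
  instead: these form vector spaces of total functions, restriction to the open set \<open>F\<close>
  is injective on them, and they have traces on the edges, which \<open>F\<close> does not contain.
  Existence comes from the Riesz representation, uniqueness from definiteness of the L2 product.
  Several forms are only semidefinite (traces on one edge, differences along the boundary,
  energies), hence the shape of \<open>riesz\<close>. The tangents \<open>t E\<close> are arbitrary,
  whereas the cycle has a direction of its own. Every edge is therefore walked counter-clockwise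
  with a parameter between 0 and 1; up to sign, the boundary terms then collapse to integrals with
  the factor \<open>perp (side p)\<close> or \<open>1 / speed p\<close>. The cycle is never
  enumerated. It enters through two facts: \<open>next_vertex\<close> permutes the vertices, and no
  proper nonempty set of vertices is invariant under it.\<close>

instantiation "fun" :: (type, real_vector) real_vector
begin

definition scaleR_fun :: "real \<Rightarrow> ('a \<Rightarrow> 'b) \<Rightarrow> 'a \<Rightarrow> 'b" where
  "scaleR_fun r f = (\<lambda>x. r *\<^sub>R f x)"

instance
  by standard (auto simp: scaleR_fun_def fun_eq_iff scaleR_add_right scaleR_add_left)

end

lemma scaleR_fun_apply [simp]: "(r *\<^sub>R f) x = r *\<^sub>R f x"
  by (simp add: scaleR_fun_def)

text \<open>Linearity is asked for on \<open>W\<close> only: an integral such as \<open>ip u\<close>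
  is additive on continuous functions, where it converges, but not on all functions.\<close>

definition lin_on :: "'v::real_vector set \<Rightarrow> ('v \<Rightarrow> real) \<Rightarrow> bool" where
  "lin_on W L \<longleftrightarrow> (\<forall>u\<in>W. \<forall>v\<in>W. L (u + v) = L u + L v) \<and> (\<forall>c. \<forall>u\<in>W. L (c *\<^sub>R u) = c * L u)"

lemma lin_onD:
  assumes "lin_on W L" "u \<in> W"
  shows "v \<in> W \<Longrightarrow> L (u + v) = L u + L v" "L (c *\<^sub>R u) = c * L u"
  using assms by (auto simp: lin_on_def)

lemma lin_on_diff:
  assumes "lin_on W L" "subspace W" "u \<in> W" "v \<in> W"
  shows "L (u - v) = L u - L v"
proof -
  have "L (u + (-1) *\<^sub>R v) = L u + (-1) * L v"
    using assms by (simp only: lin_onD subspace_scale)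
  then show ?thesis by simp
qed

text \<open>
  Only semidefiniteness of the form is assumed. Then the functional has to vanish on the
  isotropic vectors; this makes the lemma applicable to energy forms such as
  \<open>\<integral> rot p \<bullet> rot q\<close>, whose kernel consists of the constants.
\<close>

lemma riesz_span:
  fixes B :: "'v::real_vector \<Rightarrow> 'v \<Rightarrow> real"
  assumes W: "subspace W" and "finite S" "S \<subseteq> W"
    and B: "\<And>u. u \<in> W \<Longrightarrow> lin_on W (B u)"
    and sym: "\<And>u v. u \<in> W \<Longrightarrow> v \<in> W \<Longrightarrow> B u v = B v u"
    and pos: "\<And>u. u \<in> W \<Longrightarrow> 0 \<le> B u u"
    and L: "lin_on W L"
    and L0: "\<And>u. u \<in> W \<Longrightarrow> B u u = 0 \<Longrightarrow> L u = 0"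
  shows "\<exists>p\<in>span S. \<forall>w\<in>span S. B p w = L w"
  using \<open>finite S\<close> \<open>S \<subseteq> W\<close> L L0
\<comment> \<open>\<open>L\<close> is generalized because the induction hypothesis is applied to
  \<open>B e\<close> as well; this projects the new vector \<open>e\<close> on
  \<open>span S\<close>.\<close>
proof (induction S arbitrary: L rule: finite_induct)
  case empty
  have "B 0 0 = L 0"
    using lin_onD(2)[OF B, of 0 0 0] lin_onD(2)[OF empty.prems(2), of 0 0] subspace_0[OF W] by simp
  then show ?case by simp
next
  case (insert e S)
  have e: "e \<in> W" and S: "S \<subseteq> W" using insert.prems by auto
  have SW: "span S \<subseteq> W" using S W by (simp add: span_minimal)
  \<comment> \<open>Cauchy-Schwarz for a semidefinite form: if \<open>B w w = 0\<close>, the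
    quadratic in \<open>c\<close> degenerates to an affine function, and \<open>c\<close> is chosen
    to give it the value -1.\<close>
  have isotropic: "B w u = 0" if "u \<in> W" "w \<in> W" "B w w = 0" for u w
  proof (rule ccontr)
    assume nz: "B w u \<noteq> 0"
    define c where "c = - (B u u + 1) / (2 * B w u)"
    have "B (u + c *\<^sub>R w) (u + c *\<^sub>R w) = B u u + 2 * c * B w u"
    proof -
      have m: "u + c *\<^sub>R w \<in> W" "c *\<^sub>R w \<in> W" using that W by (auto simp: subspace_add subspace_scale)
      have "B (u + c *\<^sub>R w) (u + c *\<^sub>R w) = B (u + c *\<^sub>R w) u + c * B (u + c *\<^sub>R w) w"
        using lin_onD[OF B[OF m(1)]] that m by simp
      also have "\<dots> = B u (u + c *\<^sub>R w) + c * B w (u + c *\<^sub>R w)"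
        using sym that m by simp
      also have "\<dots> = B u u + c * B u w + c * (B w u + c * B w w)"
        using lin_onD[OF B[OF that(1)]] lin_onD[OF B[OF that(2)]] that m by simp
      finally show ?thesis using that sym[of u w] by (simp add: algebra_simps)
    qed
    also have "\<dots> = -1" using nz by (simp add: c_def field_simps)
    finally show False using pos[of "u + c *\<^sub>R w"] that W by (auto simp: subspace_add subspace_scale)
  qed
  obtain p where p: "p \<in> span S" "\<And>w. w \<in> span S \<Longrightarrow> B p w = L w"
    using insert.IH[OF S insert.prems(2,3)] by blast
  obtain pe where pe: "pe \<in> span S" "\<And>w. w \<in> span S \<Longrightarrow> B pe w = B e w"
  proof -
    have "B e u = 0" if "u \<in> W" "B u u = 0" for u
      using isotropic[OF e that] sym[OF e that(1)] by simp
    then show ?thesis using insert.IH[OF S B[OF e]] that by blast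
  qed
  define f where "f = e - pe"
  have fW: "f \<in> W" and pW: "p \<in> W" and peW: "pe \<in> W"
    using e p pe SW W by (auto simp: f_def subspace_diff)
  have Bf: "B f w = 0" if "w \<in> span S" for w
  proof -
    have "w \<in> W" using that SW by auto
    then have "B f w = B w e - B w pe"
      using sym fW lin_on_diff[OF B W e peW] by (simp add: f_def)
    then show ?thesis using pe(2)[OF that] sym \<open>w \<in> W\<close> e peW by simp
  qed
  \<comment> \<open>A Gram-Schmidt step. If \<open>f\<close> is isotropic, \<open>L f = 0\<close> by
    hypothesis and the coefficient is arbitrary.\<close>
  define c where "c = (if B f f = 0 then 0 else L f / B f f)"
  define q where "q = p + c *\<^sub>R f"
  have qW: "q \<in> W" using W pW fW by (simp add: q_def subspace_add subspace_scale)
  have Bq: "B q w = B p w + c * B f w" if "w \<in> W" for w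
  proof -
    have "B q w = B w (p + c *\<^sub>R f)" using sym that qW by (simp add: q_def)
    also have "\<dots> = B w p + c * B w f"
      using lin_onD[OF B[OF that]] pW fW W by (simp add: subspace_scale)
    finally show ?thesis using sym that pW fW by simp
  qed
  have fsp: "f \<in> span (insert e S)"
    unfolding f_def using pe(1) span_mono[of S "insert e S"] by (blast intro: span_diff span_base)
  have qsp: "q \<in> span (insert e S)"
    unfolding q_def using p(1) fsp span_mono[of S "insert e S"] by (intro span_add span_scale) auto
  moreover have "B q w = L w" if mem: "w \<in> span (insert e S)" for w
  proof -
    obtain k where k: "w - k *\<^sub>R e \<in> span S" using mem unfolding span_breakdown_eq by blast
    define v where "v = w - k *\<^sub>R e + k *\<^sub>R pe"
    have v: "v \<in> span S" using k pe(1) by (simp add: v_def span_add span_scale)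
    have vW: "v \<in> W" using v SW by auto
    have w: "w = v + k *\<^sub>R f" by (simp add: v_def f_def algebra_simps)
    have "B q v = L v" using Bq[OF vW] Bf[OF v] p(2)[OF v] by simp
    moreover have "B q f = L f"
    proof -
      have "B p f = 0" using Bf[OF p(1)] sym pW fW by simp
      then show ?thesis using Bq[OF fW] insert.prems(3)[OF fW] by (auto simp: c_def)
    qed
    ultimately show ?thesis
      unfolding w using lin_onD[OF B[OF qW]] lin_onD[OF insert.prems(2)] vW fW W
      by (simp add: subspace_scale)
  qed
  ultimately show ?case by blast
qed

text \<open>The generators may lie outside \<open>W\<close>, which makes the passage to subspaces
  immediate; \<open>fin_dim_finite_basis\<close> recovers generators inside
  \<open>W\<close>.\<close>

definition fin_dim :: "'v::real_vector set \<Rightarrow> bool" where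
  "fin_dim W \<longleftrightarrow> subspace W \<and> (\<exists>S. finite S \<and> W \<subseteq> span S)"

lemma fin_dim_span: "finite S \<Longrightarrow> fin_dim (span S)"
  by (auto simp: fin_dim_def)

lemma fin_dim_subset: "fin_dim W \<Longrightarrow> subspace W' \<Longrightarrow> W' \<subseteq> W \<Longrightarrow> fin_dim W'"
  by (auto simp: fin_dim_def)

lemma fin_dim_finite_basis:
  assumes "fin_dim W"
  obtains S where "finite S" "span S = W" "S \<subseteq> W"
proof -
  obtain T where T: "finite T" "W \<subseteq> span T" and W: "subspace W" using assms by (auto simp: fin_dim_def)
  obtain S where S: "S \<subseteq> W" "independent S" "W \<subseteq> span S" by (rule basis_exists)
  then have "finite S" using independent_span_bound[of T S] T by auto
  moreover have "span S = W" using S W by (simp add: span_minimal subset_antisym)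
  ultimately show ?thesis using that[OF _ _ S(1)] by simp
qed

lemma riesz:
  fixes B :: "'v::real_vector \<Rightarrow> 'v \<Rightarrow> real"
  assumes "fin_dim W"
    and "\<And>u. u \<in> W \<Longrightarrow> lin_on W (B u)"
    and "\<And>u v. u \<in> W \<Longrightarrow> v \<in> W \<Longrightarrow> B u v = B v u"
    and "\<And>u. u \<in> W \<Longrightarrow> 0 \<le> B u u"
    and "lin_on W L"
    and "\<And>u. u \<in> W \<Longrightarrow> B u u = 0 \<Longrightarrow> L u = 0"
  shows "\<exists>p\<in>W. \<forall>w\<in>W. B p w = L w"
proof -
  obtain S where S: "finite S" "span S = W" "S \<subseteq> W" using fin_dim_finite_basis[OF assms(1)] .
  have W: "subspace W" using assms(1) by (simp add: fin_dim_def)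
  show ?thesis using riesz_span[OF W S(1,3) assms(2-6)] unfolding S(2) by blast
qed

section \<open>Bivariate polynomials\<close>

definition bimonom :: "nat \<Rightarrow> nat \<Rightarrow> point \<Rightarrow> real" where
  "bimonom i j = (\<lambda>z. fst z ^ i * snd z ^ j)"

definition exponents :: "int \<Rightarrow> (nat \<times> nat) set" where
  "exponents l = {(i, j). int i + int j \<le> l}"

lemma finite_exponents: "finite (exponents l)"
proof -
  have "exponents l \<subseteq> {..nat l} \<times> {..nat l}" by (auto simp: exponents_def)
  then show ?thesis by (rule finite_subset) simp
qed

lemma sum_fun_apply: "(\<Sum>i\<in>A. f i) x = (\<Sum>i\<in>A. f i x)"
  by (induction A rule: infinite_finite_induct) auto

lemma polys_iff:
  "p \<in> polys l \<longleftrightarrow> (\<exists>c. p = (\<Sum>(i, j)\<in>exponents l. c (i, j) *\<^sub>R bimonom i j))"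
proof
  assume "p \<in> polys l"
  then obtain c where c: "\<And>x y. p (x, y) = (\<Sum>(i, j)\<in>exponents l. c i j * x ^ i * y ^ j)"
    by (auto simp: polys_def exponents_def)
  have "p = (\<Sum>(i, j)\<in>exponents l. (\<lambda>(i, j). c i j) (i, j) *\<^sub>R bimonom i j)"
  proof
    fix z :: point
    show "p z = (\<Sum>(i, j)\<in>exponents l. (\<lambda>(i, j). c i j) (i, j) *\<^sub>R bimonom i j) z"
      using c[of "fst z" "snd z"]
      by (simp add: sum_fun_apply bimonom_def case_prod_beta mult.assoc)
  qed
  then show "\<exists>c. p = (\<Sum>(i, j)\<in>exponents l. c (i, j) *\<^sub>R bimonom i j)"
    by blast
next
  assume "\<exists>c. p = (\<Sum>(i, j)\<in>exponents l. c (i, j) *\<^sub>R bimonom i j)"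
  then obtain c where c: "p = (\<Sum>(i, j)\<in>exponents l. c (i, j) *\<^sub>R bimonom i j)" ..
  have "p (x, y) = (\<Sum>(i, j)\<in>exponents l. c (i, j) * x ^ i * y ^ j)" for x y
    unfolding c by (simp add: sum_fun_apply bimonom_def case_prod_beta mult.assoc)
  then show "p \<in> polys l"
    unfolding polys_def exponents_def by (auto intro!: exI[of _ "\<lambda>i j. c (i, j)"])
qed

text \<open>As a span, the space inherits finite dimension and an induction over monomials; negative
  degrees are covered, since \<open>exponents l\<close> is then empty.\<close>

lemma polys_eq_span: "polys l = span ((\<lambda>(i, j). bimonom i j) ` exponents l)"
proof
  show "polys l \<subseteq> span ((\<lambda>(i, j). bimonom i j) ` exponents l)"
    by (auto simp: polys_iff case_prod_beta intro!: span_sum span_scale) (force intro: span_base)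
next
  have "subspace (polys l)"
    unfolding subspace_def
  proof safe
    show "0 \<in> polys l"
      by (auto simp: polys_iff intro!: exI[of _ "\<lambda>_. 0"])
  next
    fix p q assume "p \<in> polys l" "q \<in> polys l"
    then obtain c d where "p = (\<Sum>(i, j)\<in>exponents l. c (i, j) *\<^sub>R bimonom i j)"
      "q = (\<Sum>(i, j)\<in>exponents l. d (i, j) *\<^sub>R bimonom i j)" by (auto simp: polys_iff)
    then have "p + q = (\<Sum>(i, j)\<in>exponents l. (\<lambda>x. c x + d x) (i, j) *\<^sub>R bimonom i j)"
      by (simp add: sum.distrib[symmetric] case_prod_beta scaleR_left_distrib)
    then show "p + q \<in> polys l" unfolding polys_iff by (intro exI[of _ "\<lambda>x. c x + d x"]) simp
  next
    fix r p assume "p \<in> polys l"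
    then obtain c where "p = (\<Sum>(i, j)\<in>exponents l. c (i, j) *\<^sub>R bimonom i j)" by (auto simp: polys_iff)
    then have "r *\<^sub>R p = (\<Sum>(i, j)\<in>exponents l. (\<lambda>x. r * c x) (i, j) *\<^sub>R bimonom i j)"
      by (simp add: scaleR_sum_right case_prod_beta)
    then show "r *\<^sub>R p \<in> polys l" unfolding polys_iff by (intro exI[of _ "\<lambda>x. r * c x"]) simp
  qed
  moreover have "bimonom i j \<in> polys l" if "(i, j) \<in> exponents l" for i j
  proof -
    have "bimonom i j = (\<Sum>x\<in>exponents l. if x = (i, j) then bimonom i j else 0)"
      using that finite_exponents by simp
    also have "\<dots> = (\<Sum>(i', j')\<in>exponents l. (\<lambda>x. if x = (i, j) then 1 else 0) (i', j') *\<^sub>R bimonom i' j')"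
      by (rule sum.cong) (auto simp: fun_eq_iff split: if_splits)
    finally show ?thesis unfolding polys_iff by (rule exI[of _ "\<lambda>x. if x = (i, j) then 1 else 0"])
  qed
  ultimately show "span ((\<lambda>(i, j). bimonom i j) ` exponents l) \<subseteq> polys l"
    by (intro span_minimal) auto
qed

lemma fin_dim_polys: "fin_dim (polys l)"
  unfolding polys_eq_span by (intro fin_dim_span finite_imageI finite_exponents)

lemma subspace_polys: "subspace (polys l)"
  unfolding polys_eq_span by simp

lemma bimonom_in_polys: "int i + int j \<le> l \<Longrightarrow> bimonom i j \<in> polys l"
  unfolding polys_eq_span by (rule span_base) (auto simp: exponents_def)

lemma polys_induct [consumes 1, case_names zero step]:
  assumes "p \<in> polys l"
    and "Q 0"
    and "\<And>c i j p. int i + int j \<le> l \<Longrightarrow> p \<in> polys l \<Longrightarrow> Q p \<Longrightarrow> Q (c *\<^sub>R bimonom i j + p)"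
  shows "Q p"
proof -
  from assms(1) have "p \<in> span ((\<lambda>(i, j). bimonom i j) ` exponents l)" by (simp only: polys_eq_span)
  then have "p \<in> polys l \<and> Q p"
  proof (induction rule: span_induct_alt)
    case base
    show ?case using assms(2) subspace_0[OF subspace_polys] by blast
  next
    case (step c x y)
    then obtain i j where ij: "x = bimonom i j" "int i + int j \<le> l" by (auto simp: exponents_def)
    then have "c *\<^sub>R x + y \<in> polys l"
      using step bimonom_in_polys by (intro subspace_add subspace_scale subspace_polys) auto
    then show ?case using step assms(3)[OF ij(2)] unfolding ij(1) by blast
  qed
  then show ?thesis ..
qed

lemma polys_add: "p \<in> polys l \<Longrightarrow> q \<in> polys l \<Longrightarrow> (\<lambda>z. p z + q z) \<in> polys l"
  using subspace_add[OF subspace_polys, of p l q] by (simp add: plus_fun_def)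

lemma polys_scale: "p \<in> polys l \<Longrightarrow> (\<lambda>z. c * p z) \<in> polys l"
  using subspace_scale[OF subspace_polys, of p l c] by (simp add: scaleR_fun_def)

lemma polys_minus: "p \<in> polys l \<Longrightarrow> (\<lambda>z. - p z) \<in> polys l"
  using polys_scale[of p l "-1"] by simp

lemma polys_diff: "p \<in> polys l \<Longrightarrow> q \<in> polys l \<Longrightarrow> (\<lambda>z. p z - q z) \<in> polys l"
  using polys_add[OF _ polys_minus] by simp

lemma polys_zero: "(\<lambda>z. 0) \<in> polys l"
  using subspace_0[OF subspace_polys, of l] by (simp add: zero_fun_def)

lemma polys_le: "l \<le> m \<Longrightarrow> p \<in> polys l \<Longrightarrow> p \<in> polys m"
  unfolding polys_eq_span by (erule subsetD[OF span_mono, rotated]) (auto simp: exponents_def)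

lemma polys_const: "0 \<le> l \<Longrightarrow> (\<lambda>z. c) \<in> polys l"
  using polys_scale[OF bimonom_in_polys[of 0 0 l], of c] by (simp add: bimonom_def)

lemma polys_sum: "finite A \<Longrightarrow> (\<And>i. i \<in> A \<Longrightarrow> f i \<in> polys l) \<Longrightarrow> (\<lambda>z. \<Sum>i\<in>A. f i z) \<in> polys l"
  by (induction A rule: finite_induct) (auto intro: polys_zero polys_add)

lemma polys_mult:
  assumes "p \<in> polys l" "q \<in> polys m"
  shows "(\<lambda>z. p z * q z) \<in> polys (l + m)"
  using assms(1)
proof (induction p rule: polys_induct)
  case zero
  show ?case by (simp add: polys_zero)
next
  case (step c i j p)
  have "(\<lambda>z. bimonom i j z * q z) \<in> polys (l + m)"
    using assms(2)
  proof (induction q rule: polys_induct)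
    case zero
    show ?case by (simp add: polys_zero)
  next
    case (step d i' j' q)
    have "bimonom (i + i') (j + j') \<in> polys (l + m)"
      using step \<open>int i + int j \<le> l\<close> by (intro bimonom_in_polys) auto
    then have "(\<lambda>z. d * bimonom (i + i') (j + j') z + bimonom i j z * q z) \<in> polys (l + m)"
      by (intro polys_add polys_scale step.IH)
    then show ?case by (simp add: bimonom_def power_add algebra_simps)
  qed
  then have "(\<lambda>z. c * (bimonom i j z * q z) + p z * q z) \<in> polys (l + m)"
    by (intro polys_add polys_scale step.IH)
  then show ?case by (simp add: algebra_simps)
qed

lemma polys_power:
  assumes "p \<in> polys l" "0 \<le> l"
  shows "(\<lambda>z. p z ^ n) \<in> polys (int n * l)"
proof (induction n)
  case 0
  show ?case by (simp add: polys_const)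
next
  case (Suc n)
  show ?case using polys_mult[OF assms(1) Suc] by (simp add: algebra_simps)
qed

lemma continuous_on_polys:
  assumes "p \<in> polys l"
  shows "continuous_on S p"
  using assms
proof (induction p rule: polys_induct)
  case zero
  show ?case by (simp add: zero_fun_def)
next
  case (step c i j p)
  have "continuous_on S (\<lambda>z. c * bimonom i j z + p z)"
    unfolding bimonom_def using step.IH by (intro continuous_intros)
  then show ?case by (simp add: plus_fun_def)
qed

section \<open>Partial derivatives of polynomials\<close>

definition has_grad :: "(point \<Rightarrow> real) \<Rightarrow> (point \<Rightarrow> real) \<Rightarrow> (point \<Rightarrow> real) \<Rightarrow> bool" where
  "has_grad p a b \<longleftrightarrow> (\<forall>z. (p has_derivative (\<lambda>h. fst h * a z + snd h * b z)) (at z))"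

definition dx :: "(point \<Rightarrow> real) \<Rightarrow> point \<Rightarrow> real" where
  "dx p z = fst (grad p z)"

definition dy :: "(point \<Rightarrow> real) \<Rightarrow> point \<Rightarrow> real" where
  "dy p z = snd (grad p z)"

lemma has_grad_imp_grad:
  assumes "has_grad p a b"
  shows "grad p z = (a z, b z)"
  unfolding grad_def
proof (rule the_equality)
  show "GDERIV p z :> (a z, b z)"
    using spec[OF assms[unfolded has_grad_def], of z] by (simp add: gderiv_def inner_prod_def)
next
  fix D assume "GDERIV p z :> D"
  then have "(p has_derivative (\<lambda>h. h \<bullet> D)) (at z)" by (simp add: gderiv_def)
  moreover have "(p has_derivative (\<lambda>h. fst h * a z + snd h * b z)) (at z)"
    using assms unfolding has_grad_def by blast
  ultimately have "(\<lambda>h. h \<bullet> D) = (\<lambda>h. fst h * a z + snd h * b z)" by (rule has_derivative_unique)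
  from fun_cong[OF this, of "(1, 0)"] fun_cong[OF this, of "(0, 1)"]
  show "D = (a z, b z)" by (cases D) auto
qed

lemma has_grad_imp: "has_grad p a b \<Longrightarrow> dx p = a" "has_grad p a b \<Longrightarrow> dy p = b"
  by (auto simp: dx_def dy_def has_grad_imp_grad)

text \<open>For \<open>i = 0\<close> the truncated exponent \<open>i - 1\<close> is harmless because
  the factor \<open>i\<close> vanishes; likewise for \<open>j\<close>.\<close>

lemma has_grad_bimonom: "has_grad (bimonom i j) (\<lambda>z. i * bimonom (i - 1) j z) (\<lambda>z. j * bimonom i (j - 1) z)"
  unfolding has_grad_def bimonom_def
  by (auto intro!: derivative_eq_intros simp: algebra_simps)

lemma has_grad_zero: "has_grad 0 (\<lambda>z. 0) (\<lambda>z. 0)"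
  by (simp add: has_grad_def zero_fun_def)

lemma has_grad_lincomb:
  assumes "has_grad p a b" "has_grad q a' b'"
  shows "has_grad (\<lambda>z. p z + q z) (\<lambda>z. a z + a' z) (\<lambda>z. b z + b' z)"
    and "has_grad (\<lambda>z. c * p z) (\<lambda>z. c * a z) (\<lambda>z. c * b z)"
    and "has_grad (\<lambda>z. p z - q z) (\<lambda>z. a z - a' z) (\<lambda>z. b z - b' z)"
proof -
  have p: "(p has_derivative (\<lambda>h. fst h * a z + snd h * b z)) (at z)"
    and q: "(q has_derivative (\<lambda>h. fst h * a' z + snd h * b' z)) (at z)" for z
    using assms unfolding has_grad_def by blast+
  show "has_grad (\<lambda>z. p z + q z) (\<lambda>z. a z + a' z) (\<lambda>z. b z + b' z)"
    unfolding has_grad_def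
    by (intro allI has_derivative_eq_rhs[OF has_derivative_add[OF p q]]) (auto simp: algebra_simps)
  show "has_grad (\<lambda>z. c * p z) (\<lambda>z. c * a z) (\<lambda>z. c * b z)"
    unfolding has_grad_def
    by (intro allI has_derivative_eq_rhs[OF has_derivative_mult_right[OF p]]) (auto simp: algebra_simps)
  show "has_grad (\<lambda>z. p z - q z) (\<lambda>z. a z - a' z) (\<lambda>z. b z - b' z)"
    unfolding has_grad_def
    by (intro allI has_derivative_eq_rhs[OF has_derivative_diff[OF p q]]) (auto simp: algebra_simps)
qed

lemma has_grad_combine:
  "has_grad p a b \<Longrightarrow> has_grad q a' b' \<Longrightarrow>
    has_grad (c *\<^sub>R p + q) (\<lambda>z. c * a z + a' z) (\<lambda>z. c * b z + b' z)"
  using has_grad_lincomb(1)[OF has_grad_lincomb(2)] by (simp add: plus_fun_def scaleR_fun_def)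

lemma polys_pred_bimonom:
  assumes "int i + int j \<le> l"
  shows "(\<lambda>z. i * bimonom (i - 1) j z) \<in> polys (l - 1)" "(\<lambda>z. j * bimonom i (j - 1) z) \<in> polys (l - 1)"
  using assms by (cases i; cases j; auto intro!: polys_zero polys_scale bimonom_in_polys)+

text \<open>The shared witness \<open>ab\<close> expresses the equality of the mixed derivatives,
  which for monomials can be read off. Such witnesses give \<open>dx p\<close> and
  \<open>dy p\<close> their meaning, as \<open>grad\<close> is a definite description.\<close>

lemma polys_second_order:
  assumes "p \<in> polys l"
  shows "\<exists>a b aa ab bb. has_grad p a b \<and> has_grad a aa ab \<and> has_grad b ab bb \<and>
    a \<in> polys (l - 1) \<and> b \<in> polys (l - 1)"
  using assms
proof (induction p rule: polys_induct)
  case zero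
  have "has_grad (\<lambda>z. 0) (\<lambda>z. 0) (\<lambda>z. 0)" using has_grad_zero by (simp add: zero_fun_def)
  then show ?case using has_grad_zero polys_zero by blast
next
  case (step c i j p)
  then obtain a b aa ab bb where IH: "has_grad p a b" "has_grad a aa ab" "has_grad b ab bb"
    "a \<in> polys (l - 1)" "b \<in> polys (l - 1)" by blast
  let ?a = "\<lambda>z. i * bimonom (i - 1) j z" and ?b = "\<lambda>z. j * bimonom i (j - 1) z"
  have m: "has_grad (k *\<^sub>R bimonom i' j') (\<lambda>z. k * (i' * bimonom (i' - 1) j' z)) (\<lambda>z. k * (j' * bimonom i' (j' - 1) z))"
    for k i' j'
    using has_grad_combine[OF has_grad_bimonom has_grad_zero] by simp
  note first = has_grad_combine[OF has_grad_bimonom IH(1), of c i j]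
  have a: "has_grad (c *\<^sub>R (i *\<^sub>R bimonom (i - 1) j) + a)
     (\<lambda>z. c * (i * ((i - 1) * bimonom (i - 1 - 1) j z)) + aa z)
     (\<lambda>z. c * (i * (j * bimonom (i - 1) (j - 1) z)) + ab z)"
    using has_grad_combine[OF m IH(2)] .
  have b: "has_grad (c *\<^sub>R (j *\<^sub>R bimonom i (j - 1)) + b)
     (\<lambda>z. c * (j * (i * bimonom (i - 1) (j - 1) z)) + ab z)
     (\<lambda>z. c * (j * ((j - 1) * bimonom i (j - 1 - 1) z)) + bb z)"
    using has_grad_combine[OF m IH(3)] .
  have e: "(\<lambda>z. c * (j * (i * bimonom (i - 1) (j - 1) z)) + ab z) = (\<lambda>z. c * (i * (j * bimonom (i - 1) (j - 1) z)) + ab z)"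
    by (auto simp: algebra_simps)
  have p: "(\<lambda>z. c * ?a z + a z) \<in> polys (l - 1)" "(\<lambda>z. c * ?b z + b z) \<in> polys (l - 1)"
    using step IH by (intro polys_add polys_scale polys_pred_bimonom; simp)+
  have "has_grad (\<lambda>z. c * ?a z + a z)
     (\<lambda>z. c * (i * ((i - 1) * bimonom (i - 1 - 1) j z)) + aa z)
     (\<lambda>z. c * (i * (j * bimonom (i - 1) (j - 1) z)) + ab z)"
    using a by (simp add: plus_fun_def scaleR_fun_def)
  moreover have "has_grad (\<lambda>z. c * ?b z + b z)
     (\<lambda>z. c * (i * (j * bimonom (i - 1) (j - 1) z)) + ab z)
     (\<lambda>z. c * (j * ((j - 1) * bimonom i (j - 1 - 1) z)) + bb z)"
    using b unfolding e by (simp add: plus_fun_def scaleR_fun_def)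
  ultimately show ?case
    by (intro exI conjI) (rule first p | assumption)+
qed

lemma polys_has_grad:
  assumes "p \<in> polys l"
  shows "has_grad p (dx p) (dy p)" and "dx p \<in> polys (l - 1)" and "dy p \<in> polys (l - 1)"
    and "dx (dy p) = dy (dx p)"
proof -
  obtain a b aa ab bb where h: "has_grad p a b" "has_grad a aa ab" "has_grad b ab bb"
    "a \<in> polys (l - 1)" "b \<in> polys (l - 1)" using polys_second_order[OF assms] by blast
  then show "has_grad p (dx p) (dy p)" and "dx p \<in> polys (l - 1)" and "dy p \<in> polys (l - 1)"
    and "dx (dy p) = dy (dx p)"
    by (simp_all add: has_grad_imp[OF h(1)] has_grad_imp[OF h(2)] has_grad_imp[OF h(3)])
qed

lemma grad_eq: "grad p z = (dx p z, dy p z)"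
  by (simp add: dx_def dy_def)

lemma rot_eq: "rot p z = (dy p z, - dx p z)"
  by (simp add: rot_def rotation_def grad_eq)

lemma dx_lincomb:
  assumes "p \<in> polys l" "q \<in> polys m"
  shows "dx (\<lambda>z. p z + q z) = (\<lambda>z. dx p z + dx q z)" "dy (\<lambda>z. p z + q z) = (\<lambda>z. dy p z + dy q z)"
    "dx (\<lambda>z. c * p z) = (\<lambda>z. c * dx p z)" "dy (\<lambda>z. c * p z) = (\<lambda>z. c * dy p z)"
    "dx (\<lambda>z. p z - q z) = (\<lambda>z. dx p z - dx q z)" "dy (\<lambda>z. p z - q z) = (\<lambda>z. dy p z - dy q z)"
  using has_grad_lincomb[OF polys_has_grad(1)[OF assms(1)] polys_has_grad(1)[OF assms(2)]]
  by (auto dest: has_grad_imp)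

lemma dx_const: "dx (\<lambda>z. c) = (\<lambda>z. 0)" "dy (\<lambda>z. c) = (\<lambda>z. 0)"
  using has_grad_imp[of "\<lambda>z. c" "\<lambda>z. 0" "\<lambda>z. 0"] by (simp_all add: has_grad_def)

text \<open>This makes the divergence surjective onto polynomials of one degree less, by fields with
  a single nonzero component, and supplies the potentials in
  \<open>div_free_imp_rot\<close>.\<close>

lemma polys_antideriv:
  assumes "p \<in> polys l"
  shows "\<exists>P\<in>polys (l + 1). dx P = p" and "\<exists>P\<in>polys (l + 1). dy P = p"
proof -
  show "\<exists>P\<in>polys (l + 1). dx P = p"
    using assms
  proof (induction p rule: polys_induct)
    case zero
    show ?case using dx_const(1)[of 0] polys_zero by (auto simp: zero_fun_def)
  next
    case (step c i j p)
    then obtain P where P: "P \<in> polys (l + 1)" "dx P = p" by blast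
    have m: "bimonom (Suc i) j \<in> polys (l + 1)" using step by (intro bimonom_in_polys) auto
    let ?P = "\<lambda>z. (c / Suc i) * bimonom (Suc i) j z + P z"
    have "?P \<in> polys (l + 1)" using P m by (intro polys_add polys_scale)
    moreover have "dx ?P = c *\<^sub>R bimonom i j + p"
      unfolding dx_lincomb(1)[OF polys_scale[OF m] P(1)] dx_lincomb(3)[OF m m] has_grad_imp(1)[OF has_grad_bimonom] P(2)
      by (rule ext) simp
    ultimately show ?case by blast
  qed
  show "\<exists>P\<in>polys (l + 1). dy P = p"
    using assms
  proof (induction p rule: polys_induct)
    case zero
    show ?case using dx_const(2)[of 0] polys_zero by (auto simp: zero_fun_def)
  next
    case (step c i j p)
    then obtain P where P: "P \<in> polys (l + 1)" "dy P = p" by blast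
    have m: "bimonom i (Suc j) \<in> polys (l + 1)" using step by (intro bimonom_in_polys) auto
    let ?P = "\<lambda>z. (c / Suc j) * bimonom i (Suc j) z + P z"
    have "?P \<in> polys (l + 1)" using P m by (intro polys_add polys_scale)
    moreover have "dy ?P = c *\<^sub>R bimonom i j + p"
      unfolding dx_lincomb(2)[OF polys_scale[OF m] P(1)] dx_lincomb(4)[OF m m] has_grad_imp(2)[OF has_grad_bimonom] P(2)
      by (rule ext) simp
    ultimately show ?case by blast
  qed
qed

lemma polys_slice:
  assumes "p \<in> polys l"
  shows "(\<lambda>z. p (fst z, 0)) \<in> polys l"
  using assms
proof (induction p rule: polys_induct)
  case zero
  show ?case by (simp add: polys_zero)
next
  case (step c i j p)
  have "(\<lambda>z. bimonom i j (fst z, 0)) \<in> polys l"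
  proof (cases j)
    case 0
    then show ?thesis using bimonom_in_polys[of i 0 l] step by (simp add: bimonom_def)
  qed (simp add: bimonom_def polys_zero)
  then have "(\<lambda>z. c * bimonom i j (fst z, 0) + p (fst z, 0)) \<in> polys l"
    by (intro polys_add polys_scale step.IH)
  then show ?case by simp
qed

lemma has_grad_line_derivative:
  assumes "has_grad p a b"
  shows "((\<lambda>s. p (x + s *\<^sub>R d)) has_real_derivative (fst d * a (x + s *\<^sub>R d) + snd d * b (x + s *\<^sub>R d))) (at s)"
proof -
  have "((\<lambda>s. x + s *\<^sub>R d) has_derivative (\<lambda>h. h *\<^sub>R d)) (at s)"
    by (auto intro!: derivative_eq_intros)
  from has_derivative_compose[OF this spec[OF assms[unfolded has_grad_def], of "x + s *\<^sub>R d"]]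
  have "((\<lambda>s. p (x + s *\<^sub>R d)) has_derivative
     (\<lambda>h. fst (h *\<^sub>R d) * a (x + s *\<^sub>R d) + snd (h *\<^sub>R d) * b (x + s *\<^sub>R d))) (at s)" .
  then show ?thesis unfolding has_field_derivative_def
    by (rule has_derivative_eq_rhs) (auto simp: algebra_simps)
qed

lemma dy_zero_imp_slice:
  assumes "has_grad v a (\<lambda>z. 0)"
  shows "v z = v (fst z, 0)"
proof -
  have "((\<lambda>s. v ((fst z, 0) + s *\<^sub>R (0, 1))) has_real_derivative 0) (at s)" for s
    using has_grad_line_derivative[OF assms, of "(fst z, 0)" "(0, 1)" s] by simp
  from DERIV_isconst_all[OF allI, OF this, of "snd z" 0] show ?thesis by (cases z) simp
qed

text \<open>The potential is explicit: integrate \<open>p\<close> in the second variable to get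
  \<open>P\<close>. The remaining error \<open>v = q + dx P\<close> depends on the first variable
  only, and subtracting a primitive of it in that variable leaves \<open>dy P\<close>
  unchanged.\<close>

lemma div_free_imp_rot:
  assumes p: "p \<in> polys l" and q: "q \<in> polys l" and div: "\<And>z. dx p z + dy q z = 0"
  shows "\<exists>r\<in>polys (l + 1). \<forall>z. rot r z = (p z, q z)"
proof -
  obtain P where P: "P \<in> polys (l + 1)" "dy P = p" using polys_antideriv(2)[OF p] by blast
  define v where "v = (\<lambda>z. q z + dx P z)"
  have dxP: "dx P \<in> polys l" using polys_has_grad(2)[OF P(1)] by simp
  have v: "v \<in> polys l" unfolding v_def using q dxP by (rule polys_add)
  have "dy v = (\<lambda>z. dy q z + dy (dx P) z)" unfolding v_def by (rule dx_lincomb(2)[OF q dxP])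
  also have "\<dots> = (\<lambda>z. 0)" using div polys_has_grad(4)[OF P(1)] P(2) by (auto simp: fun_eq_iff add.commute)
  finally have "has_grad v (dx v) (\<lambda>z. 0)" using polys_has_grad(1)[OF v] by simp
  then have v_slice: "v z = v (fst z, 0)" for z by (rule dy_zero_imp_slice)
  obtain Q where Q: "Q \<in> polys (l + 1)" "dx Q = v" using polys_antideriv(1)[OF v] by blast
  \<comment> \<open>The primitive \<open>Q\<close> may still vary in the second variable; slicing
    removes this and keeps the derivative \<open>v\<close>, which equals its own slice.\<close>
  define Q0 where "Q0 = (\<lambda>z :: point. Q (fst z, 0 :: real))"
  have Q0: "Q0 \<in> polys (l + 1)" unfolding Q0_def by (rule polys_slice[OF Q(1)])
  have "has_grad Q0 v (\<lambda>z. 0)"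
    unfolding has_grad_def
  proof
    fix z :: point
    have "((\<lambda>z :: point. (fst z, 0 :: real)) has_derivative (\<lambda>h. (fst h, 0))) (at z)"
      by (auto intro!: derivative_eq_intros)
    from has_derivative_compose[OF this] polys_has_grad(1)[OF Q(1)]
    have "(Q0 has_derivative (\<lambda>h. fst (fst h, 0 :: real) * v (fst z, 0) + snd (fst h, 0) * dy Q (fst z, 0))) (at z)"
      unfolding Q0_def has_grad_def Q(2) by blast
    then show "(Q0 has_derivative (\<lambda>h. fst h * v z + snd h * 0)) (at z)"
      using v_slice[of z] by simp
  qed
  note Q0d = has_grad_imp[OF this]
  have "rot (\<lambda>z. P z - Q0 z) z = (p z, q z)" for z
    using dx_lincomb(5,6)[OF P(1) Q0] Q0d P(2) by (simp add: rot_eq v_def)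
  moreover have "(\<lambda>z. P z - Q0 z) \<in> polys (l + 1)" using P(1) Q0 by (rule polys_diff)
  ultimately show ?thesis by blast
qed

section \<open>Polynomial fields and their divergence\<close>

lemma mem_vpolys: "w \<in> vpolys l \<longleftrightarrow> (\<lambda>z. fst (w z)) \<in> polys l \<and> (\<lambda>z. snd (w z)) \<in> polys l"
proof
  assume "(\<lambda>z. fst (w z)) \<in> polys l \<and> (\<lambda>z. snd (w z)) \<in> polys l"
  then show "w \<in> vpolys l"
    unfolding vpolys_def by (intro CollectI exI[of _ "\<lambda>z. fst (w z)"] exI[of _ "\<lambda>z. snd (w z)"]) simp
qed (auto simp: vpolys_def)

lemma fin_dim_vpolys: "fin_dim (vpolys l)"
  unfolding fin_dim_def
proof
  show "subspace (vpolys l)"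
    unfolding subspace_def by (auto simp: mem_vpolys polys_zero polys_add polys_scale)
  obtain S where S: "finite S" "span S = polys l" using fin_dim_finite_basis[OF fin_dim_polys] by metis
  let ?f = "\<lambda>(p :: point \<Rightarrow> real) z. (p z, 0 :: real)" and ?g = "\<lambda>(p :: point \<Rightarrow> real) z. (0 :: real, p z)"
  have lin: "linear ?f" "linear ?g" by (auto intro!: linearI simp: fun_eq_iff)
  have "w \<in> span (?f ` S \<union> ?g ` S)" if w: "w \<in> vpolys l" for w
  proof -
    have "?f (\<lambda>z. fst (w z)) \<in> span (?f ` S)" "?g (\<lambda>z. snd (w z)) \<in> span (?g ` S)"
      using w by (auto simp: linear_span_image[OF lin(1)] linear_span_image[OF lin(2)] S(2) mem_vpolys)
    then have "?f (\<lambda>z. fst (w z)) + ?g (\<lambda>z. snd (w z)) \<in> span (?f ` S \<union> ?g ` S)"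
      by (intro span_add; elim subsetD[OF span_mono, rotated]; simp)
    then show ?thesis by (simp add: plus_fun_def)
  qed
  then show "\<exists>S. finite S \<and> vpolys l \<subseteq> span S" using S(1) by (intro exI[of _ "?f ` S \<union> ?g ` S"]) auto
qed

lemma subspace_vpolys: "subspace (vpolys l)"
  using fin_dim_vpolys by (simp add: fin_dim_def)

lemma continuous_on_vpolys: "w \<in> vpolys l \<Longrightarrow> continuous_on S w"
  using continuous_on_Pair[of S "\<lambda>z. fst (w z)" "\<lambda>z. snd (w z)"] by (auto simp: mem_vpolys continuous_on_polys)

lemma divergence_eq:
  assumes "w \<in> vpolys l"
  shows "divergence w z = dx (\<lambda>z. fst (w z)) z + dy (\<lambda>z. snd (w z)) z"
proof -
  let ?p = "\<lambda>z. fst (w z)" and ?q = "\<lambda>z. snd (w z)"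
  have p: "(?p has_derivative (\<lambda>h. fst h * dx ?p z + snd h * dy ?p z)) (at z)"
    and q: "(?q has_derivative (\<lambda>h. fst h * dx ?q z + snd h * dy ?q z)) (at z)"
    using assms polys_has_grad(1) unfolding mem_vpolys has_grad_def by blast+
  have "(w has_derivative (\<lambda>h. (fst h * dx ?p z + snd h * dy ?p z, fst h * dx ?q z + snd h * dy ?q z))) (at z)"
    using has_derivative_Pair[OF p q] by simp
  then have "frechet_derivative w (at z) = (\<lambda>h. (fst h * dx ?p z + snd h * dy ?p z, fst h * dx ?q z + snd h * dy ?q z))"
    by (rule frechet_derivative_at[symmetric])
  then show ?thesis
    unfolding divergence_def Basis_prod_def by (subst sum.union_disjoint) auto
qed

lemma rot_in_vpolys: "r \<in> polys (l + 1) \<Longrightarrow> rot r \<in> vpolys l"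
  using polys_has_grad(2,3)[of r "l + 1"] by (auto simp: mem_vpolys rot_eq polys_minus)

lemma divergence_rot:
  assumes "r \<in> polys l"
  shows "divergence (rot r) z = 0"
proof -
  have "rot r \<in> vpolys (l - 1)" using assms by (intro rot_in_vpolys) simp
  moreover have "dy (\<lambda>z. - dx r z) = (\<lambda>z. - dy (dx r) z)"
    using dx_lincomb(4)[OF polys_has_grad(2)[OF assms] polys_zero, of "-1"] by simp
  ultimately show ?thesis using polys_has_grad(4)[OF assms] by (simp add: divergence_eq rot_eq)
qed

text \<open>The bound is on coefficients and not on \<open>degree\<close>, so that a negative
  \<open>l\<close> leaves the zero polynomial alone, in agreement with
  \<open>polys l\<close>.\<close>

definition upoly :: "int \<Rightarrow> real poly set" where
  "upoly l = {P. \<forall>i. l < int i \<longrightarrow> coeff P i = 0}"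

lemma upoly_degree: "int (degree P) \<le> l \<Longrightarrow> P \<in> upoly l"
  by (auto simp: upoly_def coeff_eq_0)

lemma polys_trace:
  assumes "p \<in> polys l"
  shows "\<exists>P\<in>upoly l. \<forall>s. p (linepath x y s) = poly P s"
  using assms
proof (induction p rule: polys_induct)
  case zero
  show ?case by (intro bexI[of _ 0]) (auto simp: upoly_def)
next
  case (step c i j p)
  then obtain P where P: "P \<in> upoly l" "\<And>s. p (linepath x y s) = poly P s" by blast
  let ?f = "[:fst x, fst y - fst x:]" and ?g = "[:snd x, snd y - snd x:]"
  let ?M = "?f ^ i * ?g ^ j"
  have "degree ?M \<le> degree (?f ^ i) + degree (?g ^ j)" by (rule degree_mult_le)
  also have "\<dots> \<le> i + j"
    using degree_power_le[of ?f i] degree_power_le[of ?g j] by (simp split: if_splits)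
  finally have "?M \<in> upoly l" using step.hyps by (intro upoly_degree) simp
  then have "smult c ?M + P \<in> upoly l" using P(1) by (simp add: upoly_def)
  moreover have "(c *\<^sub>R bimonom i j + p) (linepath x y s) = poly (smult c ?M + P) s" for s
    using P(2) by (simp add: bimonom_def linepath_def algebra_simps)
  ultimately show ?case by blast
qed

lemma polys_extend_trace:
  assumes "P \<in> upoly l" "x \<noteq> y"
  shows "\<exists>p\<in>polys l. \<forall>s. p (linepath x y s) = poly P s"
proof -
  define d where "d = y - x"
  \<comment> \<open>The parameter of the orthogonal projection of \<open>z\<close> on the line
    through \<open>x\<close> and \<open>y\<close>, written in monomials so that its degree is
    visible.\<close>
  define \<sigma> where "\<sigma> = (\<lambda>z :: point. (fst d / (d \<bullet> d)) * bimonom 1 0 z + ((snd d / (d \<bullet> d)) * bimonom 0 1 z + (- (x \<bullet> d) / (d \<bullet> d)) * bimonom 0 0 z))"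
  have \<sigma>: "\<sigma> \<in> polys 1"
    unfolding \<sigma>_def by (intro polys_add polys_scale bimonom_in_polys) auto
  have \<sigma>_line: "\<sigma> (linepath x y s) = s" for s
  proof -
    have z: "linepath x y s = x + s *\<^sub>R d" by (simp add: linepath_def d_def algebra_simps)
    have "\<sigma> z = ((z - x) \<bullet> d) / (d \<bullet> d)" for z
      by (simp add: \<sigma>_def bimonom_def inner_prod_def field_simps add_divide_distrib[symmetric] diff_divide_distrib[symmetric])
    then show ?thesis using assms(2) unfolding z by (simp add: d_def)
  qed
  have "(\<lambda>z. coeff P i * \<sigma> z ^ i) \<in> polys l" for i
  proof (cases "int i \<le> l")
    case True
    then show ?thesis using polys_le[OF _ polys_power[OF \<sigma>, of i]] by (intro polys_scale) auto
  next
    case False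
    then show ?thesis using assms(1) by (simp add: upoly_def polys_zero)
  qed
  then have "(\<lambda>z. \<Sum>i\<le>degree P. coeff P i * \<sigma> z ^ i) \<in> polys l" by (intro polys_sum) auto
  moreover have "(\<Sum>i\<le>degree P. coeff P i * \<sigma> (linepath x y s) ^ i) = poly P s" for s
    by (simp add: \<sigma>_line poly_altdef)
  ultimately show ?thesis by (intro bexI) auto
qed

text \<open>On the line from a point of \<open>F\<close> to \<open>z\<close> the polynomial is
  univariate with infinitely many roots. Hence polynomials are determined by their restriction to
  \<open>F\<close>.\<close>

lemma polys_zero_on_open:
  assumes "p \<in> polys l" "open F" "F \<noteq> {}" "\<And>z. z \<in> F \<Longrightarrow> p z = 0"
  shows "p z = 0"
proof -
  obtain x where x: "x \<in> F" using assms(3) by auto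
  obtain P where P: "\<And>s. p (linepath x z s) = poly P s" using polys_trace[OF assms(1)] by blast
  have "open (linepath x z -` F)"
    using assms(2) by (intro continuous_open_vimage) (auto simp: linepath_def intro!: continuous_intros)
  moreover have "0 \<in> linepath x z -` F" using x by (simp add: linepath_def)
  ultimately have "infinite (linepath x z -` F)"
    by (metis empty_iff finite_imp_not_open)
  moreover have "linepath x z -` F \<subseteq> {s. poly P s = 0}" using assms(4) P by (metis (mono_tags) mem_Collect_eq subsetI vimageE)
  ultimately have "P = 0" using poly_roots_finite finite_subset by metis
  then show ?thesis using P[of 1] by (simp add: linepath_def)
qed

section \<open>Local structure of the boundary of a polygon\<close>

definition perp :: "point \<Rightarrow> point" where
  "perp d = (- snd d, fst d)"

lemma rotation_pi_half: "rotation (pi / 2) d = perp d"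
  by (simp add: rotation_def perp_def)

lemma perp_simps [simp]:
  "perp (- d) = - perp d" "perp (c *\<^sub>R d) = c *\<^sub>R perp d" "perp (perp d) = - d"
  "d \<bullet> perp d = 0" "perp d \<bullet> d = 0" "perp d \<bullet> perp e = d \<bullet> e" "perp d = 0 \<longleftrightarrow> d = 0"
  by (auto simp: perp_def inner_prod_def prod_eq_iff)

lemma perp_add: "perp (d + e) = perp d + perp e"
  by (simp add: perp_def)

lemma inner_perp_swap: "perp d \<bullet> e = - (d \<bullet> perp e)"
  by (simp add: perp_def inner_prod_def)

lemma orthogonal_decomposition:
  assumes "norm a = 1"
  shows "y = (y \<bullet> a) *\<^sub>R a + (y \<bullet> perp a) *\<^sub>R perp a"
proof -
  have "a \<bullet> a = 1" using assms by (simp add: norm_eq_1)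
  then have n: "fst a * fst a + snd a * snd a = 1" by (simp add: inner_prod_def)
  have "(y \<bullet> a) * fst a - (y \<bullet> perp a) * snd a = fst y * (fst a * fst a + snd a * snd a)"
    "(y \<bullet> a) * snd a + (y \<bullet> perp a) * fst a = snd y * (fst a * fst a + snd a * snd a)"
    by (simp_all add: inner_prod_def perp_def algebra_simps)
  then show ?thesis unfolding n by (simp add: prod_eq_iff perp_def)
qed

lemma orthogonal_to_perp_imp_parallel:
  assumes "d \<bullet> perp e = 0" "e \<noteq> 0"
  shows "\<exists>c. d = c *\<^sub>R e"
proof
  have n: "fst e * fst e + snd e * snd e \<noteq> 0" using assms(2) by (simp add: sum_squares_eq_zero_iff prod_eq_iff)
  have o: "snd d * fst e = fst d * snd e" using assms(1) by (simp add: inner_prod_def perp_def)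
  show "d = ((d \<bullet> e) / (e \<bullet> e)) *\<^sub>R e"
  proof (rule prod_eqI)
    have "fst d * (fst e * fst e + snd e * snd e) = (fst d * fst e + snd d * snd e) * fst e" using o by algebra
    then show "fst d = fst (((d \<bullet> e) / (e \<bullet> e)) *\<^sub>R e)" using n by (simp add: inner_prod_def field_simps)
    have "snd d * (fst e * fst e + snd e * snd e) = (fst d * fst e + snd d * snd e) * snd e" using o by algebra
    then show "snd d = snd (((d \<bullet> e) / (e \<bullet> e)) *\<^sub>R e)" using n by (simp add: inner_prod_def field_simps)
  qed
qed

lemma closed_segment_subset_line:
  assumes "y \<in> closed_segment a b"
  shows "perp (b - a) \<bullet> y = perp (b - a) \<bullet> a"
proof -
  obtain u where "y = (1 - u) *\<^sub>R a + u *\<^sub>R b" using assms by (auto simp: closed_segment_def)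
  then have "y = a + u *\<^sub>R (b - a)" by (simp add: algebra_simps)
  then show ?thesis by (simp add: inner_add_right)
qed

lemma frontier_triangle_subset_lines:
  assumes "triangle T"
  shows "\<exists>N. finite N \<and> (\<forall>(n, c)\<in>N. n \<noteq> 0) \<and> frontier T \<subseteq> (\<Union>(n, c)\<in>N. {y. n \<bullet> y = (c :: real)})"
proof -
  obtain a b c where abc: "\<not> collinear {a, b, c}" "T = convex hull {a, b, c}"
    using assms by (auto simp: triangle_def)
  have neq: "b - a \<noteq> 0" "c - b \<noteq> 0" "a - c \<noteq> 0"
    using abc(1) by (auto simp: insert_commute)
  let ?N = "(\<lambda>(x, y). (perp (y - x), perp (y - x) \<bullet> x)) ` {(a, b), (b, c), (c, a)}"
  have "frontier T = closed_segment a b \<union> closed_segment b c \<union> closed_segment c a"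
    unfolding abc(2) by (rule frontier_of_triangle) simp
  moreover have "closed_segment x y \<subseteq> (\<Union>(n, c)\<in>?N. {y. n \<bullet> y = c})" if "(x, y) \<in> {(a, b), (b, c), (c, a)}" for x y
  proof
    fix z assume z: "z \<in> closed_segment x y"
    have "(perp (y - x), perp (y - x) \<bullet> x) \<in> ?N" using that by (rule rev_image_eqI) simp
    then show "z \<in> (\<Union>(n, c)\<in>?N. {y. n \<bullet> y = c})"
      by (rule UN_I) (simp add: closed_segment_subset_line[OF z])
  qed
  ultimately have "frontier T \<subseteq> (\<Union>(n, c)\<in>?N. {y. n \<bullet> y = c})" by simp
  moreover have "\<forall>(n, c)\<in>?N. n \<noteq> 0" using neq by auto
  ultimately show ?thesis by (intro exI[of _ ?N]) simp
qed

lemma polygon_open: "polygon F \<Longrightarrow> open F"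
  by (auto simp: polygon_def)

lemma polygon_bounded: "polygon F \<Longrightarrow> bounded F"
proof -
  assume "polygon F"
  then obtain \<T> where T: "finite \<T>" "\<forall>T\<in>\<T>. triangle T" "F = interior (\<Union>\<T>)" by (auto simp: polygon_def)
  have "bounded T" if "T \<in> \<T>" for T
    using T(2) that unfolding triangle_def by (metis bounded_convex_hull bounded_insert bounded_empty)
  then have "bounded (\<Union>\<T>)" using T(1) by blast
  then show ?thesis unfolding T(3) using bounded_subset interior_subset by blast
qed

text \<open>The boundary of the interior of a union lies in the union of the boundaries. This cover
  is what makes the Lipschitz graphs piecewise linear.\<close>

lemma polygon_frontier_subset_lines:
  assumes "polygon F"
  shows "\<exists>N. finite N \<and> (\<forall>(n, c)\<in>N. n \<noteq> 0) \<and> frontier F \<subseteq> (\<Union>(n, c)\<in>N. {y. n \<bullet> y = (c :: real)})"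
proof -
  obtain \<T> where T: "finite \<T>" "\<forall>T\<in>\<T>. triangle T" "F = interior (\<Union>\<T>)"
    using assms by (auto simp: polygon_def)
  have "\<forall>T\<in>\<T>. \<exists>N. finite N \<and> (\<forall>(n, c)\<in>N. n \<noteq> 0) \<and> frontier T \<subseteq> (\<Union>(n, c)\<in>N. {y. n \<bullet> y = (c :: real)})"
    using T(2) frontier_triangle_subset_lines by blast
  from bchoice[OF this] obtain N where N: "\<forall>T\<in>\<T>. finite (N T) \<and> (\<forall>(n, c)\<in>N T. n \<noteq> 0) \<and>
      frontier T \<subseteq> (\<Union>(n, c)\<in>N T. {y. n \<bullet> y = (c :: real)})" ..
  have "frontier F \<subseteq> frontier (\<Union>\<T>)" unfolding T(3) by (rule frontier_interior_subset)
  also have "\<dots> \<subseteq> (\<Union>T\<in>\<T>. frontier T)" by (rule frontier_Union_subset[OF T(1)])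
  also have "\<dots> \<subseteq> (\<Union>(n, c)\<in>(\<Union>T\<in>\<T>. N T). {y. n \<bullet> y = c})" using N by (simp add: subset_iff) fastforce
  finally have "frontier F \<subseteq> (\<Union>(n, c)\<in>(\<Union>T\<in>\<T>. N T). {y. n \<bullet> y = c})" .
  moreover have "finite (\<Union>T\<in>\<T>. N T)" using T(1) N by auto
  moreover have "\<forall>(n, c)\<in>(\<Union>T\<in>\<T>. N T). n \<noteq> 0" using N by blast
  ultimately show ?thesis by (intro exI[of _ "\<Union>T\<in>\<T>. N T"]) simp
qed

lemma subgraph_frontier:
  assumes "open U" "continuous_on UNIV g" "a \<noteq> 0"
    and F: "\<And>y. y \<in> U \<Longrightarrow> y \<in> F \<longleftrightarrow> y \<bullet> perp a < g (y \<bullet> a)"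
    and y: "y \<in> U"
  shows "y \<in> frontier F \<longleftrightarrow> y \<bullet> perp a = g (y \<bullet> a)"
proof -
  have cont: "continuous_on UNIV (\<lambda>y. g (y \<bullet> a))"
    by (rule continuous_on_compose2[OF assms(2)]) (auto intro!: continuous_intros)
  have "open (U \<inter> {y. y \<bullet> perp a < g (y \<bullet> a)})"
    by (intro open_Int assms(1) open_Collect_less cont continuous_intros)
  then have int: "y \<in> interior F" if "y \<bullet> perp a < g (y \<bullet> a)"
    using F y that by (intro interiorI[of "U \<inter> {y. y \<bullet> perp a < g (y \<bullet> a)}"]) auto
  have "open (U \<inter> {y. g (y \<bullet> a) < y \<bullet> perp a})"
    by (intro open_Int assms(1) open_Collect_less cont continuous_intros)
  then have ext: "y \<notin> closure F" if "y \<bullet> perp a > g (y \<bullet> a)"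
    using F y that unfolding closure_iff_nhds_not_empty
    by (auto intro!: exI[of _ "U \<inter> {y. g (y \<bullet> a) < y \<bullet> perp a}"])
  have "y \<in> frontier F" if eq: "y \<bullet> perp a = g (y \<bullet> a)"
  proof -
    have "y \<notin> F" using F[OF y] eq by simp
    moreover have "y \<in> closure F"
      unfolding closure_approachable
    proof safe
      fix e :: real assume "e > 0"
      obtain r where r: "r > 0" "ball y r \<subseteq> U" using assms(1) y by (auto simp: open_contains_ball)
      define z where "z = y - (min e r / (2 * norm a)) *\<^sub>R perp a"
      have na: "norm (perp a) = norm a" by (simp add: norm_eq_sqrt_inner)
      have d: "dist z y = min e r / 2"
        using \<open>e > 0\<close> r(1) assms(3) by (simp add: z_def dist_norm na)
      then have "z \<in> ball y r" using \<open>e > 0\<close> r(1) by (auto simp: dist_commute)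
      then have "z \<in> U" using r(2) by auto
      moreover have "z \<bullet> a = y \<bullet> a" by (simp add: z_def inner_diff_left)
      moreover have "z \<bullet> perp a < y \<bullet> perp a"
        using \<open>e > 0\<close> r(1) assms(3) by (simp add: z_def inner_diff_left)
      ultimately have "z \<in> F" using F eq by simp
      moreover have "dist z y < e" using d \<open>e > 0\<close> r(1) by auto
      ultimately show "\<exists>z\<in>F. dist z y < e" by blast
    qed
    ultimately show ?thesis using interior_subset by (auto simp: frontier_def)
  qed
  then show ?thesis using int ext by (force simp: frontier_def)
qed

text \<open>In the plane, \<open>b\<close> is \<open>perp a\<close> or its negative; in the second
  case reflecting the abscissa, with \<open>- a\<close> for \<open>a\<close> and
  \<open>g (- s)\<close> for \<open>g s\<close>, restores the orientation.\<close>

lemma lipschitz_boundary_subgraph: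
  assumes "lipschitz_boundary F" "x \<in> frontier F"
  obtains U a g where "open U" "x \<in> U" "norm a = 1" "continuous_on UNIV g"
    "\<And>y. y \<in> U \<Longrightarrow> y \<in> F \<longleftrightarrow> y \<bullet> perp a < g (y \<bullet> a)"
proof -
  obtain U a b L and g :: "real \<Rightarrow> real" where *: "open U" "x \<in> U" "norm a = 1" "norm b = 1" "a \<bullet> b = 0"
    "L-lipschitz_on UNIV g" "F \<inter> U = {y \<in> U. y \<bullet> b < g (y \<bullet> a)}"
    using assms unfolding lipschitz_boundary_def by meson
  have g: "continuous_on UNIV g" using *(6) by (rule lipschitz_on_continuous_on)
  have F: "y \<in> F \<longleftrightarrow> y \<bullet> b < g (y \<bullet> a)" if "y \<in> U" for y using *(7) that by auto
  have b: "b = (b \<bullet> perp a) *\<^sub>R perp a"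
    using orthogonal_decomposition[OF *(3), of b] *(5) by (simp add: inner_commute)
  then have "norm b = \<bar>b \<bullet> perp a\<bar> * norm (perp a)" by (metis norm_scaleR)
  moreover have "norm (perp a) = 1" using *(3) by (simp add: norm_eq_sqrt_inner)
  ultimately have "\<bar>b \<bullet> perp a\<bar> = 1" using *(4) by simp
  then have "b \<bullet> perp a = 1 \<or> b \<bullet> perp a = -1" by linarith
  then consider "b = perp a" | "b = perp (- a)" using b by fastforce
  then show thesis
  proof cases
    case 1
    then show thesis using that[OF *(1,2,3) g] F by simp
  next
    case 2
    have g': "continuous_on UNIV (\<lambda>s. g (- s))"
      by (rule continuous_on_compose2[OF g]) (auto intro!: continuous_intros)
    show thesis using that[OF *(1,2) _ g', of "- a"] F *(3) 2 by simp
  qed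
qed

text \<open>The chord slope is continuous on the connected set \<open>S\<close> and takes finitely
  many values, so it is constant.\<close>

lemma finite_slopes_imp_linear:
  fixes g :: "real \<Rightarrow> real"
  assumes "connected S" "s0 \<notin> S" "continuous_on UNIV g" "finite M"
    and "\<And>s. s \<in> S \<Longrightarrow> (g s - g s0) / (s - s0) \<in> M"
  shows "\<exists>m. \<forall>s\<in>S. g s = g s0 + m * (s - s0)"
proof -
  have "continuous_on S (\<lambda>s. (g s - g s0) / (s - s0))"
    using assms(2) continuous_on_subset[OF assms(3)] by (intro continuous_intros) auto
  moreover have "finite ((\<lambda>s. (g s - g s0) / (s - s0)) ` S)"
    using assms(5) by (intro finite_subset[OF _ assms(4)]) auto
  ultimately have "(\<lambda>s. (g s - g s0) / (s - s0)) constant_on S"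
    by (rule continuous_finite_range_constant[OF assms(1)])
  then obtain m where m: "\<And>s. s \<in> S \<Longrightarrow> (g s - g s0) / (s - s0) = m"
    unfolding constant_on_def by metis
  have "g s = g s0 + m * (s - s0)" if "s \<in> S" for s
  proof -
    have "s - s0 \<noteq> 0" using assms(2) that by auto
    then show ?thesis using m[OF that] by (simp add: divide_eq_eq)
  qed
  then show ?thesis by blast
qed

text \<open>
  The graph from the Lipschitz condition is covered by finitely many lines, so that the slope of
  its chords through \<open>x\<close> is locally constant on either side of \<open>x\<close>.
\<close>

lemma polygon_local_wedge:
  assumes "polygon F" "x \<in> frontier F"
  obtains a r m where "norm a = 1" "r > 0"
    "\<forall>y\<in>ball x r. y \<in> F \<longleftrightarrow> (y - x) \<bullet> perp a < m (sgn ((y - x) \<bullet> a)) * ((y - x) \<bullet> a)"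
proof -
  have "lipschitz_boundary F" using assms(1) by (simp add: polygon_def)
  from lipschitz_boundary_subgraph[OF this assms(2)]
  obtain U a g where U: "open U" "x \<in> U" and a: "norm a = 1" and g: "continuous_on UNIV g"
    and F: "\<And>y. y \<in> U \<Longrightarrow> y \<in> F \<longleftrightarrow> y \<bullet> perp a < g (y \<bullet> a)" by blast
  have a0: "a \<noteq> 0" using a by auto
  have aa: "a \<bullet> a = 1" using a by (simp add: norm_eq_1)
  obtain N where N: "finite N" "\<And>n c. (n, c) \<in> N \<Longrightarrow> n \<noteq> 0"
    "frontier F \<subseteq> (\<Union>(n, c)\<in>N. {y. n \<bullet> y = (c :: real)})"
    using polygon_frontier_subset_lines[OF assms(1)] by (metis (mono_tags, lifting) case_prodD)
  have fr: "y \<in> frontier F \<longleftrightarrow> y \<bullet> perp a = g (y \<bullet> a)" if "y \<in> U" for y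
    by (rule subgraph_frontier[OF U(1) g a0 _ that]) (rule F)
  define s0 where "s0 = x \<bullet> a"
  define P where "P = (\<lambda>s. s *\<^sub>R a + g s *\<^sub>R perp a)"
  have gx: "x \<bullet> perp a = g s0" using fr[OF U(2)] assms(2) by (simp add: s0_def)
  have Px: "P s0 = x" using orthogonal_decomposition[OF a, of x] gx by (simp add: P_def s0_def)
  have Pa: "P s \<bullet> a = s" "P s \<bullet> perp a = g s" for s
    by (simp_all add: P_def inner_add_left aa)
  \<comment> \<open>The covering lines that miss \<open>x\<close> are cut out of \<open>U\<close>;
    every line that covers a graph point in \<open>W\<close> then passes through \<open>x\<close>
    and contains the chord.\<close>
  define W where "W = U \<inter> (\<Inter>(n, c)\<in>{(n, c)\<in>N. n \<bullet> x \<noteq> c}. {y. n \<bullet> y \<noteq> c})"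
  have "open W"
    unfolding W_def
  proof (intro open_Int U(1) open_INT)
    show "finite {(n, c) \<in> N. n \<bullet> x \<noteq> c}" by (rule finite_subset[OF _ N(1)]) auto
    show "\<forall>i\<in>{(n, c) \<in> N. n \<bullet> x \<noteq> c}. open (case i of (n, c) \<Rightarrow> {y. n \<bullet> y \<noteq> c})"
      by (auto intro!: open_Collect_neq continuous_intros)
  qed
  moreover have "continuous_on UNIV P" unfolding P_def using g by (intro continuous_intros)
  ultimately have "open (P -` W)" by (rule open_vimage)
  moreover have "s0 \<in> P -` W" using U(2) by (auto simp: W_def Px)
  ultimately obtain \<delta> where \<delta>: "\<delta> > 0" "ball s0 \<delta> \<subseteq> P -` W" by (rule openE)
  \<comment> \<open>The slopes of the covering lines in the frame \<open>a\<close>,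
    \<open>perp a\<close>.\<close>
  define M where "M = (\<lambda>(n, c). - (n \<bullet> a) / (n \<bullet> perp a)) ` N"
  have slope: "(g s - g s0) / (s - s0) \<in> M" if s: "s \<in> ball s0 \<delta>" "s \<noteq> s0" for s
  proof -
    have W: "P s \<in> W" using s \<delta>(2) by auto
    then have PU: "P s \<in> U" by (simp add: W_def)
    have "P s \<in> frontier F" using fr[OF PU] by (simp add: Pa)
    then obtain n c where nc: "(n, c) \<in> N" "n \<bullet> P s = c" using N(3) by blast
    have "n \<bullet> x = c"
    proof (rule ccontr)
      assume "n \<bullet> x \<noteq> c"
      with nc(1) W have "n \<bullet> P s \<noteq> c" unfolding W_def by blast
      with nc(2) show False by simp
    qed
    then have "n \<bullet> P s0 = n \<bullet> P s" using nc(2) Px by simp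
    then have e: "(s - s0) * (n \<bullet> a) + (g s - g s0) * (n \<bullet> perp a) = 0"
      by (simp add: P_def inner_add_right algebra_simps)
    \<comment> \<open>A covering line through \<open>x\<close> in the direction
      \<open>perp a\<close> meets the graph over \<open>s0\<close> only.\<close>
    have "n \<bullet> perp a \<noteq> 0"
    proof
      assume z: "n \<bullet> perp a = 0"
      then have "n \<bullet> a = 0" using e s(2) by simp
      then have "n = 0" using orthogonal_decomposition[OF a, of n] z by simp
      then show False using N(2) nc(1) by blast
    qed
    then have "(g s - g s0) / (s - s0) = - (n \<bullet> a) / (n \<bullet> perp a)"
      using e s(2) by (simp add: field_simps)
    then show ?thesis using nc(1) unfolding M_def by force
  qed
  have fM: "finite M" using N(1) by (simp add: M_def)
  obtain mr where mr: "\<And>s. s \<in> {s0<..<s0 + \<delta>} \<Longrightarrow> g s = g s0 + mr * (s - s0)"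
    using finite_slopes_imp_linear[of "{s0<..<s0 + \<delta>}" s0 g M, OF _ _ g fM] slope by (force simp: dist_real_def)
  obtain ml where ml: "\<And>s. s \<in> {s0 - \<delta><..<s0} \<Longrightarrow> g s = g s0 + ml * (s - s0)"
    using finite_slopes_imp_linear[of "{s0 - \<delta><..<s0}" s0 g M, OF _ _ g fM] slope by (force simp: dist_real_def)
  \<comment> \<open>\<open>sgn\<close> is 0 only where the slope is multiplied by 0, so
    \<open>m 0\<close> may take any value.\<close>
  define m :: "real \<Rightarrow> real" where "m = (\<lambda>t. if t = 1 then mr else ml)"
  have gm: "g s = g s0 + m (sgn (s - s0)) * (s - s0)" if "\<bar>s - s0\<bar> < \<delta>" for s
  proof -
    consider "s > s0" | "s < s0" | "s = s0" by linarith
    then show ?thesis using mr[of s] ml[of s] that by cases (auto simp: m_def sgn_real_def)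
  qed
  obtain r where r: "r > 0" "ball x r \<subseteq> U" using U by (auto simp: open_contains_ball)
  show thesis
  proof (rule that[OF a, of "min r \<delta>" m])
    show "min r \<delta> > 0" using r \<delta> by simp
    show "\<forall>y\<in>ball x (min r \<delta>). y \<in> F \<longleftrightarrow> (y - x) \<bullet> perp a < m (sgn ((y - x) \<bullet> a)) * ((y - x) \<bullet> a)"
    proof
      fix y assume y: "y \<in> ball x (min r \<delta>)"
      have "\<bar>(y - x) \<bullet> a\<bar> \<le> norm (y - x) * norm a" by (rule Cauchy_Schwarz_ineq2)
      then have "\<bar>y \<bullet> a - s0\<bar> < \<delta>" using y a by (simp add: s0_def inner_diff_left dist_norm norm_minus_commute)
      from gm[OF this] F[of y] y r(2)
      show "y \<in> F \<longleftrightarrow> (y - x) \<bullet> perp a < m (sgn ((y - x) \<bullet> a)) * ((y - x) \<bullet> a)"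
        by (auto simp: inner_diff_left gx s0_def)
    qed
  qed
qed

section \<open>Flat boundary points and the direction with \<open>F\<close> on the left\<close>

definition left_half :: "point set \<Rightarrow> point \<Rightarrow> point \<Rightarrow> bool" where
  "left_half F x d \<longleftrightarrow> (\<exists>r>0. \<forall>z\<in>ball x r. z \<in> F \<longleftrightarrow> 0 < (z - x) \<bullet> perp d)"

text \<open>Only the direction of \<open>d\<close> matters, so edge vectors serve without
  normalization.\<close>

lemma left_half_scale: "left_half F x d \<Longrightarrow> 0 < c \<Longrightarrow> left_half F x (c *\<^sub>R d)"
  unfolding left_half_def by (simp add: zero_less_mult_iff)

lemma left_half_frontier_iff:
  assumes "d \<noteq> 0" and r: "\<forall>z\<in>ball x r. z \<in> F \<longleftrightarrow> 0 < (z - x) \<bullet> perp d" and "z \<in> ball x r"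
  shows "z \<in> frontier F \<longleftrightarrow> (z - x) \<bullet> perp d = 0"
proof -
  have "z \<in> frontier F \<longleftrightarrow> z \<bullet> perp (- d) = (\<lambda>_. x \<bullet> perp (- d)) (z \<bullet> (- d))"
    using assms by (intro subgraph_frontier[of "ball x r"]) (auto simp: inner_diff_left)
  then show ?thesis by (auto simp: inner_diff_left)
qed

lemma left_half_imp_frontier:
  assumes "left_half F x d" "d \<noteq> 0"
  shows "x \<in> frontier F"
proof -
  obtain r where "r > 0" "\<forall>z\<in>ball x r. z \<in> F \<longleftrightarrow> 0 < (z - x) \<bullet> perp d"
    using assms(1) unfolding left_half_def by blast
  then show ?thesis using left_half_frontier_iff[OF assms(2), of x r F x] by simp
qed

lemma small_step:
  fixes d :: point
  assumes "r > 0"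
  obtains \<epsilon> where "\<epsilon> > 0" "\<And>s. \<bar>s\<bar> \<le> \<epsilon> \<Longrightarrow> x + s *\<^sub>R d \<in> ball x r"
proof
  have n: "norm d + 1 > 0" by (simp add: add_nonneg_pos)
  \<comment> \<open>The summand 1 keeps the denominator positive for \<open>d = 0\<close>.\<close>
  show "r / (2 * (norm d + 1)) > 0" using assms n by simp
  fix s assume "\<bar>s\<bar> \<le> r / (2 * (norm d + 1))"
  then have "\<bar>s\<bar> * norm d \<le> r / (2 * (norm d + 1)) * norm d" by (rule mult_right_mono) simp
  also have "\<dots> = r * (norm d / (2 * (norm d + 1)))" by simp
  also have "\<dots> < r * 1"
    using assms n by (intro mult_strict_left_mono) (simp_all add: divide_less_eq)
  also have "\<dots> = r" by simp
  finally show "x + s *\<^sub>R d \<in> ball x r" by (simp add: dist_norm)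
qed

text \<open>Near \<open>x\<close> the boundary is the line through \<open>x\<close> along
  \<open>d\<close>, so a boundary ray at \<open>x\<close> has to follow that line.\<close>

lemma left_half_direction:
  assumes "left_half F x d" "d \<noteq> 0" "e \<noteq> 0" "\<epsilon> > 0"
    and "\<And>s. 0 < s \<Longrightarrow> s \<le> \<epsilon> \<Longrightarrow> x + s *\<^sub>R e \<in> frontier F"
  shows "\<exists>c. c \<noteq> 0 \<and> d = c *\<^sub>R e"
proof -
  obtain r where r: "r > 0" "\<forall>z\<in>ball x r. z \<in> F \<longleftrightarrow> 0 < (z - x) \<bullet> perp d"
    using assms(1) unfolding left_half_def by blast
  obtain \<delta> where \<delta>: "\<delta> > 0" "\<And>s. \<bar>s\<bar> \<le> \<delta> \<Longrightarrow> x + s *\<^sub>R e \<in> ball x r" using small_step[OF r(1)] by blast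
  have "(min \<delta> \<epsilon>) *\<^sub>R e \<bullet> perp d = 0"
    using left_half_frontier_iff[OF assms(2) r(2) \<delta>(2)[of "min \<delta> \<epsilon>"]] assms(4) assms(5)[of "min \<delta> \<epsilon>"] \<delta>(1) by simp
  then have "d \<bullet> perp e = 0" using \<delta>(1) assms(4) inner_perp_swap[of d e] by (simp add: inner_commute min_def split: if_splits)
  from orthogonal_to_perp_imp_parallel[OF this assms(3)] obtain c where "d = c *\<^sub>R e" ..
  then show ?thesis using assms(2) by auto
qed

lemma left_half_not_opposite:
  assumes "left_half F x d" "d \<noteq> 0"
  shows "\<not> left_half F x (- d)"
proof
  assume "left_half F x (- d)"
  then obtain r' where r': "r' > 0" "\<forall>z\<in>ball x r'. z \<in> F \<longleftrightarrow> 0 < (z - x) \<bullet> perp (- d)"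
    unfolding left_half_def by blast
  obtain r where r: "r > 0" "\<forall>z\<in>ball x r. z \<in> F \<longleftrightarrow> 0 < (z - x) \<bullet> perp d"
    using assms(1) unfolding left_half_def by blast
  obtain \<delta> where \<delta>: "\<delta> > 0" "\<And>s. \<bar>s\<bar> \<le> \<delta> \<Longrightarrow> x + s *\<^sub>R perp d \<in> ball x (min r r')"
    using small_step[of "min r r'" x "perp d"] r(1) r'(1) by (metis min_less_iff_conj)
  have "x + \<delta> *\<^sub>R perp d \<in> ball x (min r r')" using \<delta> by simp
  moreover have "0 < \<delta> *\<^sub>R perp d \<bullet> perp d" using \<delta>(1) assms(2) by simp
  moreover from calculation have "x + \<delta> *\<^sub>R perp d \<in> ball x r" "x + \<delta> *\<^sub>R perp d \<in> ball x r'" by auto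
  ultimately show False using bspec[OF r(2), of "x + \<delta> *\<^sub>R perp d"] bspec[OF r'(2), of "x + \<delta> *\<^sub>R perp d"] by simp
qed

lemma left_half_unique:
  assumes "left_half F x d" "left_half F x e" "d \<noteq> 0" "e \<noteq> 0"
  shows "\<exists>k>0. e = k *\<^sub>R d"
proof -
  obtain r where r: "r > 0" "\<forall>z\<in>ball x r. z \<in> F \<longleftrightarrow> 0 < (z - x) \<bullet> perp d"
    using assms(1) unfolding left_half_def by blast
  obtain \<delta> where \<delta>: "\<delta> > 0" "\<And>s. \<bar>s\<bar> \<le> \<delta> \<Longrightarrow> x + s *\<^sub>R d \<in> ball x r" using small_step[OF r(1)] by blast
  have "x + s *\<^sub>R d \<in> frontier F" if "0 < s" "s \<le> \<delta>" for s
    using left_half_frontier_iff[OF assms(3) r(2) \<delta>(2), of s] that by simp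
  then obtain c where c: "c \<noteq> 0" "e = c *\<^sub>R d"
    using left_half_direction[OF assms(2,4,3) \<delta>(1)] by blast
  have "c > 0"
  proof (rule ccontr)
    assume "\<not> c > 0"
    then have "left_half F x ((- c) *\<^sub>R d)" using c(1) by (intro left_half_scale assms(1)) simp
    then show False using left_half_not_opposite[OF assms(2,4)] c(2) by simp
  qed
  then show ?thesis using c by blast
qed

text \<open>Nearby points on the edge of the half plane see the same half plane. This openness
  drives the continuation arguments along edges.\<close>

lemma left_half_slide:
  assumes "left_half F x d"
  shows "\<exists>\<epsilon>>0. \<forall>s. \<bar>s\<bar> \<le> \<epsilon> \<longrightarrow> left_half F (x + s *\<^sub>R d) d"
proof -
  obtain r where r: "r > 0" "\<forall>z\<in>ball x r. z \<in> F \<longleftrightarrow> 0 < (z - x) \<bullet> perp d"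
    using assms(1) unfolding left_half_def by blast
  obtain \<delta> where \<delta>: "\<delta> > 0" "\<And>s. \<bar>s\<bar> \<le> \<delta> \<Longrightarrow> x + s *\<^sub>R d \<in> ball x r" using small_step[OF r(1)] by blast
  have "left_half F (x + s *\<^sub>R d) d" if s: "\<bar>s\<bar> \<le> \<delta>" for s
  proof -
    obtain \<rho> where \<rho>: "\<rho> > 0" "ball (x + s *\<^sub>R d) \<rho> \<subseteq> ball x r"
      using \<delta>(2)[OF s] openE[OF open_ball] by blast
    have "z \<in> F \<longleftrightarrow> 0 < (z - (x + s *\<^sub>R d)) \<bullet> perp d" if "z \<in> ball (x + s *\<^sub>R d) \<rho>" for z
      using r(2) \<rho>(2) that by (auto simp: inner_diff_left inner_add_left)
    then show ?thesis unfolding left_half_def using \<rho>(1) by blast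
  qed
  then show ?thesis using \<delta>(1) by blast
qed

text \<open>
  The two boundary rays at \<open>x\<close> are \<open>w 1\<close> and \<open>w (-1)\<close>: the polygon lies to the left of the
  first one and to the right of the second one.
\<close>

lemma polygon_local_rays:
  assumes "polygon F" "x \<in> frontier F"
  obtains r and w :: "real \<Rightarrow> point" where "r > 0"
    "\<forall>\<sigma>\<in>{1, -1}. w \<sigma> \<noteq> 0"
    "\<forall>\<sigma>\<in>{1, -1}. \<forall>s>0. s * norm (w \<sigma>) < r \<longrightarrow> left_half F (x + s *\<^sub>R w \<sigma>) (\<sigma> *\<^sub>R w \<sigma>)"
    "\<forall>z\<in>frontier F \<inter> ball x r. \<exists>\<sigma>\<in>{1, -1}. \<exists>s\<ge>0. z = x + s *\<^sub>R w \<sigma>"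
    "\<forall>c. w 1 = c *\<^sub>R w (-1) \<longrightarrow> left_half F x (w 1)"
proof -
  obtain a m r where a: "norm a = 1" and r: "r > 0"
    and wedge: "\<forall>y\<in>ball x r. y \<in> F \<longleftrightarrow> (y - x) \<bullet> perp a < m (sgn ((y - x) \<bullet> a)) * ((y - x) \<bullet> a)"
    by (rule polygon_local_wedge[OF assms])
  note F = bspec[OF wedge]
  have aa: "a \<bullet> a = 1" and a0: "a \<noteq> 0" using a by (auto simp: norm_eq_1)
  \<comment> \<open>\<open>F\<close> lies below the graph, so a walker with \<open>F\<close> on the
    left moves towards smaller abscissae: \<open>w 1\<close> follows the branch of slope
    \<open>m (-1)\<close> to the left, \<open>w (-1)\<close> the branch of slope \<open>m 1\<close>
    to the right.\<close>
  define w where "w = (\<lambda>\<sigma> :: real. (- \<sigma>) *\<^sub>R (a + m (- \<sigma>) *\<^sub>R perp a))"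
  have wa: "w \<sigma> \<bullet> a = - \<sigma>" "w \<sigma> \<bullet> perp a = - \<sigma> * m (- \<sigma>)" for \<sigma>
    by (simp_all add: w_def inner_add_left aa)
  have pw: "z \<bullet> perp (w \<sigma>) = \<sigma> * (m (- \<sigma>) * (z \<bullet> a) - z \<bullet> perp a)" for z \<sigma>
    unfolding w_def perp_simps(2) perp_add perp_simps(3) by (simp add: inner_add_right algebra_simps)
  have w0: "w \<sigma> \<noteq> 0" if "\<sigma> \<in> {1, -1}" for \<sigma>
    using wa(1)[of \<sigma>] that by auto
  have half: "y \<in> F \<longleftrightarrow> 0 < (y - x) \<bullet> perp (\<sigma> *\<^sub>R w \<sigma>)"
    if "y \<in> ball x r" "\<sigma> \<in> {1, -1}" "sgn ((y - x) \<bullet> a) = - \<sigma>" for y \<sigma>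
    using F[OF that(1)] that(2) unfolding that(3) by (auto simp: pw)
  have lh: "left_half F (x + s *\<^sub>R w \<sigma>) (\<sigma> *\<^sub>R w \<sigma>)" if \<sigma>: "\<sigma> \<in> {1, -1}" and s: "0 < s" "s * norm (w \<sigma>) < r" for \<sigma> s
  proof -
    let ?y = "x + s *\<^sub>R w \<sigma>" and ?H = "{y. 0 < - \<sigma> * ((y - x) \<bullet> a)}"
    have "open (ball x r \<inter> ?H)" by (intro open_Int open_ball open_Collect_less continuous_intros)
    moreover have "?y \<in> ball x r \<inter> ?H"
      using s \<sigma> by (auto simp: dist_norm wa)
    ultimately obtain \<rho> where \<rho>: "\<rho> > 0" "ball ?y \<rho> \<subseteq> ball x r \<inter> ?H" by (auto elim: openE)
    have "z \<in> F \<longleftrightarrow> 0 < (z - ?y) \<bullet> perp (\<sigma> *\<^sub>R w \<sigma>)" if "z \<in> ball ?y \<rho>" for z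
    proof -
      have "z \<in> ball x r" "z \<in> ?H" using that \<rho>(2) by auto
      moreover from this have "sgn ((z - x) \<bullet> a) = - \<sigma>" using \<sigma> by (auto simp: sgn_real_def)
      ultimately show ?thesis using half[OF _ \<sigma>] by (simp add: inner_diff_left inner_add_left)
    qed
    then show ?thesis unfolding left_half_def using \<rho>(1) by blast
  qed
  \<comment> \<open>The graph is rebuilt from its two slopes to make
    \<open>subgraph_frontier\<close> applicable.\<close>
  define g where "g = (\<lambda>t. x \<bullet> perp a + (if t \<ge> x \<bullet> a then m 1 * (t - x \<bullet> a) else m (-1) * (t - x \<bullet> a)))"
  have g: "continuous_on UNIV g"
  proof -
    have "continuous_on ({t. x \<bullet> a \<le> t} \<union> {t. t \<le> x \<bullet> a})
      (\<lambda>t. if t \<ge> x \<bullet> a then m 1 * (t - x \<bullet> a) else m (-1) * (t - x \<bullet> a))"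
      by (rule continuous_on_cases) (auto intro!: closed_Collect_le continuous_intros)
    moreover have "{t. x \<bullet> a \<le> t} \<union> {t. t \<le> x \<bullet> a} = UNIV" by auto
    ultimately show ?thesis unfolding g_def by (intro continuous_intros) simp
  qed
  have Fg: "y \<in> F \<longleftrightarrow> y \<bullet> perp a < g (y \<bullet> a)" if "y \<in> ball x r" for y
    using F[OF that] by (auto simp: g_def inner_diff_left sgn_real_def)
  have fr: "y \<in> frontier F \<longleftrightarrow> y \<bullet> perp a = g (y \<bullet> a)" if "y \<in> ball x r" for y
    by (rule subgraph_frontier[OF open_ball g a0 _ that]) (rule Fg)
  have rays: "\<exists>\<sigma>\<in>{1, -1}. \<exists>s\<ge>0. z = x + s *\<^sub>R w \<sigma>" if z: "z \<in> frontier F" "z \<in> ball x r" for z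
  proof -
    define t where "t = (z - x) \<bullet> a"
    define \<sigma> :: real where "\<sigma> = (if t \<ge> 0 then -1 else 1)"
    have \<sigma>: "\<sigma> \<in> {1, -1}" "0 \<le> - \<sigma> * t" "\<sigma> * \<sigma> = 1" by (auto simp: \<sigma>_def)
    have "(z - x) \<bullet> perp a = m (- \<sigma>) * t"
      using fr[OF z(2)] z(1) by (auto simp: g_def t_def \<sigma>_def inner_diff_left)
    then have "z - x = t *\<^sub>R a + (m (- \<sigma>) * t) *\<^sub>R perp a"
      using orthogonal_decomposition[OF a, of "z - x"] by (simp add: t_def)
    also have "\<dots> = (- \<sigma> * t) *\<^sub>R w \<sigma>"
      unfolding w_def using \<sigma>(1) by (auto simp: algebra_simps)
    finally have "z = x + (- \<sigma> * t) *\<^sub>R w \<sigma>" by (simp add: algebra_simps)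
    then show ?thesis using \<sigma> by blast
  qed
  \<comment> \<open>The rays have abscissae -1 and 1, so parallel rays are opposite; then the slopes
    agree and the wedge is a half plane.\<close>
  have flat: "left_half F x (w 1)" if "w 1 = c *\<^sub>R w (-1)" for c
  proof -
    have "w 1 \<bullet> a = c * (w (-1) \<bullet> a)" unfolding that by simp
    then have c: "c = -1" by (simp add: wa)
    have "w 1 \<bullet> perp a = c * (w (-1) \<bullet> perp a)" unfolding that by simp
    then have mm: "m 1 = m (-1)" unfolding c wa by simp
    have "y \<in> F \<longleftrightarrow> 0 < (y - x) \<bullet> perp (w 1)" if "y \<in> ball x r" for y
      using F[OF that] unfolding pw by (auto simp: sgn_real_def mm split: if_splits)
    then show ?thesis unfolding left_half_def using r by blast
  qed
  show thesis using w0 lh rays flat by (intro that[OF r, of w]) blast+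
qed

text \<open>The definition of corners speaks of the boundary alone; the wedge adds that
  \<open>F\<close> lies on one side. Both boundary rays must follow the straight boundary near
  \<open>x\<close>, and parallel rays make the wedge a half plane.\<close>

lemma polygon_flat_point:
  assumes "polygon F" "x \<in> frontier F" "x \<notin> corners F"
  shows "\<exists>d. d \<noteq> 0 \<and> left_half F x d"
proof -
  obtain \<rho> d where d: "\<rho> > 0" "d \<noteq> 0" "frontier F \<inter> ball x \<rho> = range (\<lambda>s. x + s *\<^sub>R d) \<inter> ball x \<rho>"
    using assms(2,3) unfolding corners_def by blast
  obtain r and w :: "real \<Rightarrow> point" where r: "r > 0"
    and w0: "\<forall>\<sigma>\<in>{1, -1}. w \<sigma> \<noteq> 0"
    and lh: "\<forall>\<sigma>\<in>{1, -1}. \<forall>s>0. s * norm (w \<sigma>) < r \<longrightarrow> left_half F (x + s *\<^sub>R w \<sigma>) (\<sigma> *\<^sub>R w \<sigma>)"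
    and "\<forall>z\<in>frontier F \<inter> ball x r. \<exists>\<sigma>\<in>{1, -1}. \<exists>s\<ge>0. z = x + s *\<^sub>R w \<sigma>"
    and flat: "\<forall>c. w 1 = c *\<^sub>R w (-1) \<longrightarrow> left_half F x (w 1)"
    by (rule polygon_local_rays[OF assms(1,2)])
  have "\<exists>c. c \<noteq> 0 \<and> w \<sigma> = c *\<^sub>R d" if \<sigma>: "\<sigma> \<in> {1, -1 :: real}" for \<sigma>
  proof -
    obtain \<epsilon> where \<epsilon>: "\<epsilon> > 0" "\<And>s. \<bar>s\<bar> \<le> \<epsilon> \<Longrightarrow> x + s *\<^sub>R w \<sigma> \<in> ball x (min r \<rho>)"
      using small_step[of "min r \<rho>" x "w \<sigma>"] d(1) r by (metis min_less_iff_conj)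
    have "x + \<epsilon> *\<^sub>R w \<sigma> \<in> ball x (min r \<rho>)" using \<epsilon> by simp
    then have "\<epsilon> * norm (w \<sigma>) < r" "x + \<epsilon> *\<^sub>R w \<sigma> \<in> ball x \<rho>" using \<epsilon>(1) by (auto simp: dist_norm)
    moreover have "x + \<epsilon> *\<^sub>R w \<sigma> \<in> frontier F"
    proof (rule left_half_imp_frontier)
      show "left_half F (x + \<epsilon> *\<^sub>R w \<sigma>) (\<sigma> *\<^sub>R w \<sigma>)" using lh \<sigma> \<epsilon>(1) calculation by blast
      show "\<sigma> *\<^sub>R w \<sigma> \<noteq> 0" using w0 \<sigma> by auto
    qed
    ultimately obtain s where "x + \<epsilon> *\<^sub>R w \<sigma> = x + s *\<^sub>R d" using d(3) by blast
    then have "(1 / \<epsilon>) *\<^sub>R (\<epsilon> *\<^sub>R w \<sigma>) = (1 / \<epsilon>) *\<^sub>R (s *\<^sub>R d)" by simp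
    then have "w \<sigma> = (s / \<epsilon>) *\<^sub>R d" using \<epsilon>(1) by simp
    then show ?thesis using w0 \<sigma> by fastforce
  qed
  from this[of 1] this[of "-1"] obtain c c' where "w 1 = c *\<^sub>R d" "c' \<noteq> 0" "w (-1) = c' *\<^sub>R d" by auto
  then have "w 1 = (c / c') *\<^sub>R w (-1)" by simp
  then show ?thesis using flat w0 by blast
qed

section \<open>The cycle of edges\<close>

lemma open_segment_param:
  fixes p q :: point
  assumes "p \<noteq> q"
  shows "z \<in> open_segment p q \<longleftrightarrow> (\<exists>s. 0 < s \<and> s < 1 \<and> z = p + s *\<^sub>R (q - p))"
  using assms unfolding in_segment by (auto simp: algebra_simps)

lemma closed_segment_param:
  fixes p q :: point
  shows "z \<in> closed_segment p q \<longleftrightarrow> (\<exists>s. 0 \<le> s \<and> s \<le> 1 \<and> z = p + s *\<^sub>R (q - p))"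
  unfolding in_segment by (auto simp: algebra_simps)

locale face =
  fixes F V :: "point set"
  assumes polygon: "polygon F" and vertices: "vertex_set F V"
begin

lemma V_finite: "finite V" and V_frontier: "V \<subseteq> frontier F" and corners_V: "corners F \<subseteq> V"
  using vertices by (auto simp: vertex_set_def)

lemma flat_point: "z \<in> frontier F \<Longrightarrow> z \<notin> V \<Longrightarrow> \<exists>d. d \<noteq> 0 \<and> left_half F z d"
  using polygon_flat_point[OF polygon] corners_V by blast

text \<open>The ray is followed as long as it stays in the bounded set \<open>frontier F\<close>.
  The last point is a vertex, because at a flat point the boundary would continue straight
  on.\<close>

lemma ray_reaches_vertex:
  assumes x: "x \<in> frontier F" and d: "d \<noteq> 0" and "\<epsilon> > 0"
    and ray: "\<And>s. 0 < s \<Longrightarrow> s \<le> \<epsilon> \<Longrightarrow> x + s *\<^sub>R d \<in> frontier F"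
  shows "\<exists>m>0. x + m *\<^sub>R d \<in> V \<and> (\<forall>s. 0 \<le> s \<and> s \<le> m \<longrightarrow> x + s *\<^sub>R d \<in> frontier F) \<and>
    (\<forall>s. 0 < s \<and> s < m \<longrightarrow> x + s *\<^sub>R d \<notin> V)"
proof -
  define S where "S = {s. 0 \<le> s \<and> (\<forall>t. 0 \<le> t \<and> t \<le> s \<longrightarrow> x + t *\<^sub>R d \<in> frontier F)}"
  have "x + t *\<^sub>R d \<in> frontier F" if "0 \<le> t" "t \<le> \<epsilon>" for t
    using ray[of t] x that by (cases "t = 0") simp_all
  then have \<epsilon>S: "\<epsilon> \<in> S" unfolding S_def using \<open>\<epsilon> > 0\<close> by simp
  have "bounded (frontier F)"
    using bounded_closure[OF polygon_bounded[OF polygon]] by (rule bounded_subset) (simp add: frontier_def)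
  then obtain B where B: "\<And>z. z \<in> frontier F \<Longrightarrow> norm z \<le> B" by (auto simp: bounded_iff)
  have "s \<le> (B + norm x) / norm d" if "s \<in> S" for s
  proof -
    have s: "0 \<le> s" "x + s *\<^sub>R d \<in> frontier F" using that by (auto simp: S_def)
    have "norm (s *\<^sub>R d) \<le> norm (x + s *\<^sub>R d) + norm x"
      using norm_triangle_ineq4[of "x + s *\<^sub>R d" x] by simp
    also have "\<dots> \<le> B + norm x" using B[OF s(2)] by simp
    finally show ?thesis using d s(1) by (simp add: field_simps)
  qed
  then have bdd: "bdd_above S" by (auto simp: bdd_above_def)
  define m where "m = Sup S"
  have m: "\<epsilon> \<le> m" unfolding m_def by (rule cSup_upper[OF \<epsilon>S bdd])
  have below: "x + t *\<^sub>R d \<in> frontier F" if t: "0 \<le> t" "t < m" for t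
  proof -
    obtain s where "s \<in> S" "t < s" using less_cSup_iff[of S t] t \<epsilon>S bdd by (auto simp: m_def)
    then show ?thesis using t(1) by (auto simp: S_def)
  qed
  have end_frontier: "x + m *\<^sub>R d \<in> frontier F"
  proof -
    have "closed ((\<lambda>t. x + t *\<^sub>R d) -` frontier F)"
      by (intro closed_vimage frontier_closed continuous_intros)
    moreover have "{0..<m} \<subseteq> (\<lambda>t. x + t *\<^sub>R d) -` frontier F" using below by auto
    ultimately have "closure {0..<m} \<subseteq> (\<lambda>t. x + t *\<^sub>R d) -` frontier F" by (rule closure_minimal[rotated])
    then have "{0..m} \<subseteq> (\<lambda>t. x + t *\<^sub>R d) -` frontier F" using m \<open>\<epsilon> > 0\<close> by simp
    moreover have "m \<in> {0..m}" using m \<open>\<epsilon> > 0\<close> by simp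
    ultimately show ?thesis by blast
  qed
  have end_V: "x + m *\<^sub>R d \<in> V"
  proof (rule ccontr)
    assume "x + m *\<^sub>R d \<notin> V"
    then obtain e where e: "e \<noteq> 0" "left_half F (x + m *\<^sub>R d) e" using flat_point end_frontier by blast
    have "x + m *\<^sub>R d + s *\<^sub>R (- d) \<in> frontier F" if "0 < s" "s \<le> m" for s
      using below[of "m - s"] that by (simp add: algebra_simps)
    moreover have "m > 0" "- d \<noteq> 0" using m \<open>\<epsilon> > 0\<close> d by auto
    ultimately obtain c where c: "c \<noteq> 0" "e = c *\<^sub>R (- d)"
      using left_half_direction[OF e(2,1), of "- d" m] by blast
    obtain \<delta> where \<delta>: "\<delta> > 0" "\<And>s. \<bar>s\<bar> \<le> \<delta> \<Longrightarrow> left_half F (x + m *\<^sub>R d + s *\<^sub>R e) e"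
      using left_half_slide[OF e(2)] by blast
    \<comment> \<open>A slide by at most \<open>\<delta>\<close> along
      \<open>e = c *\<^sub>R (- d)\<close> is one by at most \<open>\<delta> * \<bar>c\<bar>\<close>
      along \<open>d\<close>; it leads beyond the supremum \<open>m\<close>.\<close>
    have "x + (m + t) *\<^sub>R d \<in> frontier F" if t: "0 \<le> t" "t \<le> \<delta> * \<bar>c\<bar>" for t
    proof -
      have "\<bar>- (t / c)\<bar> \<le> \<delta>" using t c(1) by (simp add: abs_divide field_simps)
      from left_half_imp_frontier[OF \<delta>(2)[OF this] e(1)]
      show ?thesis using c by (simp add: algebra_simps)
    qed
    then have "m + \<delta> * \<bar>c\<bar> \<in> S"
      unfolding S_def
    proof (safe)
      show "0 \<le> m + \<delta> * \<bar>c\<bar>" using m \<open>\<epsilon> > 0\<close> \<delta>(1) by simp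
      fix t assume *: "\<And>t. 0 \<le> t \<Longrightarrow> t \<le> \<delta> * \<bar>c\<bar> \<Longrightarrow> x + (m + t) *\<^sub>R d \<in> frontier F"
        and t: "0 \<le> t" "t \<le> m + \<delta> * \<bar>c\<bar>"
      show "x + t *\<^sub>R d \<in> frontier F"
        using below[of t] *[of "t - m"] t by (cases "t < m") auto
    qed
    then have "m + \<delta> * \<bar>c\<bar> \<le> m" unfolding m_def by (rule cSup_upper[OF _ bdd])
    then show False using \<delta>(1) c(1) by (simp add: mult_le_0_iff)
  qed
  \<comment> \<open>Flat vertices may precede the end of the straight piece, so the first vertex on
    it is selected.\<close>
  define K where "K = {s. 0 < s \<and> s \<le> m \<and> x + s *\<^sub>R d \<in> V}"
  have "inj_on (\<lambda>s. x + s *\<^sub>R d) K" using d by (auto simp: inj_on_def)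
  moreover have "(\<lambda>s. x + s *\<^sub>R d) ` K \<subseteq> V" by (auto simp: K_def)
  ultimately have K: "finite K" using V_finite by (rule inj_on_finite)
  have "m \<in> K" using end_V m \<open>\<epsilon> > 0\<close> by (simp add: K_def)
  then have k: "Min K \<in> K" using K by (intro Min_in) auto
  have "x + s *\<^sub>R d \<notin> V" if "0 < s" "s < Min K" for s
  proof
    assume "x + s *\<^sub>R d \<in> V"
    then have "s \<in> K" using that k by (auto simp: K_def)
    then show False using Min_le[OF K] that(2) by fastforce
  qed
  moreover have "x + s *\<^sub>R d \<in> frontier F" if "0 \<le> s" "s \<le> Min K" for s
  proof -
    have "s \<le> m" using that(2) k by (simp add: K_def)
    then show ?thesis using below[of s] end_frontier that(1) by (cases "s = m") simp_all
  qed
  ultimately show ?thesis using k by (intro exI[of _ "Min K"]) (auto simp: K_def)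
qed

definition edge_between :: "point \<Rightarrow> point \<Rightarrow> bool" where
  "edge_between p q \<longleftrightarrow> p \<in> V \<and> q \<in> V \<and> p \<noteq> q \<and> closed_segment p q \<subseteq> frontier F \<and> open_segment p q \<inter> V = {}"

text \<open>For \<open>\<sigma> = 1\<close> the polygon lies to the left of the edge from \<open>p\<close> to \<open>q\<close>, for \<open>\<sigma> = -1\<close> to the right.\<close>

definition oriented_arc :: "real \<Rightarrow> point \<Rightarrow> point \<Rightarrow> bool" where
  "oriented_arc \<sigma> p q \<longleftrightarrow> edge_between p q \<and> (\<forall>z\<in>open_segment p q. left_half F z (\<sigma> *\<^sub>R (q - p)))"

lemma edge_between_sym: "edge_between p q \<longleftrightarrow> edge_between q p"
  by (auto simp: edge_between_def closed_segment_commute open_segment_commute)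

lemma arc_reverse: "oriented_arc \<sigma> p q \<longleftrightarrow> oriented_arc (- \<sigma>) q p"
proof -
  have "\<sigma> *\<^sub>R (q - p) = (- \<sigma>) *\<^sub>R (p - q)" by (simp add: algebra_simps)
  then show ?thesis unfolding oriented_arc_def by (metis edge_between_sym open_segment_commute)
qed

lemma edge_flat_points:
  assumes "edge_between p q" "z \<in> open_segment p q"
  shows "left_half F z (q - p) \<or> left_half F z (- (q - p))"
proof -
  have pq: "p \<noteq> q" using assms(1) by (simp add: edge_between_def)
  obtain s where s: "0 < s" "s < 1" "z = p + s *\<^sub>R (q - p)"
    using assms(2) open_segment_param[OF pq] by blast
  have "z \<in> frontier F" "z \<notin> V"
    using assms open_closed_segment by (auto simp: edge_between_def)
  then obtain d where d: "d \<noteq> 0" "left_half F z d" using flat_point by blast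
  have "z + t *\<^sub>R (q - p) \<in> frontier F" if "0 < t" "t \<le> 1 - s" for t
  proof -
    have "z + t *\<^sub>R (q - p) = p + (s + t) *\<^sub>R (q - p)" by (simp add: s(3) algebra_simps)
    then have "z + t *\<^sub>R (q - p) \<in> closed_segment p q"
      using s(1) that unfolding closed_segment_param by (intro exI[of _ "s + t"]) auto
    then show ?thesis using assms(1) by (auto simp: edge_between_def)
  qed
  then obtain c where c: "c \<noteq> 0" "d = c *\<^sub>R (q - p)"
    using left_half_direction[OF d(2,1), of "q - p" "1 - s"] s(2) pq by auto
  have "left_half F z ((1 / \<bar>c\<bar>) *\<^sub>R d)" using c(1) d(2) by (intro left_half_scale) auto
  moreover have "(1 / \<bar>c\<bar>) *\<^sub>R d = sgn c *\<^sub>R (q - p)" using c by (simp add: sgn_real_def)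
  ultimately show ?thesis using c(1) by (auto simp: sgn_real_def split: if_splits)
qed

text \<open>The parameters with \<open>F\<close> on the left and those with \<open>F\<close> on the
  right form disjoint open sets that cover the connected open interval, so one of them is empty
  there.\<close>

lemma edge_orientation:
  assumes e: "edge_between p q"
  shows "\<exists>\<sigma>\<in>{1, -1}. oriented_arc \<sigma> p q"
proof -
  have pq: "p \<noteq> q" using e by (simp add: edge_between_def)
  define d where "d = q - p"
  have d0: "d \<noteq> 0" using pq by (simp add: d_def)
  define U where "U = (\<lambda>\<sigma>. {s. left_half F (p + s *\<^sub>R d) (\<sigma> *\<^sub>R d)})"
  have U: "open (U \<sigma>)" if "\<sigma> \<in> {1, -1}" for \<sigma>
    unfolding open_dist
  proof
    fix s assume "s \<in> U \<sigma>"
    then have "left_half F (p + s *\<^sub>R d) (\<sigma> *\<^sub>R d)" by (simp add: U_def)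
    from left_half_slide[OF this] obtain \<epsilon> where \<epsilon>: "\<epsilon> > 0"
      "\<And>t. \<bar>t\<bar> \<le> \<epsilon> \<Longrightarrow> left_half F (p + s *\<^sub>R d + t *\<^sub>R (\<sigma> *\<^sub>R d)) (\<sigma> *\<^sub>R d)" by blast
    have "y \<in> U \<sigma>" if y: "dist y s < \<epsilon>" for y
    proof -
      have "\<bar>\<sigma> * (y - s)\<bar> \<le> \<epsilon>" using y \<open>\<sigma> \<in> _\<close> by (auto simp: dist_real_def abs_mult)
      from \<epsilon>(2)[OF this] have "left_half F (p + (s + \<sigma> * (y - s) * \<sigma>) *\<^sub>R d) (\<sigma> *\<^sub>R d)"
        by (simp only: scaleR_add_left scaleR_scaleR add.assoc)
      moreover have "s + \<sigma> * (y - s) * \<sigma> = y" using \<open>\<sigma> \<in> _\<close> by auto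
      ultimately show ?thesis by (simp add: U_def)
    qed
    then show "\<exists>e>0. \<forall>y. dist y s < e \<longrightarrow> y \<in> U \<sigma>" using \<epsilon>(1) by blast
  qed
  have cover: "{0<..<1} \<subseteq> U 1 \<union> U (-1)"
  proof
    fix s :: real assume "s \<in> {0<..<1}"
    then have "p + s *\<^sub>R d \<in> open_segment p q"
      unfolding open_segment_param[OF pq] d_def by auto
    from edge_flat_points[OF e this] show "s \<in> U 1 \<union> U (-1)" by (auto simp: U_def d_def)
  qed
  have disj: "U 1 \<inter> U (-1) = {}"
  proof -
    have "\<not> (left_half F (p + s *\<^sub>R d) d \<and> left_half F (p + s *\<^sub>R d) (- d))" for s
      using left_half_not_opposite[OF _ d0] by blast
    then show ?thesis unfolding U_def by auto
  qed
  have "U 1 \<inter> {0<..<1} = {} \<or> U (-1) \<inter> {0<..<1} = {}"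
    using connectedD[of "{0<..<1 :: real}" "U 1" "U (-1)"] U cover disj by auto
  then obtain \<sigma> where \<sigma>: "\<sigma> \<in> {1, -1}" "{0<..<1} \<subseteq> U \<sigma>"
    using cover by blast
  have "left_half F z (\<sigma> *\<^sub>R (q - p))" if "z \<in> open_segment p q" for z
    using that \<sigma>(2) unfolding open_segment_param[OF pq] by (auto simp: U_def d_def)
  then show ?thesis using \<sigma>(1) e unfolding oriented_arc_def by blast
qed

lemma edge_between_ray:
  assumes "p \<in> V" "d \<noteq> 0" "m > 0" "p + m *\<^sub>R d \<in> V"
    and "\<forall>s. 0 \<le> s \<and> s \<le> m \<longrightarrow> p + s *\<^sub>R d \<in> frontier F"
    and "\<forall>s. 0 < s \<and> s < m \<longrightarrow> p + s *\<^sub>R d \<notin> V"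
  shows "edge_between p (p + m *\<^sub>R d)"
proof -
  have ne: "p \<noteq> p + m *\<^sub>R d" using assms(2,3) by simp
  have "z \<in> frontier F" if mem: "z \<in> closed_segment p (p + m *\<^sub>R d)" for z
  proof -
    obtain s where s: "0 \<le> s" "s \<le> 1" "z = p + s *\<^sub>R (p + m *\<^sub>R d - p)"
      using mem unfolding closed_segment_param by blast
    then have z: "z = p + (s * m) *\<^sub>R d" by simp
    have "s * m \<le> m" "0 \<le> s * m" using s assms(3) by (auto simp: mult_left_le_one_le)
    then show ?thesis using z assms(5) by blast
  qed
  moreover have "z \<notin> V" if mem: "z \<in> open_segment p (p + m *\<^sub>R d)" for z
  proof -
    obtain s where s: "0 < s" "s < 1" "z = p + s *\<^sub>R (p + m *\<^sub>R d - p)"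
      using mem unfolding open_segment_param[OF ne] by blast
    then have z: "z = p + (s * m) *\<^sub>R d" by simp
    have "s * m < m" "0 < s * m" using s assms(3) by auto
    then show ?thesis using z assms(6) by blast
  qed
  ultimately show ?thesis using assms(1,4) ne unfolding edge_between_def by blast
qed

text \<open>Near \<open>p\<close> an arc follows one of the two boundary rays, and the side on which
  \<open>F\<close> lies tells which one. Following that ray to its first vertex gives existence; of
  two arcs on the same ray, the longer would have a vertex in its interior. The sign 1 yields the
  successor of a vertex, the sign -1 its predecessor.\<close>

lemma arc_exists_unique:
  assumes p: "p \<in> V" and \<sigma>: "\<sigma> \<in> {1, -1}"
  shows "\<exists>!q. oriented_arc \<sigma> p q"
proof -
  have pf: "p \<in> frontier F" using p V_frontier by blast
  obtain r and w :: "real \<Rightarrow> point" where r: "r > 0"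
    and w0: "\<forall>\<sigma>\<in>{1, -1}. w \<sigma> \<noteq> 0"
    and lh: "\<forall>\<sigma>\<in>{1, -1}. \<forall>s>0. s * norm (w \<sigma>) < r \<longrightarrow> left_half F (p + s *\<^sub>R w \<sigma>) (\<sigma> *\<^sub>R w \<sigma>)"
    and rays: "\<forall>z\<in>frontier F \<inter> ball p r. \<exists>\<sigma>\<in>{1, -1}. \<exists>s\<ge>0. z = p + s *\<^sub>R w \<sigma>"
    and "\<forall>c. w 1 = c *\<^sub>R w (-1) \<longrightarrow> left_half F p (w 1)"
    by (rule polygon_local_rays[OF polygon pf])
  have uniq_sign: "\<tau> = \<tau>'" if "\<tau> \<in> {1, -1}" "\<tau>' \<in> {1, -1 :: real}" "d \<noteq> 0"
    "left_half F z (\<tau> *\<^sub>R d)" "left_half F z (\<tau>' *\<^sub>R d)" for \<tau> \<tau>' z d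
    using that left_half_not_opposite[of F z d] by auto
  have along: "\<exists>k>0. q = p + k *\<^sub>R w \<sigma>" if "oriented_arc \<sigma> p q" for q
  proof -
    have e: "edge_between p q" and o: "\<And>z. z \<in> open_segment p q \<Longrightarrow> left_half F z (\<sigma> *\<^sub>R (q - p))"
      using that by (auto simp: oriented_arc_def)
    have pq: "p \<noteq> q" using e by (simp add: edge_between_def)
    obtain \<epsilon> where \<epsilon>: "\<epsilon> > 0" "\<And>s. \<bar>s\<bar> \<le> \<epsilon> \<Longrightarrow> p + s *\<^sub>R (q - p) \<in> ball p r"
      using small_step[OF r] by blast
    \<comment> \<open>The bound 1/2 keeps the point strictly inside the segment, where the
      orientation of the arc is known.\<close>
    define s where "s = min \<epsilon> (1 / 2)"
    define z where "z = p + s *\<^sub>R (q - p)"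
    have s: "0 < s" "s < 1" "\<bar>s\<bar> \<le> \<epsilon>" using \<epsilon>(1) by (auto simp: s_def)
    have zb: "z \<in> ball p r" unfolding z_def by (rule \<epsilon>(2)[OF s(3)])
    have zo: "z \<in> open_segment p q" unfolding open_segment_param[OF pq] z_def using s by blast
    then have "z \<in> frontier F" using e open_closed_segment by (auto simp: edge_between_def)
    then obtain \<tau> t where \<tau>: "\<tau> \<in> {1, -1}" "t \<ge> 0" "z = p + t *\<^sub>R w \<tau>" using rays zb by blast
    have eq: "s *\<^sub>R (q - p) = t *\<^sub>R w \<tau>" using \<tau>(3) by (simp add: z_def)
    have t: "t > 0"
      using \<tau>(2) eq s(1) pq by (cases "t = 0") auto
    have "t * norm (w \<tau>) < r" using zb t unfolding \<tau>(3) by (simp add: dist_norm)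
    then have "left_half F z (\<tau> *\<^sub>R w \<tau>)" unfolding \<tau>(3) using lh \<tau>(1) t by blast
    moreover have "left_half F z (\<sigma> *\<^sub>R w \<tau>)"
    proof -
      have "left_half F z ((s / t) *\<^sub>R (\<sigma> *\<^sub>R (q - p)))" using s t by (intro left_half_scale[OF o[OF zo]]) simp
      moreover have "(s / t) *\<^sub>R (\<sigma> *\<^sub>R (q - p)) = (\<sigma> / t) *\<^sub>R (s *\<^sub>R (q - p))" by simp
      ultimately show ?thesis unfolding eq using t by simp
    qed
    ultimately have "\<tau> = \<sigma>" using uniq_sign \<tau>(1) \<sigma> w0 by blast
    have "q = p + (1 / s) *\<^sub>R (s *\<^sub>R (q - p))" using s(1) by simp
    also have "\<dots> = p + (t / s) *\<^sub>R w \<sigma>" unfolding eq \<open>\<tau> = \<sigma>\<close> by simp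
    finally show ?thesis using s(1) t by (intro exI[of _ "t / s"]) simp
  qed
  have no_shorter: "\<not> k < k'" if "oriented_arc \<sigma> p (p + k *\<^sub>R w \<sigma>)" "oriented_arc \<sigma> p (p + k' *\<^sub>R w \<sigma>)" "k > 0" for k k'
  proof
    assume "k < k'"
    have ne: "p \<noteq> p + k' *\<^sub>R w \<sigma>" using w0 \<sigma> \<open>k < k'\<close> that(3) by auto
    have "p + k *\<^sub>R w \<sigma> \<in> open_segment p (p + k' *\<^sub>R w \<sigma>)"
      unfolding open_segment_param[OF ne] using \<open>k < k'\<close> that(3) by (intro exI[of _ "k / k'"]) auto
    then show False using that(1,2) by (auto simp: oriented_arc_def edge_between_def)
  qed
  have "\<exists>q. oriented_arc \<sigma> p q"
  proof -
    have nz: "w \<sigma> \<noteq> 0" "norm (w \<sigma>) > 0" using w0 \<sigma> by auto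
    define \<epsilon> where "\<epsilon> = r / (2 * norm (w \<sigma>))"
    have \<epsilon>: "\<epsilon> > 0" using r nz by (simp add: \<epsilon>_def)
    have half: "left_half F (p + s *\<^sub>R w \<sigma>) (\<sigma> *\<^sub>R w \<sigma>)" if "0 < s" "s \<le> \<epsilon>" for s
    proof -
      have "s * norm (w \<sigma>) \<le> \<epsilon> * norm (w \<sigma>)" using that by (intro mult_right_mono) auto
      also have "\<dots> < r" using r nz by (simp add: \<epsilon>_def)
      finally show ?thesis using lh \<sigma> that(1) by blast
    qed
    have "p + s *\<^sub>R w \<sigma> \<in> frontier F" if "0 < s" "s \<le> \<epsilon>" for s
      using left_half_imp_frontier[OF half[OF that]] nz(1) \<sigma> by auto
    from ray_reaches_vertex[OF pf nz(1) \<epsilon> this] obtain m where m: "m > 0" "p + m *\<^sub>R w \<sigma> \<in> V"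
      "\<forall>s. 0 \<le> s \<and> s \<le> m \<longrightarrow> p + s *\<^sub>R w \<sigma> \<in> frontier F"
      "\<forall>s. 0 < s \<and> s < m \<longrightarrow> p + s *\<^sub>R w \<sigma> \<notin> V" by blast
    define q where "q = p + m *\<^sub>R w \<sigma>"
    have e: "edge_between p q" unfolding q_def by (rule edge_between_ray[OF p nz(1) m])
    have pq: "p \<noteq> q" using e by (simp add: edge_between_def)
    obtain \<tau> where \<tau>: "\<tau> \<in> {1, -1}" "oriented_arc \<tau> p q" using edge_orientation[OF e] by blast
    define s where "s = min \<epsilon> (m / 2)"
    have s: "0 < s" "s \<le> \<epsilon>" "s < m" using \<epsilon> m(1) by (auto simp: s_def)
    have "p + s *\<^sub>R w \<sigma> \<in> open_segment p q"
      unfolding open_segment_param[OF pq] using s m(1) by (intro exI[of _ "s / m"]) (auto simp: q_def)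
    then have "left_half F (p + s *\<^sub>R w \<sigma>) (\<tau> *\<^sub>R (q - p))" using \<tau>(2) by (simp add: oriented_arc_def)
    then have "left_half F (p + s *\<^sub>R w \<sigma>) ((1 / m) *\<^sub>R (\<tau> *\<^sub>R (q - p)))"
      by (rule left_half_scale) (use m(1) in simp)
    moreover have "(1 / m) *\<^sub>R (\<tau> *\<^sub>R (q - p)) = \<tau> *\<^sub>R w \<sigma>" using m(1) by (simp add: q_def)
    ultimately have "left_half F (p + s *\<^sub>R w \<sigma>) (\<tau> *\<^sub>R w \<sigma>)" by simp
    then have "\<tau> = \<sigma>" using uniq_sign half[OF s(1,2)] \<tau>(1) \<sigma> nz(1) by blast
    then show ?thesis using \<tau>(2) by blast
  qed
  moreover have "q = q'" if q: "oriented_arc \<sigma> p q" "oriented_arc \<sigma> p q'" for q q'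
  proof -
    obtain k k' where k: "k > 0" "q = p + k *\<^sub>R w \<sigma>" "k' > 0" "q' = p + k' *\<^sub>R w \<sigma>"
      using along[OF q(1)] along[OF q(2)] by blast
    have "\<not> k < k'" "\<not> k' < k" using no_shorter q k by blast+
    then show ?thesis using k by auto
  qed
  ultimately show ?thesis by blast
qed

definition next_vertex :: "point \<Rightarrow> point" where
  "next_vertex p = (THE q. oriented_arc 1 p q)"

lemma arc_next: "p \<in> V \<Longrightarrow> oriented_arc 1 p (next_vertex p)"
  unfolding next_vertex_def by (rule theI') (rule arc_exists_unique; simp)

lemma arc_next_unique: "oriented_arc 1 p q \<Longrightarrow> q = next_vertex p"
  using arc_exists_unique[of p 1] arc_next[of p] by (auto simp: oriented_arc_def edge_between_def)

lemma next_edge: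
  assumes "p \<in> V"
  shows "next_vertex p \<in> V" "next_vertex p \<noteq> p" "closed_segment p (next_vertex p) \<subseteq> frontier F" "open_segment p (next_vertex p) \<inter> V = {}"
    "\<And>z. z \<in> open_segment p (next_vertex p) \<Longrightarrow> left_half F z (next_vertex p - p)"
  using arc_next[OF assms] by (auto simp: oriented_arc_def edge_between_def)

text \<open>Injectivity is the uniqueness of the arc traversed backwards; surjectivity follows from
  finiteness.\<close>

lemma bij_betw_next: "bij_betw next_vertex V V"
  unfolding bij_betw_def
proof
  show inj: "inj_on next_vertex V"
  proof (rule inj_onI)
    fix p q assume "p \<in> V" "q \<in> V" "next_vertex p = next_vertex q"
    then have "oriented_arc (-1) (next_vertex p) p" "oriented_arc (-1) (next_vertex p) q" using arc_next arc_reverse by metis+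
    moreover have "next_vertex p \<in> V" using next_edge(1) \<open>p \<in> V\<close> .
    ultimately show "p = q" using arc_exists_unique[of "next_vertex p" "-1"] by auto
  qed
  have "next_vertex ` V \<subseteq> V" using next_edge(1) by blast
  then show "next_vertex ` V = V" using inj V_finite by (simp add: endo_inj_surj)
qed

lemma edges_eq: "edges F V = (\<lambda>p. closed_segment p (next_vertex p)) ` V"
proof
  show "(\<lambda>p. closed_segment p (next_vertex p)) ` V \<subseteq> edges F V"
  proof
    fix E assume "E \<in> (\<lambda>p. closed_segment p (next_vertex p)) ` V"
    then obtain p where p: "p \<in> V" "E = closed_segment p (next_vertex p)" by blast
    show "E \<in> edges F V"
      unfolding edges_def using p next_edge(1-4)[OF p(1)]
      by (intro CollectI exI[of _ p] exI[of _ "next_vertex p"]) simp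
  qed
  show "edges F V \<subseteq> (\<lambda>p. closed_segment p (next_vertex p)) ` V"
  proof
    fix E assume "E \<in> edges F V"
    then obtain p q where pq: "edge_between p q" "E = closed_segment p q"
      by (auto simp: edges_def edge_between_def)
    then obtain \<sigma> where "\<sigma> \<in> {1, -1}" "oriented_arc \<sigma> p q" using edge_orientation by blast
    then consider "oriented_arc 1 p q" | "oriented_arc 1 q p" using arc_reverse[of "-1" p q] by auto
    then show "E \<in> (\<lambda>p. closed_segment p (next_vertex p)) ` V"
    proof cases
      case 1
      then show ?thesis using arc_next_unique[OF 1] pq unfolding edge_between_def by blast
    next
      case 2
      then show ?thesis using arc_next_unique[OF 2] pq closed_segment_commute[of p q]
        unfolding edge_between_def by blast
    qed
  qed
qed

text \<open>The danger is a two-cycle in which one segment is traversed in both directions; then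
  \<open>F\<close> would lie to the left of both directions.\<close>

lemma inj_on_edge: "inj_on (\<lambda>p. closed_segment p (next_vertex p)) V"
proof (rule inj_onI, rule ccontr)
  fix p q assume pq: "p \<in> V" "q \<in> V" "closed_segment p (next_vertex p) = closed_segment q (next_vertex q)" "p \<noteq> q"
  then have e: "next_vertex p = q" "next_vertex q = p" by (auto simp: doubleton_eq_iff)
  have m: "p + (1 / 2) *\<^sub>R (q - p) \<in> open_segment p q"
    unfolding open_segment_param[OF pq(4)] by (intro exI[of _ "1 / 2"]) simp
  have "left_half F (p + (1 / 2) *\<^sub>R (q - p)) (q - p)"
    using next_edge(5)[OF pq(1)] m by (simp add: e)
  moreover have "left_half F (p + (1 / 2) *\<^sub>R (q - p)) (- (q - p))"
    using next_edge(5)[OF pq(2)] m by (simp add: e open_segment_commute)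
  moreover have "q - p \<noteq> 0" using pq(4) by simp
  ultimately show False using left_half_not_opposite by blast
qed

text \<open>From a boundary point that is no vertex, the straight boundary is followed both ways to
  the first vertices; the two pieces together are an edge through the point.\<close>

lemma frontier_eq: "frontier F = (\<Union>p\<in>V. closed_segment p (next_vertex p))"
proof
  show "(\<Union>p\<in>V. closed_segment p (next_vertex p)) \<subseteq> frontier F" using next_edge(3) by blast
  show "frontier F \<subseteq> (\<Union>p\<in>V. closed_segment p (next_vertex p))"
  proof
    fix z assume z: "z \<in> frontier F"
    show "z \<in> (\<Union>p\<in>V. closed_segment p (next_vertex p))"
    proof (cases "z \<in> V")
      case False
      then obtain d where d: "d \<noteq> 0" "left_half F z d" using flat_point z by blast
      obtain \<epsilon> where \<epsilon>: "\<epsilon> > 0" "\<And>s. \<bar>s\<bar> \<le> \<epsilon> \<Longrightarrow> left_half F (z + s *\<^sub>R d) d"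
        using left_half_slide[OF d(2)] by blast
      have fr: "z + s *\<^sub>R d \<in> frontier F" if "\<bar>s\<bar> \<le> \<epsilon>" for s
        using left_half_imp_frontier[OF \<epsilon>(2)[OF that] d(1)] .
      have "z + s *\<^sub>R d \<in> frontier F" "z + s *\<^sub>R (- d) \<in> frontier F" if "0 < s" "s \<le> \<epsilon>" for s
        using fr[of s] fr[of "- s"] that by auto
      note ends = ray_reaches_vertex[OF z d(1) \<epsilon>(1) this(1)] ray_reaches_vertex[OF z _ \<epsilon>(1) this(2)]
      obtain m where m: "m > 0" "z + m *\<^sub>R d \<in> V" "\<And>s. 0 \<le> s \<Longrightarrow> s \<le> m \<Longrightarrow> z + s *\<^sub>R d \<in> frontier F"
        "\<And>s. 0 < s \<Longrightarrow> s < m \<Longrightarrow> z + s *\<^sub>R d \<notin> V" using ends(1) by blast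
      obtain n where n: "n > 0" "z + n *\<^sub>R (- d) \<in> V" "\<And>s. 0 \<le> s \<Longrightarrow> s \<le> n \<Longrightarrow> z + s *\<^sub>R (- d) \<in> frontier F"
        "\<And>s. 0 < s \<Longrightarrow> s < n \<Longrightarrow> z + s *\<^sub>R (- d) \<notin> V" using ends(2) d(1) by auto
      define p where "p = z + n *\<^sub>R (- d)"
      have shift: "p + s *\<^sub>R d = z + (s - n) *\<^sub>R d" "p + s *\<^sub>R d = z + (n - s) *\<^sub>R (- d)" for s
        by (simp_all add: p_def algebra_simps)
      have e: "edge_between p (p + (n + m) *\<^sub>R d)"
      proof (rule edge_between_ray)
        show "p \<in> V" using n(2) by (simp add: p_def)
        show "p + (n + m) *\<^sub>R d \<in> V" using m(2) shift(1)[of "n + m"] by simp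
        show "\<forall>s. 0 \<le> s \<and> s \<le> n + m \<longrightarrow> p + s *\<^sub>R d \<in> frontier F"
        proof (intro allI impI)
          fix s assume "0 \<le> s \<and> s \<le> n + m"
          then show "p + s *\<^sub>R d \<in> frontier F"
            using m(3)[of "s - n", folded shift(1)] n(3)[of "n - s", folded shift(2)] by (cases "s \<ge> n") simp_all
        qed
        show "\<forall>s. 0 < s \<and> s < n + m \<longrightarrow> p + s *\<^sub>R d \<notin> V"
        proof (intro allI impI)
          fix s assume s: "0 < s \<and> s < n + m"
          consider "s > n" | "s = n" | "s < n" by linarith
          then show "p + s *\<^sub>R d \<notin> V"
          proof cases
            case 1
            then show ?thesis using m(4)[of "s - n", folded shift(1)] s by simp
          next
            case 2
            then show ?thesis using False shift(1)[of s] by simp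
          next
            case 3
            then show ?thesis using n(4)[of "n - s", folded shift(2)] s by simp
          qed
        qed
      qed (use d(1) m(1) n(1) in auto)
      have "z = p + (n / (n + m)) *\<^sub>R ((p + (n + m) *\<^sub>R d) - p)" using n(1) m(1) by (simp add: p_def)
      then have zc: "z \<in> closed_segment p (p + (n + m) *\<^sub>R d)"
        unfolding closed_segment_param using n(1) m(1) by (intro exI[of _ "n / (n + m)"]) auto
      have "closed_segment p (p + (n + m) *\<^sub>R d) \<in> edges F V"
        using e unfolding edge_between_def edges_def by blast
      then show ?thesis using zc unfolding edges_eq by auto
    qed auto
  qed
qed

text \<open>A common point interior to one edge is interior to the other. By uniqueness of the
  direction with \<open>F\<close> on the left, the edges then lie on one line and point the same
  way; as they overlap, the start of one lies inside the other.\<close>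

lemma edges_meet_in_vertices:
  assumes p: "p \<in> V" "q \<in> V" "p \<noteq> q" and z: "z \<in> open_segment p (next_vertex p)" "z \<in> closed_segment q (next_vertex q)"
  shows False
proof -
  have ne: "p \<noteq> next_vertex p" "q \<noteq> next_vertex q" using next_edge(2) p by metis+
  have "z \<notin> V" using next_edge(4)[OF p(1)] z(1) by blast
  then have zq: "z \<in> open_segment q (next_vertex q)"
    using z(2) p(2) next_edge(1) unfolding open_segment_def by blast
  define d where "d = next_vertex p - p"
  define e where "e = next_vertex q - q"
  have de: "d \<noteq> 0" "e \<noteq> 0" using ne by (auto simp: d_def e_def)
  obtain k where k: "k > 0" "e = k *\<^sub>R d"
    using left_half_unique[OF next_edge(5)[OF p(1) z(1)] next_edge(5)[OF p(2) zq]] de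
    by (auto simp: d_def e_def)
  obtain s where s: "0 < s" "s < 1" "z = p + s *\<^sub>R d"
    using z(1) unfolding open_segment_param[OF ne(1)] by (auto simp: d_def)
  obtain t where t: "0 < t" "t < 1" "z = q + t *\<^sub>R e"
    using zq unfolding open_segment_param[OF ne(2)] by (auto simp: e_def)
  \<comment> \<open>The position of \<open>q\<close> on the line of the edge from \<open>p\<close>.
    A value between 0 and 1 puts \<open>q\<close> inside that edge, a negative value puts
    \<open>p\<close> inside the edge from \<open>q\<close>.\<close>
  define \<tau> where "\<tau> = s - t * k"
  have q: "q = p + \<tau> *\<^sub>R d" using s(3) t(3) k(2) by (simp add: \<tau>_def algebra_simps)
  have "\<not> (0 < \<tau> \<and> \<tau> < 1)"
  proof
    assume "0 < \<tau> \<and> \<tau> < 1"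
    then have "q \<in> open_segment p (next_vertex p)"
      unfolding open_segment_param[OF ne(1)] using q by (auto simp: d_def)
    then show False using next_edge(4)[OF p(1)] p(2) by blast
  qed
  moreover have "\<tau> < s" using t(1) k(1) by (simp add: \<tau>_def)
  ultimately have "\<tau> \<le> 0" using s(2) by linarith
  moreover have "\<tau> \<noteq> 0" using q p(3) by auto
  ultimately have neg: "\<tau> < 0" by simp
  have "- \<tau> < t * k" using s(1) by (simp add: \<tau>_def)
  also have "\<dots> < k" using t(2) k(1) by simp
  finally have "- \<tau> / k < 1" using k(1) by (subst pos_divide_less_eq) auto
  moreover have "0 < - \<tau> / k" using neg k(1) by (simp add: divide_less_0_iff)
  moreover have "p = q + (- \<tau> / k) *\<^sub>R e" using q k by simp
  ultimately have "p \<in> open_segment q (next_vertex q)"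
    unfolding open_segment_param[OF ne(2)] e_def by blast
  then show False using next_edge(4)[OF p(2)] p(1) by blast
qed

lemma frontier_nonempty: "frontier F \<noteq> {}"
proof -
  have "F \<noteq> {}" "bounded F" using polygon polygon_bounded by (auto simp: polygon_def)
  then show ?thesis by (intro frontier_not_empty) auto
qed

lemma V_nonempty: "V \<noteq> {}"
  using frontier_nonempty frontier_eq by auto

text \<open>The edges starting in \<open>W\<close> and those starting outside would form two
  disjoint closed sets covering the connected boundary. It follows that a quantity preserved by
  \<open>next_vertex\<close> is constant on all vertices.\<close>

lemma next_invariant_subset:
  assumes "W \<subseteq> V" "W \<noteq> {}" "\<And>p. p \<in> W \<Longrightarrow> next_vertex p \<in> W"
  shows "W = V"
proof (rule ccontr)
  assume "W \<noteq> V"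
  define A where "A = (\<Union>p\<in>W. closed_segment p (next_vertex p))"
  define B where "B = (\<Union>p\<in>V - W. closed_segment p (next_vertex p))"
  have inj: "inj_on next_vertex V" using bij_betw_next by (simp add: bij_betw_def)
  have "finite W" using assms(1) V_finite finite_subset by blast
  \<comment> \<open>An injective self-map of a finite set is onto, so the complement of
    \<open>W\<close> is invariant as well.\<close>
  then have onto: "next_vertex ` W = W"
    using assms(1,3) inj by (intro endo_inj_surj) (auto intro: inj_on_subset)
  have out: "next_vertex p \<notin> W" if "p \<in> V - W" for p
  proof
    assume "next_vertex p \<in> W"
    then obtain q where "q \<in> W" "next_vertex q = next_vertex p" using onto by (metis imageE)
    then have "q = p" using inj that assms(1) by (auto dest: inj_onD)
    then show False using that \<open>q \<in> W\<close> by simp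
  qed
  have "closed A" "closed B"
    unfolding A_def B_def using \<open>finite W\<close> V_finite by (auto intro!: closed_UN)
  moreover have "A \<union> B = frontier F" using assms(1) unfolding A_def B_def frontier_eq by blast
  moreover have "A \<inter> B = {}"
  proof (rule ccontr)
    assume "A \<inter> B \<noteq> {}"
    then obtain z p q where z: "p \<in> W" "q \<in> V - W" "z \<in> closed_segment p (next_vertex p)" "z \<in> closed_segment q (next_vertex q)"
      unfolding A_def B_def by blast
    then have pq: "p \<in> V" "q \<in> V" "p \<noteq> q" using assms(1) by auto
    have "z \<notin> open_segment p (next_vertex p)" "z \<notin> open_segment q (next_vertex q)"
      using edges_meet_in_vertices[OF pq _ z(4)] edges_meet_in_vertices[of q p z] pq z(3) by blast+
    then have "z \<in> {p, next_vertex p}" "z \<in> {q, next_vertex q}" using z(3,4) by (auto simp: open_segment_def)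
    then show False using z(1,2) assms(3)[OF z(1)] out[OF z(2)] by (metis DiffD2 insertE singletonD)
  qed
  moreover have "connected (frontier F)" using polygon by (simp add: polygon_def)
  ultimately have "A = {} \<or> B = {}" unfolding connected_closed by blast
  then show False using assms(1,2) \<open>W \<noteq> V\<close> unfolding A_def B_def by auto
qed

end

section \<open>The divergence theorem\<close>

lemma linepath_eq: "linepath p q s = p + s *\<^sub>R (q - p)"
  by (simp add: linepath_def algebra_simps)

lemma set_integrable_bounded_continuous:
  fixes f :: "'a::euclidean_space \<Rightarrow> 'b::{banach, second_countable_topology}"
  assumes "bounded S" "S \<in> sets borel" "continuous_on (closure S) f"
  shows "set_integrable lborel S f"
proof -
  have "set_integrable lborel (closure S) f"
    unfolding set_integrable_def using assms by (intro borel_integrable_compact) auto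
  then show ?thesis by (rule set_integrable_subset) (use assms(2) closure_subset in auto)
qed

text \<open>
  The primitive \<open>f\<close> on \<open>U\<close> becomes continuous on the whole line after
  adding the jumps \<open>f q\<close>, with sign, at the boundary points \<open>q\<close> to the left.
\<close>

lemma integral_derivative_open_set:
  fixes f :: "real \<Rightarrow> real"
  assumes U: "open U" "bounded U" and S: "finite S" "frontier U \<subseteq> S"
    and side: "\<And>x. x \<in> S \<Longrightarrow> \<sigma> x \<noteq> 0 \<and> (\<exists>r>0. \<forall>y. \<bar>y - x\<bar> < r \<longrightarrow> (y \<in> U \<longleftrightarrow> (y - x) * \<sigma> x < 0))"
    and f: "\<And>x. (f has_real_derivative f' x) (at x)" and f': "continuous_on UNIV f'"
  shows "(LINT x:U|lborel. f' x) = (\<Sum>x\<in>S. sgn (\<sigma> x) * f x)"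
proof -
  \<comment> \<open>If \<open>\<sigma> q > 0\<close>, then \<open>U\<close> ends at
    \<open>q\<close>, and \<open>q\<close> itself is outside \<open>U\<close>: the jump is added at
    \<open>q\<close> already. If \<open>\<sigma> q < 0\<close>, then \<open>U\<close> begins at
    \<open>q\<close> and the jump takes effect just after \<open>q\<close>.\<close>
  define J where "J = (\<lambda>x. \<Sum>q\<in>S. if q < x \<or> (q = x \<and> \<sigma> q > 0) then sgn (\<sigma> q) * f q else 0)"
  define H where "H = (\<lambda>x. (if x \<in> U then f x else 0) + J x)"
  have fcont: "isCont f x" for x using f DERIV_isCont by blast
  have J_local: "\<exists>\<delta>>0. \<exists>K. \<forall>x. \<bar>x - p\<bar> < \<delta> \<longrightarrow>
      J x = K + (if p \<in> S \<and> (p < x \<or> (p = x \<and> \<sigma> p > 0)) then sgn (\<sigma> p) * f p else 0)" for p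
  proof -
    obtain \<delta> where \<delta>: "\<delta> > 0" "\<And>q. q \<in> S \<Longrightarrow> q \<noteq> p \<Longrightarrow> \<delta> \<le> dist p q"
      using finite_set_avoid[OF S(1), of p] by blast
    have "J x = (\<Sum>q\<in>S - {p}. if q < p then sgn (\<sigma> q) * f q else 0) +
        (if p \<in> S \<and> (p < x \<or> (p = x \<and> \<sigma> p > 0)) then sgn (\<sigma> p) * f p else 0)" if x: "\<bar>x - p\<bar> < \<delta>" for x
    proof -
      have "(\<Sum>q\<in>S - {p}. if q < x \<or> (q = x \<and> \<sigma> q > 0) then sgn (\<sigma> q) * f q else 0) =
          (\<Sum>q\<in>S - {p}. if q < p then sgn (\<sigma> q) * f q else 0)"
      proof (rule sum.cong)
        fix q assume "q \<in> S - {p}"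
        then have "\<delta> \<le> \<bar>p - q\<bar>" using \<delta>(2)[of q] by (auto simp: dist_real_def)
        then have "(q < x \<or> (q = x \<and> \<sigma> q > 0)) \<longleftrightarrow> q < p" using x by (auto simp: abs_real_def split: if_splits)
        then show "(if q < x \<or> (q = x \<and> \<sigma> q > 0) then sgn (\<sigma> q) * f q else 0) = (if q < p then sgn (\<sigma> q) * f q else 0)"
          by simp
      qed simp
      then show ?thesis
        using S(1) by (cases "p \<in> S") (simp_all add: J_def sum.remove)
    qed
    then show ?thesis using \<delta>(1) by blast
  qed
  have off_S: "\<exists>\<delta>>0. \<exists>K. \<forall>x. \<bar>x - p\<bar> < \<delta> \<longrightarrow> (x \<in> U \<longleftrightarrow> p \<in> U) \<and> H x = (if p \<in> U then f x else 0) + K" if p: "p \<notin> S" for p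
  proof -
    obtain \<delta> K where \<delta>: "\<delta> > 0" "\<And>x. \<bar>x - p\<bar> < \<delta> \<Longrightarrow> J x = K"
      using J_local[of p] p by auto
    have "p \<in> interior U \<or> p \<in> - closure U" using p S(2) by (auto simp: frontier_def)
    then obtain W where W: "open W" "p \<in> W" "\<And>x. x \<in> W \<Longrightarrow> x \<in> U \<longleftrightarrow> p \<in> U"
    proof
      assume "p \<in> interior U"
      then show thesis using that[of "interior U"] interior_subset by blast
    next
      assume "p \<in> - closure U"
      then show thesis using that[of "- closure U"] closure_subset by blast
    qed
    then obtain \<epsilon> where \<epsilon>: "\<epsilon> > 0" "\<And>x. \<bar>x - p\<bar> < \<epsilon> \<Longrightarrow> x \<in> W"
      by (auto simp: open_dist dist_real_def)
    show ?thesis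
    proof (intro exI conjI allI impI)
      show "min \<delta> \<epsilon> > 0" using \<delta>(1) \<epsilon>(1) by simp
      fix x assume x: "\<bar>x - p\<bar> < min \<delta> \<epsilon>"
      then show xU: "x \<in> U \<longleftrightarrow> p \<in> U" using \<epsilon>(2)[of x] W(3) by simp
      show "H x = (if p \<in> U then f x else 0) + K" using x xU \<delta>(2)[of x] by (simp add: H_def)
    qed
  qed
  have H_deriv: "(H has_vector_derivative (if x \<in> U then f' x else 0)) (at x)" if x: "x \<notin> S" for x
  proof -
    obtain \<delta> K where \<delta>: "\<delta> > 0" "\<And>y. \<bar>y - x\<bar> < \<delta> \<Longrightarrow> H y = (if x \<in> U then f y else 0) + K"
      using off_S[OF x] by blast
    have "((\<lambda>y. (if x \<in> U then f y else 0) + K) has_real_derivative (if x \<in> U then f' x else 0)) (at x)"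
      using f by (cases "x \<in> U") (auto intro!: derivative_eq_intros)
    then have "(H has_real_derivative (if x \<in> U then f' x else 0)) (at x)"
      by (rule has_field_derivative_transform_within[OF _ \<delta>(1)]) (use \<delta>(2) in \<open>auto simp: dist_real_def\<close>)
    then show ?thesis by (simp add: has_real_derivative_iff_has_vector_derivative)
  qed
  have H_cont: "isCont H p" for p
  proof (cases "p \<in> S")
    case False
    from H_deriv[OF this] show ?thesis by (rule has_vector_derivative_continuous)
  next
    case True
    obtain r where r: "r > 0" "\<And>y. \<bar>y - p\<bar> < r \<Longrightarrow> y \<in> U \<longleftrightarrow> (y - p) * \<sigma> p < 0" and \<sigma>: "\<sigma> p \<noteq> 0"
      using side[OF True] by blast
    obtain \<delta> K where \<delta>: "\<delta> > 0" "\<And>x. \<bar>x - p\<bar> < \<delta> \<Longrightarrow> J x = K + (if p < x \<or> (p = x \<and> \<sigma> p > 0) then sgn (\<sigma> p) * f p else 0)"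
      using J_local[of p] True by auto
    \<comment> \<open>The local form of \<open>H\<close>: it follows \<open>f\<close> on the side of
      \<open>p\<close> where \<open>U\<close> lies and is constant on the other side.\<close>
    define G where "G = (\<lambda>x. K + (if \<sigma> p > 0 then f (min x p) else f (max x p) - f p))"
    have "H x = G x" if "\<bar>x - p\<bar> < min r \<delta>" for x
    proof -
      have xU: "x \<in> U \<longleftrightarrow> (x - p) * \<sigma> p < 0" by (rule r(2)) (use that in simp)
      have J: "J x = K + (if p < x \<or> (p = x \<and> \<sigma> p > 0) then sgn (\<sigma> p) * f p else 0)"
        by (rule \<delta>(2)) (use that in simp)
      show ?thesis
        using \<sigma> by (auto simp: H_def G_def J xU mult_less_0_iff min_def max_def sgn_real_def)
    qed
    then have ev: "eventually (\<lambda>x. H x = G x) (nhds p)"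
      unfolding eventually_nhds_metric using r(1) \<delta>(1) by (intro exI[of _ "min r \<delta>"]) (auto simp: dist_real_def)
    have fc: "continuous_on UNIV f" using fcont by (simp add: continuous_on_eq_continuous_at)
    have "continuous_on UNIV (\<lambda>x. f (min x p))" "continuous_on UNIV (\<lambda>x. f (max x p))"
      by (rule continuous_on_compose2[OF fc]; auto intro!: continuous_intros)+
    then have "continuous_on UNIV G" unfolding G_def by (cases "\<sigma> p > 0") (auto intro!: continuous_intros)
    then have "isCont G p" by (simp add: continuous_on_eq_continuous_at)
    then show ?thesis using isCont_cong[OF ev] by simp
  qed
  have "bounded (U \<union> S)" using U(2) S(1) by (simp add: finite_imp_bounded)
  \<comment> \<open>At \<open>- B\<close> no jump has been added yet, at \<open>B\<close> all of
    them have.\<close>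
  then obtain B where B: "B > 0" "\<And>x. x \<in> U \<union> S \<Longrightarrow> \<bar>x\<bar> < B" by (auto simp: bounded_pos_less)
  have HB: "H (- B) = 0" "H B = (\<Sum>x\<in>S. sgn (\<sigma> x) * f x)"
  proof -
    have "- B \<notin> U" "B \<notin> U" using B by force+
    moreover have "J (- B) = 0" unfolding J_def using B by (intro sum.neutral) force
    moreover have "J B = (\<Sum>x\<in>S. sgn (\<sigma> x) * f x)" unfolding J_def using B by (intro sum.cong) force+
    ultimately show "H (- B) = 0" "H B = (\<Sum>x\<in>S. sgn (\<sigma> x) * f x)" by (simp_all add: H_def)
  qed
  have "((\<lambda>x. if x \<in> U then f' x else 0) has_integral (H B - H (- B))) {- B..B}"
    using S(1) B(1) H_deriv H_cont
    by (intro fundamental_theorem_of_calculus_strong[of S]) (auto simp: continuous_at_imp_continuous_on)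
  moreover have "U \<subseteq> {- B..B}" using B by force
  ultimately have "(f' has_integral (\<Sum>x\<in>S. sgn (\<sigma> x) * f x)) U"
    by (simp add: has_integral_restrict HB)
  moreover have "set_integrable lborel U f'"
    using U f' by (intro set_integrable_bounded_continuous) (auto intro: continuous_on_subset)
  ultimately show ?thesis
    using set_borel_integral_eq_integral(2) integral_unique by metis
qed

text \<open>
  Fubini reduces the divergence theorem to the boundary points of the horizontal slices. All
  but finitely many slices avoid the end points of the boundary segments.
\<close>

lemma green_fst:
  fixes p q N :: "'i \<Rightarrow> point" and f f1 :: "point \<Rightarrow> real"
  assumes F: "open F" "bounded F" and A: "finite A"
    and fr: "frontier F \<subseteq> (\<Union>i\<in>A. closed_segment (p i) (q i))"
    and ne: "\<And>i. i \<in> A \<Longrightarrow> p i \<noteq> q i"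
    and half: "\<And>i z. i \<in> A \<Longrightarrow> z \<in> open_segment (p i) (q i) \<Longrightarrow> \<exists>r>0. \<forall>y\<in>ball z r. y \<in> F \<longleftrightarrow> (y - z) \<bullet> N i < 0"
    and N: "\<And>i. i \<in> A \<Longrightarrow> \<bar>fst (N i)\<bar> = \<bar>snd (q i) - snd (p i)\<bar>"
    and disj: "\<And>i j z. i \<in> A \<Longrightarrow> j \<in> A \<Longrightarrow> i \<noteq> j \<Longrightarrow> z \<in> open_segment (p i) (q i) \<Longrightarrow> z \<notin> closed_segment (p j) (q j)"
    and f: "\<And>x y. ((\<lambda>x. f (x, y)) has_real_derivative f1 (x, y)) (at x)"
    and cont: "continuous_on UNIV f" "continuous_on UNIV f1"
  shows "(LINT z:F|lborel. f1 z) = (\<Sum>i\<in>A. fst (N i) * (LINT s:{0..1}|lborel. f (linepath (p i) (q i) s)))"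
proof -
  define d where "d = (\<lambda>i. q i - p i)"
  define \<tau> where "\<tau> = (\<lambda>i y. (y - snd (p i)) / snd (d i))"
  \<comment> \<open>The contribution of segment \<open>i\<close> at height \<open>y\<close>.
    Horizontal segments contribute zero, in accordance with the first component of
    \<open>N i\<close>, which vanishes for them.\<close>
  define g where "g = (\<lambda>i y. if snd (d i) = 0 then 0 else
    indicator {0..1} (\<tau> i y) * (sgn (fst (N i)) * f (linepath (p i) (q i) (\<tau> i y))))"
  \<comment> \<open>The heights of the end points form a null set, which also contains the heights
    of all horizontal segments.\<close>
  define Y where "Y = snd ` (p ` A \<union> q ` A)"
  have Y: "finite Y" using A by (simp add: Y_def)
  have intF: "set_integrable lborel F f1"
    using F cont by (intro set_integrable_bounded_continuous) (auto intro: continuous_on_subset)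
  have slice: "(LINT x|lborel. indicator F (x, y) *\<^sub>R f1 (x, y)) = (\<Sum>i\<in>A. g i y)" if y: "y \<notin> Y" for y
  proof -
    define U where "U = (\<lambda>x. (x, y)) -` F"
    define A' where "A' = {i\<in>A. snd (d i) \<noteq> 0 \<and> \<tau> i y \<in> {0..1}}"
    define X where "X = (\<lambda>i. fst (linepath (p i) (q i) (\<tau> i y)))"
    have z: "(X i, y) = linepath (p i) (q i) (\<tau> i y)" "(X i, y) \<in> open_segment (p i) (q i)" if i: "i \<in> A'" for i
    proof -
      have i': "i \<in> A" "snd (d i) \<noteq> 0" "0 \<le> \<tau> i y" "\<tau> i y \<le> 1" using i by (auto simp: A'_def)
      have y_eq: "y = snd (p i) + \<tau> i y * snd (d i)" using i'(2) by (simp add: \<tau>_def)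
      show 1: "(X i, y) = linepath (p i) (q i) (\<tau> i y)"
        using y_eq by (auto simp: X_def linepath_eq d_def prod_eq_iff)
      have "y \<noteq> snd (p i)" "y \<noteq> snd (q i)" using y i'(1) by (auto simp: Y_def)
      then have "\<tau> i y \<noteq> 0" "\<tau> i y \<noteq> 1" using y_eq by (auto simp: d_def)
      then have "0 < \<tau> i y" "\<tau> i y < 1" using i' by auto
      then show "(X i, y) \<in> open_segment (p i) (q i)"
        unfolding open_segment_param[OF ne[OF i'(1)]] 1 linepath_eq by blast
    qed
    have inj: "inj_on X A'"
    proof (rule inj_onI, rule ccontr)
      fix i j assume ij: "i \<in> A'" "j \<in> A'" "X i = X j" "i \<noteq> j"
      have "(X i, y) \<in> closed_segment (p j) (q j)" using z(2)[OF ij(2)] ij(3) open_closed_segment by auto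
      then show False using disj[of i j "(X i, y)"] z(2)[OF ij(1)] ij by (auto simp: A'_def)
    qed
    have A'A: "A' \<subseteq> A" and finA': "finite A'" using A by (auto simp: A'_def)
    \<comment> \<open>The one-dimensional lemma indexes jumps by points, so the normals are carried
      from segments to crossing points; \<open>inj\<close> makes this unambiguous.\<close>
    define \<sigma> where "\<sigma> = (\<lambda>x. fst (N (the_inv_into A' X x)))"
    have \<sigma>X: "\<sigma> (X i) = fst (N i)" if "i \<in> A'" for i
      using the_inv_into_f_f[OF inj that] by (simp add: \<sigma>_def)
    have "open U" unfolding U_def by (intro open_vimage F(1) continuous_intros)
    moreover have "bounded U"
    proof -
      have "U \<subseteq> fst ` F" by (force simp: U_def)
      then show ?thesis using bounded_fst[OF F(2)] bounded_subset by blast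
    qed
    moreover have "frontier U \<subseteq> X ` A'"
    proof
      fix x assume x: "x \<in> frontier U"
      then have "x \<in> closure U" "x \<notin> U" using \<open>open U\<close> by (auto simp: frontier_def interior_open)
      have "(\<lambda>x. (x, y)) ` closure U \<subseteq> closure F"
        by (rule image_closure_subset) (auto simp: U_def closure_subset[THEN subsetD] intro!: continuous_intros)
      then have "(x, y) \<in> frontier F"
        using \<open>x \<in> closure U\<close> \<open>x \<notin> U\<close> F(1) by (auto simp: frontier_def interior_open U_def)
      then obtain i where i: "i \<in> A" "(x, y) \<in> closed_segment (p i) (q i)" using fr by blast
      then obtain s where s: "0 \<le> s" "s \<le> 1" "(x, y) = p i + s *\<^sub>R d i"
        unfolding closed_segment_param d_def by blast
      from s(3) have y_eq: "y = snd (p i) + s * snd (d i)" and x_eq: "x = fst (p i) + s * fst (d i)"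
        by (auto simp: prod_eq_iff)
      have nz: "snd (d i) \<noteq> 0"
      proof
        assume "snd (d i) = 0"
        then have "y \<in> Y" using y_eq i(1) by (auto simp: Y_def)
        then show False using y by simp
      qed
      then have "\<tau> i y = s" using y_eq by (simp add: \<tau>_def)
      then have "i \<in> A'" "X i = x" using i(1) nz s x_eq by (auto simp: A'_def X_def linepath_eq d_def)
      then show "x \<in> X ` A'" by blast
    qed
    moreover have "\<sigma> x \<noteq> 0 \<and> (\<exists>r>0. \<forall>y. \<bar>y - x\<bar> < r \<longrightarrow> (y \<in> U \<longleftrightarrow> (y - x) * \<sigma> x < 0))" if x: "x \<in> X ` A'" for x
    proof -
      obtain i where i: "i \<in> A'" "x = X i" using x by blast
      have "fst (N i) \<noteq> 0" using N[of i] i(1) by (auto simp: A'_def d_def)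
      moreover obtain r where r: "r > 0" "\<forall>y'\<in>ball (x, y) r. y' \<in> F \<longleftrightarrow> (y' - (x, y)) \<bullet> N i < 0"
        using half[OF _ z(2)[OF i(1)]] i A'A by blast
      have "x' \<in> U \<longleftrightarrow> (x' - x) * fst (N i) < 0" if "\<bar>x' - x\<bar> < r" for x'
      proof -
        have "(x', y) \<in> ball (x, y) r" using that by (simp add: dist_Pair_Pair dist_real_def abs_minus_commute)
        then show ?thesis using r(2) by (simp add: U_def inner_prod_def)
      qed
      ultimately show ?thesis using r(1) \<sigma>X[OF i(1)] i(2) by auto
    qed
    moreover have "continuous_on UNIV (\<lambda>x. f1 (x, y))"
      by (rule continuous_on_compose2[OF cont(2)]) (auto intro!: continuous_intros)
    ultimately have "(LINT x:U|lborel. f1 (x, y)) = (\<Sum>x\<in>X ` A'. sgn (\<sigma> x) * f (x, y))"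
      using f finA' by (intro integral_derivative_open_set) auto
    also have "\<dots> = (\<Sum>i\<in>A'. sgn (fst (N i)) * f (X i, y))"
      by (simp add: sum.reindex[OF inj] \<sigma>X)
    also have "\<dots> = (\<Sum>i\<in>A'. g i y)"
      by (rule sum.cong) (auto simp: g_def z(1) A'_def)
    also have "\<dots> = (\<Sum>i\<in>A. g i y)"
    proof (rule sum.mono_neutral_left[OF A A'A], rule ballI)
      fix i assume "i \<in> A - A'"
      then have "snd (d i) = 0 \<or> \<tau> i y \<notin> {0..1}" by (auto simp: A'_def)
      then show "g i y = 0" unfolding g_def by (auto simp: indicator_def)
    qed
    also have "(LINT x:U|lborel. f1 (x, y)) = (LINT x|lborel. indicator F (x, y) *\<^sub>R f1 (x, y))"
      unfolding set_lebesgue_integral_def by (intro Bochner_Integration.integral_cong) (auto simp: U_def indicator_def)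
    finally show ?thesis .
  qed
  have g_integral: "integrable lborel (g i) \<and>
      (LINT y|lborel. g i y) = fst (N i) * (LINT s:{0..1}|lborel. f (linepath (p i) (q i) s))" if i: "i \<in> A" for i
  proof (cases "snd (d i) = 0")
    case True
    then show ?thesis using N[OF i] by (simp add: g_def d_def)
  next
    case False
    have gs: "g i (snd (p i) + snd (d i) * s) = sgn (fst (N i)) * (indicator {0..1} s *\<^sub>R f (linepath (p i) (q i) s))" for s
      using False by (simp add: g_def \<tau>_def)
    have "set_integrable lborel {0..1} (\<lambda>s. f (linepath (p i) (q i) s))"
      by (rule set_integrable_bounded_continuous)
        (auto intro!: continuous_on_compose2[OF cont(1)] continuous_intros simp: linepath_def)
    then have int: "integrable lborel (\<lambda>s. g i (snd (p i) + snd (d i) * s))"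
      unfolding gs set_integrable_def by simp
    \<comment> \<open>Passing from the height to the parameter of the segment contributes
      \<open>\<bar>snd (d i)\<bar>\<close>, which together with the sign makes up
      \<open>fst (N i)\<close>.\<close>
    have "(LINT y|lborel. g i y) = \<bar>snd (d i)\<bar> *\<^sub>R (LINT s|lborel. g i (snd (p i) + snd (d i) * s))"
      by (rule lborel_integral_real_affine[OF False])
    also have "\<dots> = (\<bar>snd (d i)\<bar> * sgn (fst (N i))) * (LINT s:{0..1}|lborel. f (linepath (p i) (q i) s))"
      unfolding gs set_lebesgue_integral_def by simp
    also have "\<bar>snd (d i)\<bar> * sgn (fst (N i)) = fst (N i)"
      using N[OF i] abs_mult_sgn[of "fst (N i)"] by (simp add: d_def mult.commute)
    finally show ?thesis using int lborel_integrable_real_affine_iff[OF False] by blast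
  qed
  have int2: "integrable (lborel \<Otimes>\<^sub>M lborel) (\<lambda>(x, y). indicator F (x, y) *\<^sub>R f1 (x, y))"
  proof -
    have "(\<lambda>(x, y). indicator F (x, y) *\<^sub>R f1 (x, y)) = (\<lambda>z. indicator F z *\<^sub>R f1 z)" by auto
    then show ?thesis using intF unfolding set_integrable_def by (simp only: lborel_prod)
  qed
  have "(LINT z:F|lborel. f1 z) = (LINT z|(lborel \<Otimes>\<^sub>M lborel). (case z of (x, y) \<Rightarrow> indicator F (x, y) *\<^sub>R f1 (x, y)))"
    by (simp add: set_lebesgue_integral_def lborel_prod)
  also have "\<dots> = (LINT y|lborel. LINT x|lborel. indicator F (x, y) *\<^sub>R f1 (x, y))"
    by (rule lborel_pair.integral_snd[OF int2, symmetric])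
  also have "\<dots> = (LINT y|lborel. (\<Sum>i\<in>A. g i y))"
  proof (rule integral_cong_AE)
    show "(\<lambda>y. LINT x|lborel. indicator F (x, y) *\<^sub>R f1 (x, y)) \<in> borel_measurable lborel"
      by (rule borel_measurable_integrable[OF lborel_pair.integrable_snd[OF int2]])
    show "(\<lambda>y. \<Sum>i\<in>A. g i y) \<in> borel_measurable lborel"
      using g_integral by (intro borel_measurable_sum) (blast intro: borel_measurable_integrable)
    show "AE y in lborel. (LINT x|lborel. indicator F (x, y) *\<^sub>R f1 (x, y)) = (\<Sum>i\<in>A. g i y)"
    proof (rule AE_I')
      show "Y \<in> null_sets lborel" using Y by (rule finite_imp_null_set_lborel)
      show "{y \<in> space lborel. (LINT x|lborel. indicator F (x, y) *\<^sub>R f1 (x, y)) \<noteq> (\<Sum>i\<in>A. g i y)} \<subseteq> Y"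
        using slice by blast
    qed
  qed
  also have "\<dots> = (\<Sum>i\<in>A. LINT y|lborel. g i y)"
    using g_integral by (intro Bochner_Integration.integral_sum) auto
  also have "\<dots> = (\<Sum>i\<in>A. fst (N i) * (LINT s:{0..1}|lborel. f (linepath (p i) (q i) s)))"
    using g_integral by (intro sum.cong) auto
  finally show ?thesis .
qed

section \<open>Exchange of the coordinates\<close>

lemma dist_swap: "dist (prod.swap x) (prod.swap (y :: point)) = dist x y"
  by (simp add: dist_prod_def add.commute)

lemma linepath_swap: "linepath (prod.swap p) (prod.swap (q :: point)) s = prod.swap (linepath p q s)"
  by (simp add: linepath_def prod_eq_iff)

lemma closed_segment_swap: "prod.swap (z :: point) \<in> closed_segment p q \<longleftrightarrow> z \<in> closed_segment (prod.swap p) (prod.swap q)"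
  unfolding closed_segment_param by (simp add: prod_eq_iff conj_commute)

lemma open_segment_swap: "prod.swap (z :: point) \<in> open_segment p q \<longleftrightarrow> z \<in> open_segment (prod.swap p) (prod.swap q)"
proof -
  have "prod.swap z = p \<longleftrightarrow> z = prod.swap p" "prod.swap z = q \<longleftrightarrow> z = prod.swap q" by (auto simp: prod_eq_iff)
  then show ?thesis by (simp add: open_segment_def closed_segment_swap)
qed

lemma set_integral_swap:
  fixes f :: "point \<Rightarrow> real"
  assumes "set_integrable lborel S f"
  shows "(LINT z:prod.swap -` S|lborel. f (prod.swap z)) = (LINT z:S|lborel. f z)"
proof -
  let ?g = "\<lambda>z. indicator S z *\<^sub>R f z"
  have "?g \<in> borel_measurable (lborel \<Otimes>\<^sub>M lborel)"
    using assms unfolding set_integrable_def lborel_prod by (rule borel_measurable_integrable)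
  from lborel_pair.integral_product_swap[OF this]
  have "(LINT z|(lborel \<Otimes>\<^sub>M lborel). (case z of (x, y) \<Rightarrow> ?g (y, x))) = (LINT z|(lborel \<Otimes>\<^sub>M lborel). ?g z)" .
  moreover have "(\<lambda>z. case z of (x, y) \<Rightarrow> ?g (y, x)) = (\<lambda>z. indicator (prod.swap -` S) z *\<^sub>R f (prod.swap z))"
    by (auto simp: indicator_def)
  ultimately show ?thesis by (simp add: set_lebesgue_integral_def lborel_prod)
qed

text \<open>Exchanging the coordinates reduces this to \<open>green_fst\<close>. The exchange
  reverses orientation, but the side of \<open>F\<close> is expressed by the normal \<open>N\<close>
  and not by the order of the end points.\<close>

lemma green_snd:
  fixes p q N :: "'i \<Rightarrow> point" and f f2 :: "point \<Rightarrow> real"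
  assumes F: "open F" "bounded F" and A: "finite A"
    and fr: "frontier F \<subseteq> (\<Union>i\<in>A. closed_segment (p i) (q i))"
    and ne: "\<And>i. i \<in> A \<Longrightarrow> p i \<noteq> q i"
    and half: "\<And>i z. i \<in> A \<Longrightarrow> z \<in> open_segment (p i) (q i) \<Longrightarrow> \<exists>r>0. \<forall>y\<in>ball z r. y \<in> F \<longleftrightarrow> (y - z) \<bullet> N i < 0"
    and N: "\<And>i. i \<in> A \<Longrightarrow> \<bar>snd (N i)\<bar> = \<bar>fst (q i) - fst (p i)\<bar>"
    and disj: "\<And>i j z. i \<in> A \<Longrightarrow> j \<in> A \<Longrightarrow> i \<noteq> j \<Longrightarrow> z \<in> open_segment (p i) (q i) \<Longrightarrow> z \<notin> closed_segment (p j) (q j)"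
    and f: "\<And>x y. ((\<lambda>y. f (x, y)) has_real_derivative f2 (x, y)) (at y)"
    and cont: "continuous_on UNIV f" "continuous_on UNIV f2"
  shows "(LINT z:F|lborel. f2 z) = (\<Sum>i\<in>A. snd (N i) * (LINT s:{0..1}|lborel. f (linepath (p i) (q i) s)))"
proof -
  let ?sw = "prod.swap :: point \<Rightarrow> point"
  let ?F = "?sw -` F"
  have swc: "continuous_on S ?sw" for S
    unfolding prod.swap_def by (intro continuous_intros)
  have "(LINT z:?F|lborel. f2 (?sw z)) =
    (\<Sum>i\<in>A. fst (?sw (N i)) * (LINT s:{0..1}|lborel. f (?sw (linepath (?sw (p i)) (?sw (q i)) s))))"
  proof (rule green_fst)
    show opn: "open ?F" by (rule open_vimage[OF F(1) swc])
    have "?F = ?sw ` F" by force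
    also have "\<dots> \<subseteq> snd ` F \<times> fst ` F" by force
    finally show "bounded ?F" using F(2) bounded_fst bounded_snd bounded_Times bounded_subset by metis
    show "frontier ?F \<subseteq> (\<Union>i\<in>A. closed_segment (?sw (p i)) (?sw (q i)))"
    proof
      fix z assume z: "z \<in> frontier ?F"
      have "?sw ` closure ?F \<subseteq> closure F"
        by (rule image_closure_subset[OF swc]) (auto intro: closure_subset[THEN subsetD])
      moreover have "z \<in> closure ?F" "z \<notin> ?F" using z opn by (auto simp: frontier_def interior_open)
      ultimately have "?sw z \<in> frontier F" using F(1) by (auto simp: frontier_def interior_open)
      then show "z \<in> (\<Union>i\<in>A. closed_segment (?sw (p i)) (?sw (q i)))"
        using fr by (auto simp: closed_segment_swap[symmetric] simp del: swap_simp)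
    qed
    show "?sw (p i) \<noteq> ?sw (q i)" if "i \<in> A" for i using ne[OF that] by (auto simp: prod_eq_iff)
    show "\<exists>r>0. \<forall>y\<in>ball z r. y \<in> ?F \<longleftrightarrow> (y - z) \<bullet> ?sw (N i) < 0"
      if i: "i \<in> A" and z: "z \<in> open_segment (?sw (p i)) (?sw (q i))" for i z
    proof -
      obtain r where r: "r > 0" "\<forall>y\<in>ball (?sw z) r. y \<in> F \<longleftrightarrow> (y - ?sw z) \<bullet> N i < 0"
        using half[OF i] z open_segment_swap by blast
      have "y \<in> ?F \<longleftrightarrow> (y - z) \<bullet> ?sw (N i) < 0" if "y \<in> ball z r" for y
      proof -
        have "?sw y \<in> ball (?sw z) r" using that by (simp only: mem_ball dist_swap)
        then show ?thesis using r(2) by (simp add: inner_prod_def add.commute)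
      qed
      then show ?thesis using r(1) by blast
    qed
    show "\<bar>fst (?sw (N i))\<bar> = \<bar>snd (?sw (q i)) - snd (?sw (p i))\<bar>" if "i \<in> A" for i
      using N[OF that] by simp
    show "z \<notin> closed_segment (?sw (p j)) (?sw (q j))"
      if "i \<in> A" "j \<in> A" "i \<noteq> j" "z \<in> open_segment (?sw (p i)) (?sw (q i))" for i j z
      using disj[OF that(1-3)] that(4) unfolding open_segment_swap[symmetric] closed_segment_swap[symmetric] by blast
    show "((\<lambda>x. f (?sw (x, y))) has_real_derivative f2 (?sw (x, y))) (at x)" for x y
      using f by simp
    show "continuous_on UNIV (\<lambda>z. f (?sw z))" "continuous_on UNIV (\<lambda>z. f2 (?sw z))"
      using continuous_on_compose2[OF cont(1) swc] continuous_on_compose2[OF cont(2) swc] by auto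
  qed (rule A)
  moreover have "set_integrable lborel F f2"
    using F cont by (intro set_integrable_bounded_continuous) (auto intro: continuous_on_subset)
  ultimately show ?thesis by (simp add: set_integral_swap linepath_swap)
qed

text \<open>The description is unambiguous: a segment determines its end points up to order, and the
  substitution \<open>1 - s\<close> takes care of the order.\<close>

lemma edge_integral_segment:
  "edge_integral (closed_segment a b) f = dist a b * (LINT s:{0..1}|lborel. f (linepath a b s))"
proof -
  have rev: "(LINT s:{0..1}|lborel. f (linepath b a s)) = (LINT s:{0..1}|lborel. f (linepath a b s))" for a b
  proof -
    have "(LINT s|lborel. indicator {0..1} s *\<^sub>R f (linepath b a s)) =
        \<bar>-1\<bar> *\<^sub>R (LINT s|lborel. indicator {0..1} (1 + (-1) * s) *\<^sub>R f (linepath b a (1 + (-1) * s)))"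
      by (rule lborel_integral_real_affine) simp
    also have "\<dots> = (LINT s|lborel. indicator {0..1} s *\<^sub>R f (linepath a b s))"
      by (auto intro!: Bochner_Integration.integral_cong simp: indicator_def linepath_def algebra_simps)
    finally show ?thesis by (simp add: set_lebesgue_integral_def)
  qed
  show ?thesis
    unfolding edge_integral_def
  proof (rule the_equality)
    show "\<forall>a' b'. closed_segment a b = closed_segment a' b' \<longrightarrow>
      dist a b * (LINT s:{0..1}|lborel. f (linepath a b s)) = dist a' b' * (LINT s:{0..1}|lborel. f (linepath a' b' s))"
      using rev by (auto simp: doubleton_eq_iff dist_commute)
  qed blast
qed

lemma edge_integral_cong:
  assumes "\<And>z. z \<in> closed_segment a b \<Longrightarrow> f z = g z"
  shows "edge_integral (closed_segment a b) f = edge_integral (closed_segment a b) g"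
proof -
  have "linepath a b s \<in> closed_segment a b" if "s \<in> {0..1}" for s
    using that linepath_in_path[of s a b] by simp
  then show ?thesis
    unfolding edge_integral_segment using assms
    by (intro arg_cong[where f = "(*) (dist a b)"] set_lebesgue_integral_cong) (simp, blast)
qed

lemma set_integrable_unit_interval: "continuous_on {0..1} f \<Longrightarrow> set_integrable lborel {0..1} (f :: real \<Rightarrow> real)"
  by (intro set_integrable_bounded_continuous) auto

lemma integral_pderiv: "(LINT s:{0..1}|lborel. poly (pderiv P) s) = poly P 1 - poly P (0 :: real)"
proof -
  have "((\<lambda>s. poly (pderiv P) s) has_integral (poly P 1 - poly P 0)) {0..1}"
    by (rule fundamental_theorem_of_calculus)
      (auto simp: has_real_derivative_iff_has_vector_derivative[symmetric] intro!: poly_DERIV has_field_derivative_at_within)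
  moreover have "set_integrable lborel {0..1} (poly (pderiv P))"
    by (intro set_integrable_unit_interval continuous_intros)
  ultimately show ?thesis using set_borel_integral_eq_integral(2) integral_unique by metis
qed

lemma continuous_nonneg_integral_zero:
  fixes f :: "real \<Rightarrow> real"
  assumes "continuous_on {0..1} f" "\<And>s. s \<in> {0..1} \<Longrightarrow> 0 \<le> f s" "(LINT s:{0..1}|lborel. f s) = 0" "s \<in> {0..1}"
  shows "f s = 0"
proof -
  have "set_integrable lborel {0..1} f" using assms(1) by (rule set_integrable_unit_interval)
  from has_integral_set_lebesgue[of "{0..1}" f] set_borel_integral_eq_integral[OF this] assms(3)
  have "(f has_integral 0) (cbox 0 1)" by (simp add: has_integral_iff)
  then show ?thesis using has_integral_0_cbox_imp_0[of 0 1 f] assms by auto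
qed

context face
begin

definition side :: "point \<Rightarrow> point" where
  "side p = next_vertex p - p"

lemma side_nonzero: "p \<in> V \<Longrightarrow> side p \<noteq> 0"
  using next_edge(2) by (simp add: side_def)

lemma F_open: "open F" and F_bounded: "bounded F" and F_nonempty: "F \<noteq> {}"
  using polygon polygon_open polygon_bounded by (auto simp: polygon_def)

lemma edge_half_plane:
  assumes "p \<in> V" "z \<in> open_segment p (next_vertex p)"
  shows "\<exists>r>0. \<forall>y\<in>ball z r. y \<in> F \<longleftrightarrow> (y - z) \<bullet> - perp (side p) < 0"
  using next_edge(5)[OF assms] by (simp add: left_half_def side_def)

text \<open>As \<open>F\<close> lies to the left of \<open>side p\<close>, the outward normal is
  \<open>- perp (side p)\<close>. Its length is that of the edge and replaces the arc-length
  factor.\<close>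

lemma divergence_theorem:
  assumes w: "w \<in> vpolys l"
  shows "face_integral F (divergence w) =
    - (\<Sum>p\<in>V. LINT s:{0..1}|lborel. w (linepath p (next_vertex p) s) \<bullet> perp (side p))"
proof -
  let ?a = "\<lambda>z. fst (w z)" and ?b = "\<lambda>z. snd (w z)"
  have a: "?a \<in> polys l" and b: "?b \<in> polys l" using w by (auto simp: mem_vpolys)
  note ga = polys_has_grad[OF a] and gb = polys_has_grad[OF b]
  have da: "((\<lambda>x. ?a (x, y)) has_real_derivative dx ?a (x, y)) (at x)" for x y
    using has_grad_line_derivative[OF ga(1), of "(0, y)" "(1, 0)" x] by simp
  have db: "((\<lambda>y. ?b (x, y)) has_real_derivative dy ?b (x, y)) (at y)" for x y
    using has_grad_line_derivative[OF gb(1), of "(x, 0)" "(0, 1)" y] by simp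
  have disj: "z \<notin> closed_segment q (next_vertex q)"
    if "p \<in> V" "q \<in> V" "p \<noteq> q" "z \<in> open_segment p (next_vertex p)" for p q z
    using edges_meet_in_vertices[OF that] by blast
  have ne: "p \<noteq> next_vertex p" if "p \<in> V" for p using next_edge(2)[OF that] by simp
  have fr: "frontier F \<subseteq> (\<Union>p\<in>V. closed_segment p (next_vertex p))" using frontier_eq by simp
  have 1: "(LINT z:F|lborel. dx ?a z) =
      (\<Sum>p\<in>V. fst (- perp (side p)) * (LINT s:{0..1}|lborel. ?a (linepath p (next_vertex p) s)))"
    by (rule green_fst[where p = "\<lambda>p. p", OF F_open F_bounded V_finite fr ne edge_half_plane _ disj da
          continuous_on_polys[OF a] continuous_on_polys[OF ga(2)]])
      (auto simp: perp_def side_def)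
  have 2: "(LINT z:F|lborel. dy ?b z) =
      (\<Sum>p\<in>V. snd (- perp (side p)) * (LINT s:{0..1}|lborel. ?b (linepath p (next_vertex p) s)))"
    by (rule green_snd[where p = "\<lambda>p. p", OF F_open F_bounded V_finite fr ne edge_half_plane _ disj db
          continuous_on_polys[OF b] continuous_on_polys[OF gb(3)]])
      (auto simp: perp_def side_def)
  have int: "set_integrable lborel F (dx ?a)" "set_integrable lborel F (dy ?b)"
    using F_open F_bounded continuous_on_polys[OF ga(2)] continuous_on_polys[OF gb(3)]
    by (auto intro!: set_integrable_bounded_continuous)
  have "face_integral F (divergence w) = (LINT z:F|lborel. dx ?a z + dy ?b z)"
    unfolding face_integral_def ext[OF divergence_eq[OF w]] ..
  also have "\<dots> = (LINT z:F|lborel. dx ?a z) + (LINT z:F|lborel. dy ?b z)"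
    using int by (rule set_integral_add)
  also have "\<dots> = (\<Sum>p\<in>V. - (LINT s:{0..1}|lborel. w (linepath p (next_vertex p) s) \<bullet> perp (side p)))"
    unfolding 1 2 sum.distrib[symmetric]
  proof (rule sum.cong)
    fix p assume "p \<in> V"
    have c: "continuous_on {0..1} (\<lambda>s. ?a (linepath p (next_vertex p) s))" "continuous_on {0..1} (\<lambda>s. ?b (linepath p (next_vertex p) s))"
      by (rule continuous_on_compose2[OF continuous_on_polys[OF a, of UNIV]]
          continuous_on_compose2[OF continuous_on_polys[OF b, of UNIV]]; auto intro: continuous_on_linepath)+
    have "(LINT s:{0..1}|lborel. w (linepath p (next_vertex p) s) \<bullet> perp (side p)) =
      (LINT s:{0..1}|lborel. fst (perp (side p)) * ?a (linepath p (next_vertex p) s) + snd (perp (side p)) * ?b (linepath p (next_vertex p) s))"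
      by (simp add: inner_prod_def mult.commute)
    also have "\<dots> = fst (perp (side p)) * (LINT s:{0..1}|lborel. ?a (linepath p (next_vertex p) s)) +
        snd (perp (side p)) * (LINT s:{0..1}|lborel. ?b (linepath p (next_vertex p) s))"
      using c by (subst set_integral_add(2)) (auto intro!: set_integrable_unit_interval continuous_intros)
    finally show "fst (- perp (side p)) * (LINT s:{0..1}|lborel. ?a (linepath p (next_vertex p) s)) +
        snd (- perp (side p)) * (LINT s:{0..1}|lborel. ?b (linepath p (next_vertex p) s)) =
        - (LINT s:{0..1}|lborel. w (linepath p (next_vertex p) s) \<bullet> perp (side p))" by simp
  qed simp
  finally show ?thesis by (simp add: sum_negf)
qed

lemma sum_edges: "(\<Sum>E\<in>edges F V. h E) = (\<Sum>p\<in>V. h (closed_segment p (next_vertex p)))"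
  unfolding edges_eq by (simp add: sum.reindex[OF inj_on_edge])

text \<open>Both sums agree, since \<open>next_vertex\<close> permutes the vertices.\<close>

lemma telescope:
  fixes h :: "point \<Rightarrow> real"
  shows "(\<Sum>p\<in>V. h (next_vertex p) - h p) = 0"
  using sum.reindex_bij_betw[OF bij_betw_next, of h] by (simp add: sum_subtractf)

end

section \<open>Edge terms with the prescribed tangents\<close>

locale face_tangents = face +
  fixes t :: "point set \<Rightarrow> point"
  assumes tangents: "\<forall>E\<in>edges F V. unit_tangent E (t E)"
begin

abbreviation seg :: "point \<Rightarrow> point set" where
  "seg p \<equiv> closed_segment p (next_vertex p)"

abbreviation walk :: "point \<Rightarrow> real \<Rightarrow> point" where
  "walk p \<equiv> linepath p (next_vertex p)"

lemma seg_edge: "p \<in> V \<Longrightarrow> seg p \<in> edges F V"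
  by (simp add: edges_eq)

text \<open>The reciprocal of the edge length, positive if the tangent follows the counter-clockwise
  walk and negative otherwise. It converts derivatives in the walk parameter into derivatives along
  \<open>t\<close>.\<close>

definition speed :: "point \<Rightarrow> real" where
  "speed p = (t (seg p) \<bullet> side p) / (side p \<bullet> side p)"

lemma tangent_eq:
  assumes p: "p \<in> V"
  shows "t (seg p) = speed p *\<^sub>R side p" "\<bar>speed p\<bar> * norm (side p) = 1" "speed p \<noteq> 0"
proof -
  have u: "unit_tangent (seg p) (t (seg p))" using tangents seg_edge[OF p] by blast
  then obtain c where c: "side p = c *\<^sub>R t (seg p)" unfolding unit_tangent_def side_def by fastforce
  have n: "norm (t (seg p)) = 1" using u by (simp add: unit_tangent_def)
  then have tt: "t (seg p) \<bullet> t (seg p) = 1" by (simp add: norm_eq_1)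
  have c0: "c \<noteq> 0" using side_nonzero[OF p] c by auto
  have sp: "speed p = 1 / c" unfolding speed_def c using c0 by (simp add: tt)
  show "t (seg p) = speed p *\<^sub>R side p" unfolding c sp using c0 by simp
  show "\<bar>speed p\<bar> * norm (side p) = 1" unfolding sp c using c0 n by simp
  show "speed p \<noteq> 0" using c0 sp by simp
qed

text \<open>The reversed tangent turned by a right angle is a multiple of
  \<open>perp (side p)\<close>, which points into \<open>F\<close>; the factor is
  \<open>- speed p\<close>. Hence the sign is 1 just for tangents running against the walk.\<close>

lemma edge_sign_eq:
  assumes p: "p \<in> V"
  shows "edge_sign F t (seg p) = - sgn (speed p)"
proof -
  have ri: "rel_interior (seg p) = open_segment p (next_vertex p)"
    using next_edge(2)[OF p] by (auto simp: rel_interior_closed_segment)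
  have ne: "p \<noteq> next_vertex p" using next_edge(2)[OF p] by simp
  have half: "\<exists>\<epsilon>>0. \<forall>s. 0 < s \<and> s \<le> \<epsilon> \<longrightarrow> (z + s *\<^sub>R perp (c *\<^sub>R side p) \<in> F \<longleftrightarrow> 0 < c)"
    if z: "z \<in> open_segment p (next_vertex p)" for z c
  proof -
    obtain r where r: "r > 0" "\<forall>y\<in>ball z r. y \<in> F \<longleftrightarrow> (y - z) \<bullet> - perp (side p) < 0"
      using edge_half_plane[OF p z] by blast
    obtain \<epsilon> where \<epsilon>: "\<epsilon> > 0" "\<And>s. \<bar>s\<bar> \<le> \<epsilon> \<Longrightarrow> z + s *\<^sub>R perp (c *\<^sub>R side p) \<in> ball z r"
      using small_step[OF r(1)] by blast
    have "z + s *\<^sub>R perp (c *\<^sub>R side p) \<in> F \<longleftrightarrow> 0 < c" if "0 < s \<and> s \<le> \<epsilon>" for s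
    proof -
      have "\<bar>s\<bar> \<le> \<epsilon>" using that by simp
      from bspec[OF r(2) \<epsilon>(2)[OF this]]
      have "z + s *\<^sub>R perp (c *\<^sub>R side p) \<in> F \<longleftrightarrow> 0 < (s * (side p \<bullet> side p)) * c" by (simp add: mult_ac)
      moreover have "0 < s * (side p \<bullet> side p)" using that side_nonzero[OF p] by simp
      ultimately show ?thesis by (metis zero_less_mult_pos mult_pos_pos)
    qed
    then show ?thesis using \<epsilon>(1) by blast
  qed
  have "ccw_direction F (seg p) (- t (seg p)) \<longleftrightarrow> speed p < 0"
  proof -
    have mt: "- t (seg p) = (- speed p) *\<^sub>R side p" using tangent_eq(1)[OF p] by simp
    have "(\<forall>\<^sub>F \<epsilon> in at_right 0. z + \<epsilon> *\<^sub>R perp ((- speed p) *\<^sub>R side p) \<in> F) \<longleftrightarrow> speed p < 0"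
      if z: "z \<in> open_segment p (next_vertex p)" for z
    proof -
      obtain \<epsilon> where \<epsilon>: "\<epsilon> > 0"
        "\<And>s. 0 < s \<Longrightarrow> s \<le> \<epsilon> \<Longrightarrow> z + s *\<^sub>R perp ((- speed p) *\<^sub>R side p) \<in> F \<longleftrightarrow> 0 < - speed p"
        using half[OF z, of "- speed p"] by blast
      have "\<forall>\<^sub>F s in at_right 0. z + s *\<^sub>R perp ((- speed p) *\<^sub>R side p) \<in> F \<longleftrightarrow> speed p < 0"
        unfolding eventually_at_right_field using \<epsilon> by (intro exI[of _ \<epsilon>]) auto
      then have "(\<forall>\<^sub>F s in at_right 0. z + s *\<^sub>R perp ((- speed p) *\<^sub>R side p) \<in> F) \<longleftrightarrow> (\<forall>\<^sub>F s in at_right (0 :: real). speed p < 0)"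
        by (rule eventually_subst)
      then show ?thesis by simp
    qed
    moreover obtain z where "z \<in> open_segment p (next_vertex p)" using ne by (metis ex_in_conv open_segment_eq_empty)
    ultimately show ?thesis unfolding ccw_direction_def ri rotation_pi_half mt by blast
  qed
  then show ?thesis using tangent_eq(3)[OF p] by (simp add: edge_sign_def)
qed

text \<open>The edge sign, the edge length and the speed in the normal multiply to -1, so the choice
  of the tangent cancels.\<close>

lemma edge_term_normal:
  assumes p: "p \<in> V"
  shows "edge_sign F t (seg p) * edge_integral (seg p) (\<lambda>z. q z * (w z \<bullet> edge_normal t (seg p))) =
    - (LINT s:{0..1}|lborel. q (walk p s) * (w (walk p s) \<bullet> perp (side p)))"
proof -
  have n: "edge_normal t (seg p) = speed p *\<^sub>R perp (side p)"
    by (simp add: edge_normal_def rotation_pi_half tangent_eq(1)[OF p])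
  have "edge_integral (seg p) (\<lambda>z. q z * (w z \<bullet> edge_normal t (seg p))) =
    norm (side p) * (LINT s:{0..1}|lborel. speed p * (q (walk p s) * (w (walk p s) \<bullet> perp (side p))))"
    unfolding edge_integral_segment n by (simp add: dist_norm norm_minus_commute side_def mult_ac)
  also have "\<dots> = (norm (side p) * speed p) * (LINT s:{0..1}|lborel. q (walk p s) * (w (walk p s) \<bullet> perp (side p)))"
    by simp
  finally have "edge_sign F t (seg p) * edge_integral (seg p) (\<lambda>z. q z * (w z \<bullet> edge_normal t (seg p))) =
    - (sgn (speed p) * (norm (side p) * speed p)) * (LINT s:{0..1}|lborel. q (walk p s) * (w (walk p s) \<bullet> perp (side p)))"
    by (simp only: edge_sign_eq[OF p] mult_minus_left mult.assoc)
  moreover have "sgn (speed p) * (norm (side p) * speed p) = 1"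
    using tangent_eq(2)[OF p] by (simp add: abs_sgn mult_ac)
  ultimately show ?thesis by simp
qed

text \<open>Here one factor \<open>speed p\<close> remains; it will cancel against the one in the
  boundary gradient.\<close>

lemma edge_term_tangent:
  assumes p: "p \<in> V"
  shows "edge_sign F t (seg p) * edge_integral (seg p) g = - (LINT s:{0..1}|lborel. g (walk p s)) / speed p"
proof -
  have "edge_integral (seg p) g = norm (side p) * (LINT s:{0..1}|lborel. g (walk p s))"
    unfolding edge_integral_segment by (simp add: dist_norm norm_minus_commute side_def)
  moreover have "sgn (speed p) * norm (side p) = 1 / speed p"
  proof -
    have "speed p * (sgn (speed p) * norm (side p)) = 1" using tangent_eq(2)[OF p] by (simp add: abs_sgn mult_ac)
    then show ?thesis using tangent_eq(3)[OF p] by (simp add: field_simps)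
  qed
  ultimately show ?thesis by (simp add: edge_sign_eq[OF p] mult.assoc[symmetric])
qed

lemma walk_in_seg: "0 \<le> s \<Longrightarrow> s \<le> 1 \<Longrightarrow> walk p s \<in> seg p"
  unfolding closed_segment_param linepath_eq by blast

lemma seg_walk: "z \<in> seg p \<Longrightarrow> \<exists>s. 0 \<le> s \<and> s \<le> 1 \<and> z = walk p s"
  unfolding closed_segment_param linepath_eq by blast

text \<open>The space on an edge is defined by plane polynomials; here it becomes univariate in the
  walk parameter, the converse direction being the extension constant across the edge.\<close>

lemma P_space_edge:
  assumes p: "p \<in> V"
  shows "g \<in> P_space l (seg p) \<longleftrightarrow>
    g \<in> extensional (seg p) \<and> (\<exists>Q\<in>upoly l. \<forall>s. 0 \<le> s \<longrightarrow> s \<le> 1 \<longrightarrow> g (walk p s) = poly Q s)"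
proof
  assume "g \<in> P_space l (seg p)"
  then obtain h where h: "h \<in> polys l" "g = restrict h (seg p)" by (auto simp: P_space_def)
  obtain Q where "Q \<in> upoly l" "\<forall>s. h (walk p s) = poly Q s" using polys_trace[OF h(1)] by blast
  then show "g \<in> extensional (seg p) \<and> (\<exists>Q\<in>upoly l. \<forall>s. 0 \<le> s \<longrightarrow> s \<le> 1 \<longrightarrow> g (walk p s) = poly Q s)"
    using h(2) walk_in_seg by auto
next
  assume g: "g \<in> extensional (seg p) \<and> (\<exists>Q\<in>upoly l. \<forall>s. 0 \<le> s \<longrightarrow> s \<le> 1 \<longrightarrow> g (walk p s) = poly Q s)"
  then obtain Q where Q: "Q \<in> upoly l" "\<And>s. 0 \<le> s \<Longrightarrow> s \<le> 1 \<Longrightarrow> g (walk p s) = poly Q s" by blast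
  obtain h where h: "h \<in> polys l" "\<And>s. h (walk p s) = poly Q s"
    using polys_extend_trace[OF Q(1), of p "next_vertex p"] next_edge(2)[OF p] by metis
  have "g = restrict h (seg p)"
  proof
    fix z show "g z = restrict h (seg p) z"
    proof (cases "z \<in> seg p")
      case True
      then obtain s where "0 \<le> s" "s \<le> 1" "z = walk p s" using seg_walk by blast
      then have "g z = h z" using Q(2)[of s] h(2)[of s] by simp
      then show ?thesis using True by simp
    next
      case False
      then have "g z = undefined" using conjunct1[OF g] by (rule extensional_arb[rotated])
      then show ?thesis using False by simp
    qed
  qed
  then show "g \<in> P_space l (seg p)" using h(1) by (auto simp: P_space_def)
qed

lemma edge_deriv_eq:
  assumes p: "p \<in> V" and Q: "\<And>s. 0 \<le> s \<Longrightarrow> s \<le> 1 \<Longrightarrow> q (walk p s) = poly Q s"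
    and s: "0 \<le> s" "s \<le> 1"
  shows "edge_deriv (seg p) (t (seg p)) q (walk p s) = speed p * poly (pderiv Q) s"
proof -
  define c where "c = speed p"
  have c0: "c \<noteq> 0" using tangent_eq(3)[OF p] by (simp add: c_def)
  have move: "walk p s + u *\<^sub>R t (seg p) = walk p (s + u * c)" for u
  proof -
    have "t (seg p) = c *\<^sub>R (next_vertex p - p)" using tangent_eq(1)[OF p] by (simp add: c_def side_def)
    then show ?thesis unfolding linepath_eq by (simp only: scaleR_scaleR scaleR_add_left add.assoc)
  qed
  have mem: "walk p v \<in> seg p \<longleftrightarrow> 0 \<le> v \<and> v \<le> 1" for v
  proof -
    have "next_vertex p - p \<noteq> 0" using next_edge(2)[OF p] by simp
    then show ?thesis unfolding linepath_eq closed_segment_param by auto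
  qed
  \<comment> \<open>The parameter interval of the edge seen from \<open>walk p s\<close>, whose
    order depends on the sign of \<open>c\<close>. It is nondegenerate and contains 0, so the
    possibly one-sided derivative is unique.\<close>
  define a b where "a = (if c > 0 then - s / c else (1 - s) / c)" and "b = (if c > 0 then (1 - s) / c else - s / c)"
  have S: "{u. walk p s + u *\<^sub>R t (seg p) \<in> seg p} = {a..b}"
    unfolding move mem a_def b_def using c0 by (auto simp: field_simps split: if_splits)
  have ab: "a < b" "0 \<in> {a..b}"
    using c0 s by (auto simp: a_def b_def field_simps split: if_splits)
  have "((\<lambda>u. poly Q (s + u * c)) has_real_derivative c * poly (pderiv Q) s) (at 0 within {a..b})"
    by (auto intro!: derivative_eq_intros)
  then have "((\<lambda>u. poly Q (s + u * c)) has_vector_derivative c * poly (pderiv Q) s) (at 0 within {a..b})"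
    by (simp add: has_real_derivative_iff_has_vector_derivative)
  then have "((\<lambda>u. q (walk p s + u *\<^sub>R t (seg p))) has_vector_derivative c * poly (pderiv Q) s) (at 0 within {a..b})"
  proof (rule has_vector_derivative_transform[OF ab(2), rotated])
    fix u assume "u \<in> {a..b}"
    then have u: "walk p (s + u * c) \<in> seg p" unfolding S[symmetric] move by simp
    then show "q (walk p s + u *\<^sub>R t (seg p)) = poly Q (s + u * c)"
      unfolding move using Q u[unfolded mem] by blast
  qed
  from vector_derivative_within_closed_interval[OF ab this]
  show ?thesis unfolding edge_deriv_def S c_def .
qed

end

section \<open>Projectors and the rotated gradient\<close>

lemma lin_on_add: "lin_on W L \<Longrightarrow> lin_on W M \<Longrightarrow> lin_on W (\<lambda>w. L w + M w)"
  by (simp add: lin_on_def algebra_simps)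

lemma lin_on_scale: "lin_on W L \<Longrightarrow> lin_on W (\<lambda>w. a * L w)"
  by (simp add: lin_on_def algebra_simps)

lemma lin_on_minus: "lin_on W L \<Longrightarrow> lin_on W (\<lambda>w. - L w)"
  by (simp add: lin_on_def)

lemma lin_on_sum: "(\<And>i. i \<in> A \<Longrightarrow> lin_on W (L i)) \<Longrightarrow> lin_on W (\<lambda>w. \<Sum>i\<in>A. L i w)"
  by (simp add: lin_on_def sum.distrib sum_distrib_left)

lemma lin_on_subset: "lin_on W L \<Longrightarrow> W' \<subseteq> W \<Longrightarrow> lin_on W' L"
  unfolding lin_on_def by blast

lemma lin_on_path_integral:
  fixes g :: "real \<Rightarrow> 'b::euclidean_space" and W :: "(point \<Rightarrow> 'b) set"
  assumes "continuous_on {0..1} g" "\<And>w. w \<in> W \<Longrightarrow> continuous_on UNIV w"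
  shows "lin_on W (\<lambda>w. LINT s:{0..1}|lborel. g s \<bullet> w (linepath a b s))"
proof -
  have c: "set_integrable lborel {0..1} (\<lambda>s. g s \<bullet> w (linepath a b s))" if "w \<in> W" for w
  proof -
    have "continuous_on {0..1} (\<lambda>s. w (linepath a b s))"
      by (rule continuous_on_compose2[OF assms(2)[OF that]]) (auto intro: continuous_on_linepath)
    then show ?thesis using assms(1) by (intro set_integrable_unit_interval continuous_intros)
  qed
  then show ?thesis
    unfolding lin_on_def by (auto simp: inner_add_right set_integral_add)
qed

text \<open>An abstract \<open>J\<close> serves the face and the edges alike. The members of
  \<open>W\<close> live on the whole plane, and definiteness on \<open>X\<close> is enough because
  only restrictions to \<open>X\<close> are compared.\<close>

lemma L2_projector_eqI:
  fixes f p :: "point \<Rightarrow> 'b::real_inner"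
  assumes W: "subspace W"
    and lin: "\<And>u. u \<in> W \<Longrightarrow> lin_on W (\<lambda>w. J (\<lambda>z. u z \<bullet> w z))"
    and diff: "\<And>u w. u \<in> W \<Longrightarrow> w \<in> W \<Longrightarrow> J (\<lambda>z. (f z - u z) \<bullet> w z) = J (\<lambda>z. f z \<bullet> w z) - J (\<lambda>z. u z \<bullet> w z)"
    and definite: "\<And>u. u \<in> W \<Longrightarrow> J (\<lambda>z. u z \<bullet> u z) = 0 \<Longrightarrow> \<forall>z\<in>X. u z = 0"
    and cong: "\<And>g h. (\<And>z. z \<in> X \<Longrightarrow> g z = h z) \<Longrightarrow> J g = J h"
    and p: "p \<in> W" "\<And>w. w \<in> W \<Longrightarrow> J (\<lambda>z. p z \<bullet> w z) = J (\<lambda>z. f z \<bullet> w z)"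
  shows "L2_projector J ((\<lambda>w. restrict w X) ` W) f = restrict p X"
proof -
  have restr: "J (\<lambda>z. (f z - restrict u X z) \<bullet> restrict w X z) = J (\<lambda>z. f z \<bullet> w z) - J (\<lambda>z. u z \<bullet> w z)"
    if "u \<in> W" "w \<in> W" for u w
    using diff[OF that] cong[of "\<lambda>z. (f z - restrict u X z) \<bullet> restrict w X z" "\<lambda>z. (f z - u z) \<bullet> w z"] by simp
  show ?thesis
    unfolding L2_projector_def
  proof (rule the_equality)
    show "restrict p X \<in> (\<lambda>w. restrict w X) ` W \<and>
      (\<forall>w\<in>(\<lambda>w. restrict w X) ` W. J (\<lambda>z. (f z - restrict p X z) \<bullet> w z) = 0)"
      using p restr by auto
  next
    fix v assume v: "v \<in> (\<lambda>w. restrict w X) ` W \<and> (\<forall>w\<in>(\<lambda>w. restrict w X) ` W. J (\<lambda>z. (f z - v z) \<bullet> w z) = 0)"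
    then obtain u where u: "u \<in> W" "v = restrict u X" by blast
    have mom: "J (\<lambda>z. u z \<bullet> w z) = J (\<lambda>z. p z \<bullet> w z)" if "w \<in> W" for w
      using v restr[OF u(1) that] p(2)[OF that] that unfolding u(2) by auto
    have d: "u - p \<in> W" using W u(1) p(1) by (simp add: subspace_diff)
    have "J (\<lambda>z. (u - p) z \<bullet> (u - p) z) = J (\<lambda>z. (u - p) z \<bullet> u z) - J (\<lambda>z. (u - p) z \<bullet> p z)"
      by (rule lin_on_diff[OF lin[OF d] W u(1) p(1)])
    also have "\<dots> = J (\<lambda>z. u z \<bullet> (u - p) z) - J (\<lambda>z. p z \<bullet> (u - p) z)"
      by (simp only: inner_commute)
    also have "\<dots> = 0" using mom[OF d] by simp
    finally have "\<forall>z\<in>X. (u - p) z = 0" by (rule definite[OF d])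
    then show "v = restrict p X" unfolding u(2) by (auto intro!: restrict_ext)
  qed
qed

section \<open>The L2 product on the face\<close>

context face
begin

definition ip :: "(point \<Rightarrow> 'b::real_inner) \<Rightarrow> (point \<Rightarrow> 'b) \<Rightarrow> real" where
  "ip u v = face_integral F (\<lambda>z. u z \<bullet> v z)"

lemma face_integral_cong: "(\<And>z. z \<in> F \<Longrightarrow> f z = g z) \<Longrightarrow> face_integral F f = face_integral F g"
  unfolding face_integral_def using F_open by (intro set_lebesgue_integral_cong) auto

lemma ip_cong: "(\<And>z. z \<in> F \<Longrightarrow> u z = u' z) \<Longrightarrow> (\<And>z. z \<in> F \<Longrightarrow> v z = v' z) \<Longrightarrow> ip u v = ip u' v'"
  unfolding ip_def by (rule face_integral_cong) simp

lemma ip_commute: "ip u v = ip v u"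
  by (simp add: ip_def inner_commute)

lemma face_integrable: "continuous_on UNIV f \<Longrightarrow> set_integrable lborel F (f :: point \<Rightarrow> real)"
  using F_open F_bounded by (auto intro!: set_integrable_bounded_continuous intro: continuous_on_subset)

lemma face_integral_linear:
  assumes "continuous_on UNIV f" "continuous_on UNIV g"
  shows "face_integral F (\<lambda>z. f z + g z) = face_integral F f + face_integral F g"
    "face_integral F (\<lambda>z. f z - g z) = face_integral F f - face_integral F g"
  using face_integrable assms by (simp_all add: face_integral_def)

lemma face_integral_scale: "face_integral F (\<lambda>z. a * f z) = a * face_integral F f"
  by (simp add: face_integral_def)

lemma lin_on_ip:
  fixes u :: "point \<Rightarrow> 'b::euclidean_space"
  assumes "continuous_on UNIV u" "\<And>w. w \<in> W \<Longrightarrow> continuous_on UNIV w"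
  shows "lin_on W (ip u)"
proof -
  have "continuous_on UNIV (\<lambda>z. u z \<bullet> w z)" if "w \<in> W" for w
    using assms that by (intro continuous_intros) auto
  then show ?thesis
    unfolding lin_on_def ip_def by (auto simp: inner_add_right face_integral_linear face_integral_scale)
qed

lemma ip_nonneg: "0 \<le> ip u u"
  unfolding ip_def face_integral_def set_lebesgue_integral_def
  by (intro Bochner_Integration.integral_nonneg) auto

text \<open>The integrand vanishes almost everywhere, and the open set where \<open>u\<close> is
  nonzero in \<open>F\<close> is empty once it is negligible.\<close>

lemma ip_definite:
  fixes u :: "point \<Rightarrow> 'b::euclidean_space"
  assumes u: "continuous_on UNIV u" and zero: "ip u u = 0" and z: "z \<in> F"
  shows "u z = 0"
proof -
  let ?h = "\<lambda>z. u z \<bullet> u z"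
  have hc: "continuous_on UNIV ?h" using u by (intro continuous_intros)
  have "AE z in lborel. indicator F z *\<^sub>R ?h z = 0"
  proof (subst integral_nonneg_eq_0_iff_AE[symmetric])
    show "integrable lborel (\<lambda>z. indicator F z *\<^sub>R ?h z)"
      using face_integrable[OF hc] unfolding set_integrable_def .
    show "(LINT z|lborel. indicator F z *\<^sub>R ?h z) = 0"
      using zero unfolding ip_def face_integral_def set_lebesgue_integral_def .
  qed auto
  then have ae: "AE z in lborel. z \<notin> F \<inter> {z. u z \<noteq> 0}"
    by eventually_elim (auto simp: indicator_def)
  have opn: "open (F \<inter> {z. u z \<noteq> 0})"
    using u by (intro open_Int F_open open_Collect_neq continuous_intros)
  have "F \<inter> {z. u z \<noteq> 0} \<in> null_sets lborel"
    using ae opn by (subst AE_iff_null_sets) auto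
  then have "negligible (F \<inter> {z. u z \<noteq> 0})"
    by (simp add: negligible_iff_null_sets null_sets_completionI)
  then have "F \<inter> {z. u z \<noteq> 0} = {}" using open_not_negligible[OF opn] by blast
  then show ?thesis using z by blast
qed

lemma face_riesz:
  fixes W :: "(point \<Rightarrow> 'b::euclidean_space) set"
  assumes "fin_dim W" "\<And>w. w \<in> W \<Longrightarrow> continuous_on UNIV w" "lin_on W L"
    and "\<And>w. w \<in> W \<Longrightarrow> \<forall>z\<in>F. w z = 0 \<Longrightarrow> L w = 0"
  shows "\<exists>p\<in>W. \<forall>w\<in>W. ip p w = L w"
  using assms ip_definite by (intro riesz lin_on_ip ip_nonneg ip_commute) blast+

text \<open>The projected function may be extensional and hence arbitrary off \<open>F\<close>;
  \<open>f'\<close> is a continuous representative on the plane, for which \<open>ip\<close> is well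
  behaved.\<close>

lemma face_projector_eqI:
  fixes W :: "(point \<Rightarrow> 'b::euclidean_space) set"
  assumes W: "fin_dim W" "\<And>w. w \<in> W \<Longrightarrow> continuous_on UNIV w"
    and f: "continuous_on UNIV f'" "\<And>z. z \<in> F \<Longrightarrow> f z = f' z"
    and p: "p \<in> W" "\<And>w. w \<in> W \<Longrightarrow> ip p w = ip f' w"
  shows "L2_projector (face_integral F) ((\<lambda>w. restrict w F) ` W) f = restrict p F"
proof (rule L2_projector_eqI)
  show "subspace W" using W(1) by (simp add: fin_dim_def)
  show "lin_on W (\<lambda>w. face_integral F (\<lambda>z. u z \<bullet> w z))" if "u \<in> W" for u
    using lin_on_ip[OF W(2)[OF that] W(2)] by (simp add: ip_def[abs_def])
  have ff: "face_integral F (\<lambda>z. f z \<bullet> w z) = ip f' w" for w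
    unfolding ip_def using f(2) by (intro face_integral_cong) simp
  show "face_integral F (\<lambda>z. (f z - u z) \<bullet> w z) = face_integral F (\<lambda>z. f z \<bullet> w z) - face_integral F (\<lambda>z. u z \<bullet> w z)"
    if "u \<in> W" "w \<in> W" for u w
  proof -
    have "face_integral F (\<lambda>z. (f z - u z) \<bullet> w z) = face_integral F (\<lambda>z. f' z \<bullet> w z - u z \<bullet> w z)"
      using f(2) by (intro face_integral_cong) (simp add: inner_diff_left)
    also have "\<dots> = ip f' w - face_integral F (\<lambda>z. u z \<bullet> w z)"
      unfolding ip_def using f(1) W(2) that by (intro face_integral_linear continuous_intros) auto
    finally show ?thesis by (simp add: ff)
  qed
  show "\<forall>z\<in>F. u z = 0" if "u \<in> W" "face_integral F (\<lambda>z. u z \<bullet> u z) = 0" for u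
    using ip_definite[OF W(2)[OF that(1)]] that(2) by (auto simp: ip_def)
  show "face_integral F (\<lambda>z. p z \<bullet> w z) = face_integral F (\<lambda>z. f z \<bullet> w z)" if "w \<in> W" for w
    using p(2)[OF that] by (simp add: ff) (simp add: ip_def)
  show "face_integral F g = face_integral F h" if "\<And>z. z \<in> F \<Longrightarrow> g z = h z" for g h
    using that by (rule face_integral_cong)
qed (rule p(1))

lemma face_projector:
  fixes W :: "(point \<Rightarrow> 'b::euclidean_space) set"
  assumes W: "fin_dim W" "\<And>w. w \<in> W \<Longrightarrow> continuous_on UNIV w"
    and f: "continuous_on UNIV f'" "\<And>z. z \<in> F \<Longrightarrow> f z = f' z"
  shows "\<exists>p\<in>W. L2_projector (face_integral F) ((\<lambda>w. restrict w F) ` W) f = restrict p F \<and> (\<forall>w\<in>W. ip p w = ip f' w)"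
proof -
  have "ip f' w = 0" if "\<forall>z\<in>F. w z = 0" for w
  proof -
    have "ip f' w = ip f' (\<lambda>z. 0)" using that by (intro ip_cong) auto
    then show ?thesis by (simp add: ip_def face_integral_def)
  qed
  then obtain p where p: "p \<in> W" "\<And>w. w \<in> W \<Longrightarrow> ip p w = ip f' w"
    using face_riesz[OF W lin_on_ip[OF f(1) W(2)]] by blast
  then show ?thesis using face_projector_eqI[OF W f p] by blast
qed

lemma vpolys_zero_on_F:
  assumes "w \<in> vpolys l" "\<And>z. z \<in> F \<Longrightarrow> w z = 0"
  shows "w = (\<lambda>z. 0)"
proof
  fix z
  have "fst (w z) = 0" "snd (w z) = 0"
    using assms polys_zero_on_open[OF _ F_open F_nonempty, of "\<lambda>z. fst (w z)" l z]
      polys_zero_on_open[OF _ F_open F_nonempty, of "\<lambda>z. snd (w z)" l z]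
    by (auto simp: mem_vpolys)
  then show "w z = 0" by (simp add: prod_eq_iff)
qed

lemma vpolys_ip_zero:
  assumes "w \<in> vpolys l" "ip w w = 0"
  shows "w = (\<lambda>z. 0)"
  using vpolys_zero_on_F[OF assms(1)] ip_definite[OF continuous_on_vpolys[OF assms(1)] assms(2)] by blast

lemma polys_eq_on_F:
  assumes "p \<in> polys l" "ip p p = 0"
  shows "p = (\<lambda>z. 0)"
  using polys_zero_on_open[OF assms(1) F_open F_nonempty] ip_definite[OF continuous_on_polys[OF assms(1)] assms(2)] by blast

section \<open>Rotated gradients and their orthogonal complement\<close>

lemma divergence_in_polys: "w \<in> vpolys l \<Longrightarrow> divergence w \<in> polys (l - 1)"
  using polys_has_grad(2)[of "\<lambda>z. fst (w z)" l] polys_has_grad(3)[of "\<lambda>z. snd (w z)" l]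
  by (subst ext[OF divergence_eq]) (auto simp: mem_vpolys intro: polys_add)

lemma divergence_linear:
  assumes "u \<in> vpolys l" "v \<in> vpolys l"
  shows "divergence (u + v) = divergence u + divergence v" "divergence (c *\<^sub>R u) = c *\<^sub>R divergence u"
proof -
  have uv: "u + v \<in> vpolys l" "c *\<^sub>R u \<in> vpolys l" using assms subspace_vpolys by (auto simp: subspace_add subspace_scale)
  note d = dx_lincomb[of "\<lambda>z. fst (u z)" l "\<lambda>z. fst (v z)" l] dx_lincomb[of "\<lambda>z. snd (u z)" l "\<lambda>z. snd (v z)" l]
  show "divergence (u + v) = divergence u + divergence v" "divergence (c *\<^sub>R u) = c *\<^sub>R divergence u"
    using assms by (auto simp: fun_eq_iff divergence_eq[OF uv(1)] divergence_eq[OF uv(2)] divergence_eq[OF assms(1)]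
        divergence_eq[OF assms(2)] d mem_vpolys algebra_simps)
qed

lemma rot_linear:
  assumes "p \<in> polys l" "q \<in> polys l"
  shows "rot (p + q) = rot p + rot q" "rot (c *\<^sub>R p) = c *\<^sub>R rot p" "rot (p - q) = rot p - rot q"
  using dx_lincomb[OF assms] by (auto simp: fun_eq_iff rot_eq plus_fun_def scaleR_fun_def fun_diff_def)

lemma subspace_rot: "subspace (rot ` polys l)"
  unfolding subspace_def
proof safe
  have "rot (\<lambda>z. 0) = 0" using dx_const[of 0] by (simp add: fun_eq_iff rot_eq zero_prod_def)
  then show "0 \<in> rot ` polys l" using polys_zero by (metis image_eqI)
next
  fix p q assume "p \<in> polys l" "q \<in> polys l"
  then show "rot p + rot q \<in> rot ` polys l"
    using rot_linear(1) subspace_add[OF subspace_polys] by (metis image_eqI)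
next
  fix c p assume "p \<in> polys l"
  then show "c *\<^sub>R rot p \<in> rot ` polys l"
    using rot_linear(2) subspace_scale[OF subspace_polys] by (metis image_eqI)
qed

lemma fin_dim_rot: "fin_dim (rot ` polys l)"
proof (rule fin_dim_subset[OF fin_dim_vpolys subspace_rot])
  show "rot ` polys l \<subseteq> vpolys (l - 1)" using rot_in_vpolys[of _ "l - 1"] by auto
qed

lemma continuous_rot: "p \<in> polys l \<Longrightarrow> continuous_on S (rot p)"
  using rot_in_vpolys[of p "l - 1"] by (auto intro: continuous_on_vpolys)

lemma rot_zero_imp_const:
  assumes "r \<in> polys l" "\<And>z. rot r z = 0"
  shows "r z = r 0"
proof -
  have "has_grad r (\<lambda>z. 0) (\<lambda>z. 0)"
    using polys_has_grad(1)[OF assms(1)] assms(2) by (simp add: rot_eq zero_prod_def has_grad_def)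
  then have "((\<lambda>s. r (0 + s *\<^sub>R z)) has_real_derivative 0) (at s)" for s
    using has_grad_line_derivative[of r "\<lambda>z. 0" "\<lambda>z. 0" 0 z s] by simp
  from DERIV_isconst_all[OF allI, OF this, of 1 0] show ?thesis by simp
qed

text \<open>The complement \<open>R_perp\<close> before restriction to \<open>F\<close>. Its
  potentials have degree \<open>k + 1\<close>, one more than those of the component in
  \<open>R_space (int k - 1) F\<close>.\<close>

definition rperp :: "nat \<Rightarrow> (point \<Rightarrow> point) set" where
  "rperp k = {w \<in> vpolys (int k). \<forall>r\<in>polys (int k + 1). ip w (rot r) = 0}"

lemma R_space_eq: "R_space (int k - 1) F = (\<lambda>w. restrict w F) ` (rot ` polys (int k))"
  by (simp add: R_space_def image_image)

lemma R_perp_eq: "R_perp (int k) F = (\<lambda>w. restrict w F) ` rperp k"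
proof -
  have "(\<forall>v\<in>R_space (int k) F. face_integral F (\<lambda>z. restrict w F z \<bullet> v z) = 0) \<longleftrightarrow>
      (\<forall>r\<in>polys (int k + 1). ip w (rot r) = 0)" for w
  proof -
    have "face_integral F (\<lambda>z. restrict w F z \<bullet> restrict (rot r) F z) = ip w (rot r)" for r
      unfolding ip_def by (rule face_integral_cong) simp
    then show ?thesis by (simp add: R_space_def)
  qed
  then show ?thesis unfolding R_perp_def P_vec_def rperp_def by blast
qed

lemma rperp_vpolys: "w \<in> rperp k \<Longrightarrow> w \<in> vpolys (int k)"
  by (simp add: rperp_def)

lemma fin_dim_rperp: "fin_dim (rperp k)"
proof (rule fin_dim_subset[OF fin_dim_vpolys])
  have lin: "lin_on (vpolys (int k)) (ip (rot r))" if "r \<in> polys (int k + 1)" for r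
    using that continuous_rot continuous_on_vpolys by (intro lin_on_ip) auto
  have "ip u (rot r) = ip (rot r) u" for u r by (rule ip_commute)
  then show "subspace (rperp k)"
    unfolding subspace_def rperp_def
    using subspace_vpolys lin_onD[OF lin] lin_onD(2)[OF lin, of _ 0 0] subspace_0[OF subspace_vpolys]
    by (auto simp: subspace_add subspace_scale)
qed (auto simp: rperp_def)

text \<open>Potentials of degree \<open>k\<close> are also potentials of degree
  \<open>k + 1\<close>, so \<open>rot p\<close> is orthogonal to \<open>rperp k\<close> and the sum
  is direct. The description in \<open>R_component\<close> relies on this.\<close>

lemma rot_rperp_unique:
  assumes "p \<in> polys (int k)" "p' \<in> polys (int k)" "w \<in> rperp k" "w' \<in> rperp k"
    and eq: "\<And>z. z \<in> F \<Longrightarrow> rot p z + w z = rot p' z + w' z"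
  shows "rot p = rot p'" "w = w'"
proof -
  define d where "d = p - p'"
  have d: "d \<in> polys (int k)" using assms(1,2) subspace_polys by (simp add: d_def subspace_diff)
  have rd: "rot d = rot p - rot p'" unfolding d_def by (rule rot_linear(3)[OF assms(1,2)])
  have w: "w' - w \<in> rperp k" using assms(3,4) fin_dim_rperp by (simp add: fin_dim_def subspace_diff)
  have "ip (rot d) (rot d) = ip (w' - w) (rot d)"
    using eq by (intro ip_cong) (auto simp: rd algebra_simps)
  also have "\<dots> = 0" using w polys_le[OF _ d, of "int k + 1"] by (simp add: rperp_def)
  finally have "rot d = (\<lambda>z. 0)"
    using vpolys_ip_zero[OF rot_in_vpolys[of d "int k - 1"]] d by simp
  then show 1: "rot p = rot p'" using rd by (simp add: fun_eq_iff)
  have "w' - w = (\<lambda>z. 0)"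
    using vpolys_zero_on_F[OF rperp_vpolys[OF w]] eq 1 by simp
  then show "w = w'" by (simp add: fun_eq_iff)
qed

lemma R_component_eq:
  assumes "p \<in> polys (int k)" "w \<in> rperp k"
  shows "R_component k F (\<lambda>z\<in>F. rot p z + w z) = restrict (rot p) F"
  unfolding R_component_def
proof (rule the_equality)
  show "restrict (rot p) F \<in> R_space (int k - 1) F \<and>
    (\<exists>w'\<in>R_perp (int k) F. (\<lambda>z\<in>F. rot p z + w z) = (\<lambda>z\<in>F. restrict (rot p) F z + w' z))"
    unfolding R_space_eq R_perp_eq using assms by (auto intro!: bexI[of _ w] restrict_ext)
next
  fix v assume "v \<in> R_space (int k - 1) F \<and>
    (\<exists>w'\<in>R_perp (int k) F. (\<lambda>z\<in>F. rot p z + w z) = (\<lambda>z\<in>F. v z + w' z))"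
  then obtain p' w' where *: "p' \<in> polys (int k)" "w' \<in> rperp k" "v = restrict (rot p') F"
    "(\<lambda>z\<in>F. rot p z + w z) = (\<lambda>z\<in>F. restrict (rot p') F z + restrict w' F z)"
    unfolding R_space_eq R_perp_eq by auto
  have "rot p z + w z = rot p' z + w' z" if "z \<in> F" for z
    using fun_cong[OF *(4), of z] that by simp
  from rot_rperp_unique(1)[OF assms(1) *(1) assms(2) *(2) this] show "v = restrict (rot p) F"
    using *(3) by simp
qed

lemma X_rot_iff:
  "v \<in> X_rot k F V \<longleftrightarrow> (\<exists>p\<in>polys (int k). \<exists>w\<in>rperp k. fst v = (\<lambda>z\<in>F. rot p z + w z)) \<and> snd v \<in> P_edges (int k) F V"
proof -
  have e: "(\<lambda>z\<in>F. restrict (rot p) F z + restrict w F z) = (\<lambda>z\<in>F. rot p z + w z)" for p w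
    by (rule restrict_ext) simp
  have "(\<exists>a b. x = (\<lambda>z\<in>F. a z + b z) \<and> a \<in> R_space (int k - 1) F \<and> b \<in> R_perp (int k) F) \<longleftrightarrow>
      (\<exists>p\<in>polys (int k). \<exists>w\<in>rperp k. x = (\<lambda>z\<in>F. rot p z + w z))" for x
  proof
    assume "\<exists>a b. x = (\<lambda>z\<in>F. a z + b z) \<and> a \<in> R_space (int k - 1) F \<and> b \<in> R_perp (int k) F"
    then obtain p w where "p \<in> polys (int k)" "w \<in> rperp k" "x = (\<lambda>z\<in>F. restrict (rot p) F z + restrict w F z)"
      unfolding R_space_eq R_perp_eq by blast
    then show "\<exists>p\<in>polys (int k). \<exists>w\<in>rperp k. x = (\<lambda>z\<in>F. rot p z + w z)" unfolding e by blast
  next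
    assume "\<exists>p\<in>polys (int k). \<exists>w\<in>rperp k. x = (\<lambda>z\<in>F. rot p z + w z)"
    then obtain p w where "p \<in> polys (int k)" "w \<in> rperp k" "x = (\<lambda>z\<in>F. rot p z + w z)" by blast
    then show "\<exists>a b. x = (\<lambda>z\<in>F. a z + b z) \<and> a \<in> R_space (int k - 1) F \<and> b \<in> R_perp (int k) F"
      unfolding R_space_eq R_perp_eq
      by (intro exI[of _ "restrict (rot p) F"] exI[of _ "restrict w F"]) (simp add: e[of p w, simplified])
  qed
  then show ?thesis unfolding X_rot_def by (cases v) auto
qed

text \<open>With potentials of the full degree \<open>k + 1\<close> the two parts exhaust the fields
  of degree \<open>k\<close>, which those of \<open>X_rot\<close> need not do.\<close>

lemma rot_orthogonal_decomposition:
  assumes g: "g \<in> vpolys (int k)"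
  shows "\<exists>r\<in>polys (int k + 1). \<exists>u\<in>rperp k. g = rot r + u"
proof -
  have "\<exists>v\<in>rot ` polys (int k + 1). \<forall>w\<in>rot ` polys (int k + 1). ip v w = ip g w"
    using face_projector[OF fin_dim_rot _ continuous_on_vpolys[OF g], of "int k + 1" g] continuous_rot by blast
  then obtain r where r: "r \<in> polys (int k + 1)" "\<And>s. s \<in> polys (int k + 1) \<Longrightarrow> ip (rot r) (rot s) = ip g (rot s)"
    by blast
  have rv: "rot r \<in> vpolys (int k)" by (rule rot_in_vpolys[OF r(1)])
  have "ip (g - rot r) (rot s) = 0" if s: "s \<in> polys (int k + 1)" for s
  proof -
    have "lin_on (vpolys (int k)) (ip (rot s))"
      using continuous_rot[OF s] continuous_on_vpolys by (intro lin_on_ip) auto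
    from lin_on_diff[OF this subspace_vpolys g rv] show ?thesis
      using r(2)[OF s] by (simp add: ip_commute[of _ "rot s"])
  qed
  then have "g - rot r \<in> rperp k" unfolding rperp_def using g rv subspace_vpolys by (simp add: subspace_diff)
  moreover have "g = rot r + (g - rot r)" by simp
  ultimately show ?thesis using r(1) by blast
qed

end

section \<open>The discrete operators\<close>

lemma upoly_add: "P \<in> upoly l \<Longrightarrow> Q \<in> upoly l \<Longrightarrow> P + Q \<in> upoly l"
  by (simp add: upoly_def)

lemma upoly_smult: "P \<in> upoly l \<Longrightarrow> smult c P \<in> upoly l"
  by (simp add: upoly_def)

lemma upoly_pderiv: "P \<in> upoly (l + 1) \<Longrightarrow> pderiv P \<in> upoly l"
  by (simp add: upoly_def coeff_pderiv)

lemma upoly_antideriv: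
  assumes "U \<in> upoly l"
  shows "\<exists>P\<in>upoly (l + 1). pderiv P = U \<and> poly P 0 = 0"
proof -
  define P where "P = (\<Sum>i\<le>degree U. monom (coeff U i / real (Suc i)) (Suc i))"
  have cP: "coeff P n = (case n of 0 \<Rightarrow> 0 | Suc i \<Rightarrow> coeff U i / real (Suc i))" for n
  proof (cases n)
    case 0
    then show ?thesis by (simp add: P_def coeff_sum)
  next
    case (Suc i)
    have "coeff P n = (\<Sum>j\<le>degree U. if j = i then coeff U j / real (Suc j) else 0)"
      unfolding P_def coeff_sum by (rule sum.cong) (auto simp: Suc)
    also have "\<dots> = coeff U i / real (Suc i)" by (simp add: coeff_eq_0)
    finally show ?thesis by (simp add: Suc)
  qed
  have "pderiv P = U" by (rule poly_eqI) (simp add: coeff_pderiv cP field_simps)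
  moreover have "poly P 0 = 0" by (simp add: poly_0_coeff_0 cP)
  moreover have "P \<in> upoly (l + 1)"
    using assms by (auto simp: upoly_def cP split: nat.split)
  ultimately show ?thesis by blast
qed

lemma vpolys_le: "l \<le> m \<Longrightarrow> w \<in> vpolys l \<Longrightarrow> w \<in> vpolys m"
  using polys_le by (auto simp: mem_vpolys)

context face
begin

text \<open>
  The residual of the least squares solution is invariant under \<open>next_vertex\<close>, hence constant,
  and has zero sum.
\<close>

lemma potential_exists:
  fixes I :: "point \<Rightarrow> real"
  assumes "(\<Sum>p\<in>V. I p) = 0"
  shows "\<exists>\<phi>. \<forall>p\<in>V. \<phi> (next_vertex p) - \<phi> p = I p"
proof -
  define W where "W = {f :: point \<Rightarrow> real. \<forall>z. z \<notin> V \<longrightarrow> f z = 0}"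
  define \<delta> where "\<delta> = (\<lambda>q z :: point. if z = q then 1 else 0 :: real)"
  define D where "D = (\<lambda>(f :: point \<Rightarrow> real) p. f (next_vertex p) - f p)"
  have D_lin: "D (f + g) p = D f p + D g p" "D (c *\<^sub>R f) p = c * D f p" for f g c p
    by (simp_all add: D_def algebra_simps)
  have sub: "subspace W" by (auto simp: subspace_def W_def)
  have fd: "fin_dim W"
    unfolding fin_dim_def
  proof (intro conjI sub exI)
    show "finite (\<delta> ` V)" using V_finite by simp
    show "W \<subseteq> span (\<delta> ` V)"
    proof
      fix f assume f: "f \<in> W"
      have "f = (\<Sum>q\<in>V. f q *\<^sub>R \<delta> q)"
      proof
        fix z
        have "(\<Sum>q\<in>V. f q *\<^sub>R \<delta> q) z = (\<Sum>q\<in>V. if z = q then f q else 0)"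
          unfolding sum_fun_apply by (rule sum.cong) (auto simp: \<delta>_def)
        also have "\<dots> = (if z \<in> V then f z else 0)" using V_finite by simp
        also have "\<dots> = f z"
        proof (cases "z \<in> V")
          case False
          then have "f z = 0" using f unfolding W_def by blast
          then show ?thesis by simp
        qed simp
        finally show "f z = (\<Sum>q\<in>V. f q *\<^sub>R \<delta> q) z" by simp
      qed
      moreover have "(\<Sum>q\<in>V. f q *\<^sub>R \<delta> q) \<in> span (\<delta> ` V)"
        by (intro span_sum span_scale span_base) simp
      ultimately show "f \<in> span (\<delta> ` V)" by simp
    qed
  qed
  have lin: "lin_on W (\<lambda>g. \<Sum>p\<in>V. h p * D g p)" for h
    by (simp add: lin_on_def D_lin sum.distrib sum_distrib_left algebra_simps)
  have "\<exists>\<phi>\<in>W. \<forall>g\<in>W. (\<Sum>p\<in>V. D \<phi> p * D g p) = (\<Sum>p\<in>V. I p * D g p)"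
  \<comment> \<open>The form has a kernel, such as the functions constant on \<open>V\<close>; the
    functional sees differences only and vanishes there too.\<close>
  proof (rule riesz[OF fd lin _ _ lin])
    show "(\<Sum>p\<in>V. D u p * D v p) = (\<Sum>p\<in>V. D v p * D u p)" for u v by (simp add: mult.commute)
    show "0 \<le> (\<Sum>p\<in>V. D u p * D u p)" for u by (intro sum_nonneg) simp
    show "(\<Sum>p\<in>V. I p * D u p) = 0" if "(\<Sum>p\<in>V. D u p * D u p) = 0" for u
    proof -
      have "\<forall>p\<in>V. D u p * D u p = 0"
        using that V_finite by (subst (asm) sum_nonneg_eq_0_iff) auto
      then show ?thesis by simp
    qed
  qed
  then obtain \<phi> where \<phi>: "\<And>g. g \<in> W \<Longrightarrow> (\<Sum>p\<in>V. D \<phi> p * D g p) = (\<Sum>p\<in>V. I p * D g p)" by blast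
  define r where "r = (\<lambda>p. D \<phi> p - I p)"
  have inv: "r (next_vertex p) = r p" if p: "p \<in> V" for p
  proof -
    have n: "next_vertex p \<in> V" using next_edge(1)[OF p] .
    \<comment> \<open>Testing with the indicator of one vertex compares the residuals on the two
      edges that meet there.\<close>
    have "\<delta> (next_vertex p) \<in> W" using n by (auto simp: W_def \<delta>_def)
    from \<phi>[OF this] have 0: "(\<Sum>q\<in>V. r q * D (\<delta> (next_vertex p)) q) = 0"
      by (simp add: r_def left_diff_distrib sum_subtractf)
    have "(\<Sum>q\<in>V. r q * D (\<delta> (next_vertex p)) q) = (\<Sum>q\<in>V. (if q = p then r q else 0) - (if q = next_vertex p then r q else 0))"
    proof (rule sum.cong)
      fix q assume "q \<in> V"
      then have "next_vertex q = next_vertex p \<longleftrightarrow> q = p" using bij_betw_next p by (auto simp: bij_betw_def inj_on_eq_iff)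
      then show "r q * D (\<delta> (next_vertex p)) q = (if q = p then r q else 0) - (if q = next_vertex p then r q else 0)"
        by (auto simp: D_def \<delta>_def)
    qed simp
    also have "\<dots> = r p - r (next_vertex p)" using V_finite p n by (simp add: sum_subtractf)
    finally show ?thesis using 0 by simp
  qed
  obtain p0 where p0: "p0 \<in> V" using V_nonempty by blast
  have "{p\<in>V. r p = r p0} = V"
  proof (rule next_invariant_subset)
    show "{p\<in>V. r p = r p0} \<noteq> {}" using p0 by blast
    show "next_vertex p \<in> {p\<in>V. r p = r p0}" if "p \<in> {p\<in>V. r p = r p0}" for p
      using that inv[of p] next_edge(1)[of p] by simp
  qed blast
  then have const: "\<And>p. p \<in> V \<Longrightarrow> r p = r p0" by blast
  have "(\<Sum>p\<in>V. r p) = 0"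
    using telescope[of \<phi>] assms by (simp add: r_def D_def sum_subtractf)
  then have "real (card V) * r p0 = 0" using const by simp
  then have "r p0 = 0" using V_finite V_nonempty by simp
  then show ?thesis using const by (intro exI[of _ \<phi>]) (simp add: r_def D_def)
qed

end

section \<open>Boundary functions, the full gradient and the discrete curl\<close>

context face_tangents
begin

lemma walk_inj:
  assumes "p \<in> V" "walk p s = walk p u"
  shows "s = u"
  using assms next_edge(2)[OF assms(1)] by (simp add: linepath_eq)

lemma walk_vertex:
  assumes "p \<in> V" "0 \<le> s" "s \<le> 1" "walk p s \<in> V"
  shows "s = 0 \<or> s = 1"
proof (rule ccontr)
  assume "\<not> (s = 0 \<or> s = 1)"
  then have "walk p s \<in> open_segment p (next_vertex p)"
    using assms next_edge(2)[OF assms(1)] by (subst open_segment_param) (auto simp: linepath_eq)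
  then show False using next_edge(4)[OF assms(1)] assms(4) by blast
qed

lemma walk_meet:
  assumes "p \<in> V" "q \<in> V" "p \<noteq> q" "0 \<le> s" "s \<le> 1" "0 \<le> u" "u \<le> 1" "walk p s = walk q u"
  shows "walk p s \<in> V"
proof -
  have "walk p s \<in> seg p" "walk p s \<in> seg q"
    using walk_in_seg[OF assms(4,5), of p] walk_in_seg[OF assms(6,7), of q] assms(8) by auto
  then have "walk p s \<notin> open_segment p (next_vertex p)" using edges_meet_in_vertices[OF assms(1-3)] by blast
  then have "walk p s = p \<or> walk p s = next_vertex p" using \<open>walk p s \<in> seg p\<close> by (auto simp: open_segment_def)
  then show ?thesis using assms(1) next_edge(1)[OF assms(1)] by (elim disjE) simp_all
qed

text \<open>Different edges meet in vertices only, where both polynomials take the value of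
  \<open>\<phi>\<close>. Continuity is the pasting of finitely many closed pieces.\<close>

lemma glue_edge_polynomials:
  assumes Q: "\<And>p. p \<in> V \<Longrightarrow> Q p \<in> upoly l" "\<And>p. p \<in> V \<Longrightarrow> poly (Q p) 0 = \<phi> p" "\<And>p. p \<in> V \<Longrightarrow> poly (Q p) 1 = \<phi> (next_vertex p)"
  shows "\<exists>qb\<in>Pc_boundary l F V. \<forall>p\<in>V. \<forall>s. 0 \<le> s \<longrightarrow> s \<le> 1 \<longrightarrow> qb (walk p s) = poly (Q p) s"
proof -
  define val where "val = (\<lambda>z c. \<exists>p\<in>V. \<exists>s. 0 \<le> s \<and> s \<le> 1 \<and> z = walk p s \<and> c = poly (Q p) s)"
  define qb where "qb = (\<lambda>z\<in>frontier F. THE c. val z c)"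
  have at_vertex: "poly (Q p) s = \<phi> (walk p s)" if "p \<in> V" "0 \<le> s" "s \<le> 1" "walk p s \<in> V" for p s
    using walk_vertex[OF that] Q(2,3)[OF that(1)] by (auto simp: linepath_eq)
  have uniq: "poly (Q p) s = poly (Q q) u"
    if "p \<in> V" "q \<in> V" "0 \<le> s" "s \<le> 1" "0 \<le> u" "u \<le> 1" "walk p s = walk q u" for p q s u
  proof (cases "p = q")
    case True
    have "s = u" using walk_inj[OF that(1)] that(7) True by simp
    then show ?thesis using True by simp
  next
    case False
    then have "walk p s \<in> V" using walk_meet that by blast
    then show ?thesis using at_vertex[of p s] at_vertex[of q u] that by simp
  qed
  have vals: "qb (walk p s) = poly (Q p) s" if "p \<in> V" "0 \<le> s" "s \<le> 1" for p s
  proof -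
    have "walk p s \<in> frontier F" using walk_in_seg[OF that(2,3)] next_edge(3)[OF that(1)] by blast
    moreover have "(THE c. val (walk p s) c) = poly (Q p) s"
    proof (rule the_equality)
      show "val (walk p s) (poly (Q p) s)" unfolding val_def using that by blast
      show "c = poly (Q p) s" if "val (walk p s) c" for c
        using that uniq \<open>p \<in> V\<close> \<open>0 \<le> s\<close> \<open>s \<le> 1\<close> unfolding val_def by metis
    qed
    ultimately show ?thesis by (simp add: qb_def)
  qed
  have P: "restrict qb (seg p) \<in> P_space l (seg p)" if p: "p \<in> V" for p
    unfolding P_space_edge[OF p] using Q(1)[OF p] vals[OF p] walk_in_seg by auto
  have cont: "continuous_on (seg p) qb" if p: "p \<in> V" for p
  proof -
    obtain h where h: "h \<in> polys l" "restrict qb (seg p) = restrict h (seg p)"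
      using P[OF p] by (auto simp: P_space_def)
    have "qb z = h z" if "z \<in> seg p" for z using fun_cong[OF h(2), of z] that by simp
    then show ?thesis using continuous_on_polys[OF h(1), of "seg p"] by (simp cong: continuous_on_cong)
  qed
  have "continuous_on (frontier F) qb"
    unfolding frontier_eq
    by (rule continuous_on_closed_Union) (use V_finite cont in auto)
  moreover have "\<forall>E\<in>edges F V. restrict qb E \<in> P_space l E" using P by (simp add: edges_eq)
  ultimately have "qb \<in> Pc_boundary l F V" by (simp add: Pc_boundary_def qb_def)
  then show ?thesis using vals by blast
qed

text \<open>By \<open>edge_term_normal\<close>, minus the boundary sum of the full gradient, freed
  of the prescribed tangents.\<close>

definition bterm :: "(point \<Rightarrow> real) \<Rightarrow> (point \<Rightarrow> point) \<Rightarrow> real" where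
  "bterm qb w = (\<Sum>p\<in>V. LINT s:{0..1}|lborel. qb (walk p s) * (w (walk p s) \<bullet> perp (side p)))"

text \<open>Polynomials in the walk parameter stand in for \<open>qb\<close>, which has a meaning on
  the boundary only: they can be differentiated and integrated freely.\<close>

definition edge_trace :: "(point \<Rightarrow> real) \<Rightarrow> int \<Rightarrow> (point \<Rightarrow> real poly) \<Rightarrow> bool" where
  "edge_trace qb l Q \<longleftrightarrow> (\<forall>p\<in>V. Q p \<in> upoly l \<and> (\<forall>s. 0 \<le> s \<longrightarrow> s \<le> 1 \<longrightarrow> qb (walk p s) = poly (Q p) s))"

lemma Pc_boundary_trace:
  assumes "qb \<in> Pc_boundary l F V"
  shows "\<exists>Q. edge_trace qb l Q"
proof -
  have "\<forall>p\<in>V. \<exists>P. P \<in> upoly l \<and> (\<forall>s. 0 \<le> s \<longrightarrow> s \<le> 1 \<longrightarrow> qb (walk p s) = poly P s)"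
  proof
    fix p assume p: "p \<in> V"
    have "restrict qb (seg p) \<in> P_space l (seg p)"
      using assms seg_edge[OF p] by (simp add: Pc_boundary_def)
    then obtain P where P: "P \<in> upoly l" "\<And>s. 0 \<le> s \<Longrightarrow> s \<le> 1 \<Longrightarrow> restrict qb (seg p) (walk p s) = poly P s"
      unfolding P_space_edge[OF p] by blast
    have "qb (walk p s) = poly P s" if "0 \<le> s" "s \<le> 1" for s
      using P(2)[OF that] walk_in_seg[OF that] by simp
    then show "\<exists>P. P \<in> upoly l \<and> (\<forall>s. 0 \<le> s \<longrightarrow> s \<le> 1 \<longrightarrow> qb (walk p s) = poly P s)" using P(1) by blast
  qed
  from bchoice[OF this] show ?thesis unfolding edge_trace_def by blast
qed

lemma trace_integral:
  assumes "edge_trace qb l Q" "p \<in> V"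
  shows "(LINT s:{0..1}|lborel. qb (walk p s) * h s) = (LINT s:{0..1}|lborel. poly (Q p) s * h s)"
  using assms by (intro set_lebesgue_integral_cong) (auto simp: edge_trace_def)

lemma lin_on_bterm:
  assumes "edge_trace qb m Q"
  shows "lin_on (vpolys l) (bterm qb)"
proof -
  have "lin_on (vpolys l) (\<lambda>w. \<Sum>p\<in>V. LINT s:{0..1}|lborel. (poly (Q p) s *\<^sub>R perp (side p)) \<bullet> w (walk p s))"
    by (intro lin_on_sum lin_on_path_integral continuous_intros continuous_on_vpolys)
  moreover have "bterm qb w = (\<Sum>p\<in>V. LINT s:{0..1}|lborel. (poly (Q p) s *\<^sub>R perp (side p)) \<bullet> w (walk p s))" for w
    unfolding bterm_def using trace_integral[OF assms] by (intro sum.cong) (simp_all add: inner_commute)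
  ultimately show ?thesis by (simp add: lin_on_def)
qed

text \<open>The right-hand side in the definition of the full gradient, as a functional of the test
  field.\<close>

definition lgrad :: "(point \<Rightarrow> real) \<Rightarrow> (point \<Rightarrow> real) \<Rightarrow> (point \<Rightarrow> point) \<Rightarrow> real" where
  "lgrad q0 qb w = - ip q0 (divergence w) - bterm qb w"

lemma lin_on_lgrad:
  assumes "q0 \<in> polys m" "edge_trace qb m' Q"
  shows "lin_on (vpolys l) (lgrad q0 qb)"
proof -
  have "lin_on (polys (l - 1)) (ip q0)"
    using continuous_on_polys assms(1) by (intro lin_on_ip) auto
  then have "lin_on (vpolys l) (\<lambda>w. ip q0 (divergence w))"
    using divergence_in_polys divergence_linear unfolding lin_on_def by simp
  from lin_on_add[OF lin_on_minus[OF this] lin_on_minus[OF lin_on_bterm[OF assms(2)]]]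
  show ?thesis unfolding lgrad_def[abs_def] by simp
qed

lemma full_gradient_char:
  assumes "q0 \<in> polys m" "edge_trace qb m' Q"
  shows "\<exists>g\<in>vpolys (int k). full_gradient k F V t (restrict q0 F, qb) = restrict g F \<and>
    (\<forall>w\<in>vpolys (int k). ip g w = lgrad q0 qb w)"
proof -
  note lin = lin_on_lgrad[OF assms]
  have rhs: "- face_integral F (\<lambda>z. restrict q0 F z * divergence w z) + (\<Sum>E\<in>edges F V. edge_sign F t E *
      edge_integral E (\<lambda>z. qb z * (w z \<bullet> edge_normal t E))) = lgrad q0 qb w" for w
  proof -
    have "face_integral F (\<lambda>z. restrict q0 F z * divergence w z) = ip q0 (divergence w)"
      unfolding ip_def by (rule face_integral_cong) simp
    moreover have "(\<Sum>E\<in>edges F V. edge_sign F t E * edge_integral E (\<lambda>z. qb z * (w z \<bullet> edge_normal t E))) = - bterm qb w"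
      unfolding sum_edges bterm_def by (simp add: edge_term_normal sum_negf)
    ultimately show ?thesis by (simp add: lgrad_def)
  qed
  have "lgrad q0 qb w = 0" if "w \<in> vpolys (int k)" "\<forall>z\<in>F. w z = 0" for w
  proof -
    have "w = 0" using vpolys_zero_on_F[OF that(1)] that(2) by (simp add: zero_fun_def)
    then show ?thesis using lin_onD(2)[OF lin that(1), of 0] by simp
  qed
  from face_riesz[OF fin_dim_vpolys continuous_on_vpolys lin this]
  obtain g where g1: "g \<in> vpolys (int k)" and g2: "\<forall>w\<in>vpolys (int k). ip g w = lgrad q0 qb w" ..
  note g = g1 bspec[OF g2]
  have ipr: "face_integral F (\<lambda>z. restrict u F z \<bullet> w z) = ip u w" for u w :: "point \<Rightarrow> point"
    unfolding ip_def by (rule face_integral_cong) simp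
  have "full_gradient k F V t (restrict q0 F, qb) = restrict g F"
    unfolding full_gradient_def prod.case rhs
  proof (rule the_equality)
    show "restrict g F \<in> P_vec (int k) F \<and>
        (\<forall>w\<in>vpolys (int k). face_integral F (\<lambda>z. restrict g F z \<bullet> w z) = lgrad q0 qb w)"
      using g unfolding ipr P_vec_def by blast
  next
    fix v assume v: "v \<in> P_vec (int k) F \<and>
        (\<forall>w\<in>vpolys (int k). face_integral F (\<lambda>z. v z \<bullet> w z) = lgrad q0 qb w)"
    then obtain u where u: "u \<in> vpolys (int k)" "v = restrict u F" by (auto simp: P_vec_def)
    have mom: "ip w u = ip w g" if "w \<in> vpolys (int k)" for w
      using v g(2)[OF that] that unfolding u(2) ipr by (simp add: ip_commute[of w])
    have d: "u - g \<in> vpolys (int k)" using u(1) g(1) subspace_vpolys by (simp add: subspace_diff)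
    have "lin_on (vpolys (int k)) (ip (u - g))"
      by (intro lin_on_ip continuous_on_vpolys[OF d] continuous_on_vpolys)
    from lin_on_diff[OF this subspace_vpolys u(1) g(1)] mom[OF d]
    have "u - g = (\<lambda>z. 0)" using vpolys_ip_zero[OF d] by simp
    then show "v = restrict g F" unfolding u(2) by (simp add: fun_eq_iff)
  qed
  then show ?thesis using g by blast
qed

lemma lgrad_rot:
  assumes "r \<in> polys l"
  shows "lgrad q0 qb (rot r) = - bterm qb (rot r)"
proof -
  have "divergence (rot r) = (\<lambda>z. 0)" using divergence_rot[OF assms] by auto
  then show ?thesis by (simp add: lgrad_def ip_def face_integral_def)
qed

text \<open>Both projections inherit the moments of the full gradient. Rotated gradients are
  divergence-free, so the face value \<open>q0\<close> is invisible to the first component and acts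
  on the second one alone.\<close>

lemma discrete_gradient_char:
  assumes "q0 \<in> polys m" "edge_trace qb m' Q"
  shows "\<exists>g\<in>vpolys (int k). \<exists>p\<in>polys (int k). \<exists>w\<in>rperp k.
    discrete_gradient k F V t (restrict q0 F, qb) = ((\<lambda>z\<in>F. rot p z + w z), boundary_gradient F V t qb) \<and>
    (\<forall>u\<in>vpolys (int k). ip g u = lgrad q0 qb u) \<and>
    (\<forall>r\<in>polys (int k). ip (rot p) (rot r) = - bterm qb (rot r)) \<and>
    (\<forall>u\<in>rperp k. ip w u = lgrad q0 qb u)"
proof -
  obtain g where g: "g \<in> vpolys (int k)" "full_gradient k F V t (restrict q0 F, qb) = restrict g F"
    "\<And>w. w \<in> vpolys (int k) \<Longrightarrow> ip g w = lgrad q0 qb w"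
    using full_gradient_char[OF assms] by blast
  have gc: "continuous_on UNIV g" using g(1) by (rule continuous_on_vpolys)
  have gr: "\<And>z. z \<in> F \<Longrightarrow> restrict g F z = g z" by simp
  have rc: "continuous_on UNIV u" if "u \<in> rot ` polys (int k)" for u
    using that continuous_rot by blast
  obtain v where v: "v \<in> rot ` polys (int k)"
    "L2_projector (face_integral F) ((\<lambda>w. restrict w F) ` rot ` polys (int k)) (restrict g F) = restrict v F"
    "\<forall>u\<in>rot ` polys (int k). ip v u = ip g u"
    using face_projector[of "rot ` polys (int k)", OF fin_dim_rot rc gc gr] by blast
  then obtain p where p: "p \<in> polys (int k)" "v = rot p" by blast
  have wc: "continuous_on UNIV u" if "u \<in> rperp k" for u
    using continuous_on_vpolys[OF rperp_vpolys[OF that]] .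
  obtain w where w: "w \<in> rperp k"
    "L2_projector (face_integral F) ((\<lambda>w. restrict w F) ` rperp k) (restrict g F) = restrict w F"
    "\<forall>u\<in>rperp k. ip w u = ip g u"
    using face_projector[of "rperp k", OF fin_dim_rperp wc gc gr] by blast
  have "discrete_gradient k F V t (restrict q0 F, qb) = ((\<lambda>z\<in>F. rot p z + w z), boundary_gradient F V t qb)"
    unfolding discrete_gradient_def Let_def g(2) R_space_eq R_perp_eq v(2) w(2) p(2)
    by (auto intro!: restrict_ext)
  moreover have "ip (rot p) (rot r) = - bterm qb (rot r)" if r: "r \<in> polys (int k)" for r
  proof -
    have "rot r \<in> vpolys (int k)" using rot_in_vpolys[of r "int k - 1"] r by (auto intro: vpolys_le[rotated])
    then show ?thesis using v(3) g(3) r lgrad_rot[OF r] p(2) by simp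
  qed
  moreover have "ip w u = lgrad q0 qb u" if "u \<in> rperp k" for u
    using bspec[OF w(3) that] g(3)[OF rperp_vpolys[OF that]] by simp
  ultimately show ?thesis using g(1,3) p(1) w(1) by blast
qed

lemma boundary_gradient_walk:
  assumes Q: "edge_trace qb l Q" and p: "p \<in> V" and s: "0 \<le> s" "s \<le> 1"
  shows "boundary_gradient F V t qb (seg p) (walk p s) = speed p * poly (pderiv (Q p)) s"
proof -
  have "edge_deriv (seg p) (t (seg p)) qb (walk p s) = speed p * poly (pderiv (Q p)) s"
    using Q p s by (intro edge_deriv_eq) (auto simp: edge_trace_def)
  then show ?thesis using walk_in_seg[OF s] seg_edge[OF p] by (simp add: boundary_gradient_def)
qed

lemma boundary_gradient_in_P_edges:
  assumes "edge_trace qb (l + 1) Q"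
  shows "boundary_gradient F V t qb \<in> P_edges l F V"
  unfolding P_edges_def
proof (rule PiE_I)
  fix E assume "E \<in> edges F V"
  then obtain p where p: "p \<in> V" "E = seg p" by (auto simp: edges_eq)
  have "smult (speed p) (pderiv (Q p)) \<in> upoly l"
    using assms p(1) by (intro upoly_smult upoly_pderiv) (simp add: edge_trace_def)
  moreover have "boundary_gradient F V t qb (seg p) \<in> extensional (seg p)"
    using seg_edge[OF p(1)] by (simp add: boundary_gradient_def)
  ultimately show "boundary_gradient F V t qb E \<in> P_space l E"
    unfolding p(2) P_space_edge[OF p(1)] using boundary_gradient_walk[OF assms p(1)]
    by (auto intro!: bexI[of _ "smult (speed p) (pderiv (Q p))"])
qed (simp add: boundary_gradient_def)

lemma P_edges_walk:
  assumes "vb \<in> P_edges l F V"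
  shows "\<exists>u. \<forall>p\<in>V. u p \<in> upoly l \<and> (\<forall>s. 0 \<le> s \<longrightarrow> s \<le> 1 \<longrightarrow> vb (seg p) (walk p s) = poly (u p) s)"
proof -
  have "\<exists>P. P \<in> upoly l \<and> (\<forall>s. 0 \<le> s \<longrightarrow> s \<le> 1 \<longrightarrow> vb (seg p) (walk p s) = poly P s)" if p: "p \<in> V" for p
  proof -
    have "vb (seg p) \<in> P_space l (seg p)"
      using assms seg_edge[OF p] unfolding P_edges_def by (rule PiE_mem)
    then show ?thesis unfolding P_space_edge[OF p] by blast
  qed
  then show ?thesis by (intro bchoice) blast
qed

lemma P_edges_eqI:
  assumes "v \<in> P_edges l F V" "v' \<in> P_edges l F V"
    and "\<And>p s. p \<in> V \<Longrightarrow> 0 \<le> s \<Longrightarrow> s \<le> 1 \<Longrightarrow> v (seg p) (walk p s) = v' (seg p) (walk p s)"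
  shows "v = v'"
proof (rule PiE_ext)
  show "v \<in> (\<Pi>\<^sub>E E\<in>edges F V. P_space l E)" "v' \<in> (\<Pi>\<^sub>E E\<in>edges F V. P_space l E)"
    using assms(1,2) by (simp_all add: P_edges_def)
  fix E assume E: "E \<in> edges F V"
  then obtain p where p: "p \<in> V" "E = seg p" by (auto simp: edges_eq)
  show "v E = v' E"
  proof (rule extensionalityI)
    show "v E \<in> extensional E" "v' E \<in> extensional E"
      using assms(1,2) E unfolding P_edges_def P_space_def by (auto dest!: PiE_mem[OF _ E])
    show "v E z = v' E z" if "z \<in> E" for z
      using seg_walk[of z p] that assms(3)[OF p(1)] unfolding p(2) by blast
  qed
qed

text \<open>On an edge \<open>rot r \<bullet> perp (side p)\<close> is minus the derivative of
  \<open>r\<close> in the walk parameter. The end point values telescope around the cycle, because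
  \<open>qb\<close> has one value at each vertex.\<close>

lemma boundary_integration_by_parts:
  assumes Q: "edge_trace qb l Q" and r: "r \<in> polys m"
  shows "bterm qb (rot r) = (\<Sum>p\<in>V. LINT s:{0..1}|lborel. poly (pderiv (Q p)) s * r (walk p s))"
proof -
  have "(LINT s:{0..1}|lborel. poly (pderiv (Q p)) s * r (walk p s)) -
      (LINT s:{0..1}|lborel. qb (walk p s) * (rot r (walk p s) \<bullet> perp (side p))) =
      qb (next_vertex p) * r (next_vertex p) - qb p * r p" if p: "p \<in> V" for p
  proof -
    obtain R where R: "\<And>s. r (walk p s) = poly R s" using polys_trace[OF r] by blast
    have dR: "rot r (walk p s) \<bullet> perp (side p) = - poly (pderiv R) s" for s
    proof -
      have "((\<lambda>s. r (p + s *\<^sub>R side p)) has_real_derivative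
          (fst (side p) * dx r (p + s *\<^sub>R side p) + snd (side p) * dy r (p + s *\<^sub>R side p))) (at s)"
        by (rule has_grad_line_derivative[OF polys_has_grad(1)[OF r]])
      moreover have "(\<lambda>s. r (p + s *\<^sub>R side p)) = poly R" using R by (auto simp: linepath_eq side_def)
      ultimately have "fst (side p) * dx r (walk p s) + snd (side p) * dy r (walk p s) = poly (pderiv R) s"
        using DERIV_unique[OF _ poly_DERIV] by (simp add: linepath_eq side_def)
      then show ?thesis by (simp add: rot_eq perp_def inner_prod_def algebra_simps)
    qed
    have "(LINT s:{0..1}|lborel. poly (pderiv (Q p)) s * r (walk p s)) -
        (LINT s:{0..1}|lborel. qb (walk p s) * (rot r (walk p s) \<bullet> perp (side p))) =
        (LINT s:{0..1}|lborel. poly (pderiv (Q p)) s * poly R s) - (LINT s:{0..1}|lborel. poly (Q p) s * - poly (pderiv R) s)"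
      by (simp only: trace_integral[OF Q p] dR R)
    also have "\<dots> = (LINT s:{0..1}|lborel. poly (pderiv (Q p)) s * poly R s - poly (Q p) s * - poly (pderiv R) s)"
      by (rule set_integral_diff(2)[symmetric]; intro set_integrable_unit_interval continuous_intros)
    also have "\<dots> = (LINT s:{0..1}|lborel. poly (pderiv (Q p * R)) s)"
      by (simp add: pderiv_mult algebra_simps)
    also have "\<dots> = poly (Q p) 1 * poly R 1 - poly (Q p) 0 * poly R 0" by (simp add: integral_pderiv)
    also have "\<dots> = qb (walk p 1) * r (walk p 1) - qb (walk p 0) * r (walk p 0)"
      using Q p by (simp add: R edge_trace_def)
    finally show ?thesis by (simp add: linepath_eq)
  qed
  then have "(\<Sum>p\<in>V. (LINT s:{0..1}|lborel. poly (pderiv (Q p)) s * r (walk p s)) -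
      (LINT s:{0..1}|lborel. qb (walk p s) * (rot r (walk p s) \<bullet> perp (side p)))) = 0"
    using telescope[of "\<lambda>z. qb z * r z"] by simp
  then show ?thesis by (simp add: bterm_def sum_subtractf)
qed

text \<open>By \<open>edge_term_tangent\<close>, minus the boundary sum in the definition of the
  curl, so it enters with a plus sign.\<close>

definition bcurl :: "(point set \<Rightarrow> point \<Rightarrow> real) \<Rightarrow> (point \<Rightarrow> real) \<Rightarrow> real" where
  "bcurl vb r = (\<Sum>p\<in>V. (LINT s:{0..1}|lborel. vb (seg p) (walk p s) * r (walk p s)) / speed p)"

lemma bcurl_eq:
  assumes "\<And>p s. p \<in> V \<Longrightarrow> 0 \<le> s \<Longrightarrow> s \<le> 1 \<Longrightarrow> vb (seg p) (walk p s) = poly (u p) s"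
  shows "bcurl vb r = (\<Sum>p\<in>V. (LINT s:{0..1}|lborel. poly (u p) s * r (walk p s)) / speed p)"
  unfolding bcurl_def using assms
  by (intro sum.cong arg_cong2[where f = "(/)"] set_lebesgue_integral_cong) auto

lemma lin_on_bcurl:
  assumes "vb \<in> P_edges l F V"
  shows "lin_on (polys m) (bcurl vb)"
proof -
  obtain u where u: "\<And>p s. p \<in> V \<Longrightarrow> 0 \<le> s \<Longrightarrow> s \<le> 1 \<Longrightarrow> vb (seg p) (walk p s) = poly (u p) s"
    using P_edges_walk[OF assms] by blast
  have "lin_on (polys m) (\<lambda>r. \<Sum>p\<in>V. (1 / speed p) * (LINT s:{0..1}|lborel. poly (u p) s \<bullet> r (walk p s)))"
    by (intro lin_on_sum lin_on_scale lin_on_path_integral continuous_intros)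
      (rule continuous_on_polys)
  then show ?thesis by (simp add: bcurl_eq[OF u] lin_on_def)
qed

lemma polys_moments_unique:
  assumes "c \<in> polys l" "c' \<in> polys l" "\<And>r. r \<in> polys l \<Longrightarrow> ip c r = ip c' r"
  shows "c = c'"
proof -
  have d: "c - c' \<in> polys l" using assms(1,2) subspace_polys by (simp add: subspace_diff)
  have "lin_on (polys l) (ip (c - c'))" by (intro lin_on_ip continuous_on_polys[OF d] continuous_on_polys)
  from lin_on_diff[OF this subspace_polys assms(1,2)] assms(3)[OF d]
  have "ip (c - c') (c - c') = 0" by (simp only: ip_commute[of "c - c'" c] ip_commute[of "c - c'" c'])
  then have "c - c' = (\<lambda>z. 0)" by (rule polys_eq_on_F[OF d])
  then show ?thesis by (simp add: fun_eq_iff)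
qed

lemma discrete_curl_eqI:
  assumes p: "p \<in> polys (int k)" and w: "w \<in> rperp k" and c: "c \<in> polys (int k)"
    and mom: "\<And>r. r \<in> polys (int k) \<Longrightarrow> ip c r = ip (rot p) (rot r) + bcurl vb r"
  shows "discrete_curl k F V t ((\<lambda>z\<in>F. rot p z + w z), vb) = restrict c F"
proof -
  have rhs: "face_integral F (\<lambda>z. R_component k F (\<lambda>z\<in>F. rot p z + w z) z \<bullet> rot r z) -
      (\<Sum>E\<in>edges F V. edge_sign F t E * edge_integral E (\<lambda>z. vb E z * r z)) = ip (rot p) (rot r) + bcurl vb r" for r
  proof -
    have "face_integral F (\<lambda>z. R_component k F (\<lambda>z\<in>F. rot p z + w z) z \<bullet> rot r z) = ip (rot p) (rot r)"
      unfolding ip_def R_component_eq[OF p w] by (rule face_integral_cong) simp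
    moreover have "(\<Sum>E\<in>edges F V. edge_sign F t E * edge_integral E (\<lambda>z. vb E z * r z)) = - bcurl vb r"
      unfolding sum_edges bcurl_def by (simp add: edge_term_tangent sum_negf)
    ultimately show ?thesis by simp
  qed
  have ipr: "face_integral F (\<lambda>z. restrict u F z * r z) = ip u r" for u r :: "point \<Rightarrow> real"
    unfolding ip_def by (rule face_integral_cong) simp
  show ?thesis
    unfolding discrete_curl_def prod.case rhs
  proof (rule the_equality)
    show "restrict c F \<in> P_space (int k) F \<and> (\<forall>r\<in>polys (int k).
        face_integral F (\<lambda>z. restrict c F z * r z) = ip (rot p) (rot r) + bcurl vb r)"
      using c mom unfolding ipr P_space_def by blast
  next
    fix d assume d: "d \<in> P_space (int k) F \<and> (\<forall>r\<in>polys (int k).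
        face_integral F (\<lambda>z. d z * r z) = ip (rot p) (rot r) + bcurl vb r)"
    then obtain c' where c': "c' \<in> polys (int k)" "d = restrict c' F" by (auto simp: P_space_def)
    have "c' = c"
      using d mom unfolding c'(2) ipr by (intro polys_moments_unique[OF c'(1) c]) simp
    then show "d = restrict c F" using c'(2) by simp
  qed
qed

lemma discrete_curl_char:
  assumes p: "p \<in> polys (int k)" and w: "w \<in> rperp k" and vb: "vb \<in> P_edges (int k) F V"
  shows "\<exists>c\<in>polys (int k). discrete_curl k F V t ((\<lambda>z\<in>F. rot p z + w z), vb) = restrict c F \<and>
    (\<forall>r\<in>polys (int k). ip c r = ip (rot p) (rot r) + bcurl vb r)"
proof -
  have "lin_on (rot ` polys (int k)) (ip (rot p))"
    using continuous_rot p by (intro lin_on_ip) auto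
  then have "lin_on (polys (int k)) (\<lambda>r. ip (rot p) (rot r))"
    using rot_linear unfolding lin_on_def by simp
  from lin_on_add[OF this lin_on_bcurl[OF vb]]
  have lin: "lin_on (polys (int k)) (\<lambda>r. ip (rot p) (rot r) + bcurl vb r)" .
  have "ip (rot p) (rot r) + bcurl vb r = 0" if "r \<in> polys (int k)" "\<forall>z\<in>F. r z = 0" for r
  proof -
    have "r = 0" using polys_zero_on_open[OF that(1) F_open F_nonempty] that(2) by (auto simp: fun_eq_iff)
    then show ?thesis using lin_onD(2)[OF lin that(1), of 0] by simp
  qed
  from face_riesz[OF fin_dim_polys continuous_on_polys lin this]
  obtain c where c: "c \<in> polys (int k)" and mom: "\<forall>r\<in>polys (int k). ip c r = ip (rot p) (rot r) + bcurl vb r" ..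
  from discrete_curl_eqI[OF p w c bspec[OF mom]] show ?thesis using c mom by blast
qed

end

section \<open>Exactness\<close>

context face_tangents
begin

lemma walk_length: "p \<in> V \<Longrightarrow> dist p (next_vertex p) \<noteq> 0"
  using next_edge(2)[of p] by simp

lemma lin_on_edge_integral:
  assumes f: "\<And>s. 0 \<le> s \<Longrightarrow> s \<le> 1 \<Longrightarrow> f (walk p s) = poly P s"
  shows "lin_on (polys l) (\<lambda>w. edge_integral (seg p) (\<lambda>z. f z \<bullet> w z))"
proof -
  have "lin_on (polys l) (\<lambda>w. dist p (next_vertex p) * (LINT s:{0..1}|lborel. poly P s \<bullet> w (walk p s)))"
    by (intro lin_on_scale lin_on_path_integral continuous_intros) (rule continuous_on_polys)
  moreover have "edge_integral (seg p) (\<lambda>z. f z \<bullet> w z) =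
      dist p (next_vertex p) * (LINT s:{0..1}|lborel. poly P s \<bullet> w (walk p s))" for w
    unfolding edge_integral_segment using f
    by (intro arg_cong[where f = "(*) (dist p (next_vertex p))"] set_lebesgue_integral_cong) auto
  ultimately show ?thesis by simp
qed

lemma edge_integral_square_zero:
  assumes p: "p \<in> V" and u: "\<And>s. 0 \<le> s \<Longrightarrow> s \<le> 1 \<Longrightarrow> u (walk p s) = poly P s"
    and zero: "edge_integral (seg p) (\<lambda>z. u z \<bullet> u z) = 0" and z: "z \<in> seg p"
  shows "u z = 0"
proof -
  obtain s where s: "0 \<le> s" "s \<le> 1" "z = walk p s" using seg_walk[OF z] by blast
  have "(LINT s:{0..1}|lborel. poly P s * poly P s) = (LINT s:{0..1}|lborel. u (walk p s) \<bullet> u (walk p s))"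
    using u by (intro set_lebesgue_integral_cong) auto
  also have "\<dots> = 0"
    using zero walk_length[OF p] unfolding edge_integral_segment by simp
  finally have "poly P s * poly P s = 0"
    using s by (intro continuous_nonneg_integral_zero[of "\<lambda>s. poly P s * poly P s"]) (auto intro!: continuous_intros)
  then show ?thesis using u[OF s(1,2)] s(3) by simp
qed

text \<open>Plane polynomials with the same trace are not distinguished by the edge product, which
  is thus only semidefinite on \<open>polys l\<close>. Its isotropic elements vanish on the edge,
  and so does the functional on them.\<close>

lemma edge_projector:
  assumes p: "p \<in> V" and f: "\<And>s. 0 \<le> s \<Longrightarrow> s \<le> 1 \<Longrightarrow> f (walk p s) = poly P s"
  shows "\<exists>m\<in>polys l. L2_projector (edge_integral (seg p)) (P_space l (seg p)) f = restrict m (seg p) \<and>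
    (\<forall>w\<in>polys l. edge_integral (seg p) (\<lambda>z. m z \<bullet> w z) = edge_integral (seg p) (\<lambda>z. f z \<bullet> w z))"
proof -
  let ?J = "edge_integral (seg p)"
  have tr: "\<exists>U. \<forall>s. u (walk p s) = poly U s" if "u \<in> polys l" for u
    using polys_trace[OF that, of p "next_vertex p"] by blast
  have lin: "lin_on (polys l) (\<lambda>w. ?J (\<lambda>z. u z \<bullet> w z))" if u: "u \<in> polys l" for u
  proof -
    obtain U where "\<And>s. u (walk p s) = poly U s" using tr[OF u] by blast
    then show ?thesis by (intro lin_on_edge_integral) blast
  qed
  have definite: "u z = 0" if u: "u \<in> polys l" "?J (\<lambda>z. u z \<bullet> u z) = 0" and z: "z \<in> seg p" for u z
  proof -
    obtain U where "\<And>s. u (walk p s) = poly U s" using tr[OF u(1)] by blast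
    then show ?thesis using edge_integral_square_zero[OF p _ u(2) z] by blast
  qed
  have linf: "lin_on (polys l) (\<lambda>w. ?J (\<lambda>z. f z \<bullet> w z))"
    by (rule lin_on_edge_integral[OF f])
  have "\<exists>m\<in>polys l. \<forall>w\<in>polys l. ?J (\<lambda>z. m z \<bullet> w z) = ?J (\<lambda>z. f z \<bullet> w z)"
  proof (rule riesz[OF fin_dim_polys lin _ _ linf])
    show "?J (\<lambda>z. u z \<bullet> v z) = ?J (\<lambda>z. v z \<bullet> u z)" for u v :: "point \<Rightarrow> real"
      by (simp add: mult.commute)
    show "0 \<le> ?J (\<lambda>z. u z \<bullet> u z)" for u :: "point \<Rightarrow> real"
      unfolding edge_integral_segment set_lebesgue_integral_def
      by (intro mult_nonneg_nonneg Bochner_Integration.integral_nonneg) auto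
    show "?J (\<lambda>z. f z \<bullet> u z) = 0" if "u \<in> polys l" "?J (\<lambda>z. u z \<bullet> u z) = 0" for u
    proof -
      have "?J (\<lambda>z. f z \<bullet> u z) = ?J (\<lambda>z. 0)" using definite[OF that] by (intro edge_integral_cong) simp
      then show ?thesis by (simp add: edge_integral_segment)
    qed
  qed
  then obtain m where m: "m \<in> polys l" "\<And>w. w \<in> polys l \<Longrightarrow> ?J (\<lambda>z. m z \<bullet> w z) = ?J (\<lambda>z. f z \<bullet> w z)" by blast
  have "L2_projector ?J ((\<lambda>w. restrict w (seg p)) ` polys l) f = restrict m (seg p)"
  proof (rule L2_projector_eqI[OF subspace_polys lin _ _ _ m])
    show "?J (\<lambda>z. (f z - u z) \<bullet> w z) = ?J (\<lambda>z. f z \<bullet> w z) - ?J (\<lambda>z. u z \<bullet> w z)"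
      if uw: "u \<in> polys l" "w \<in> polys l" for u w
    proof -
      obtain U where U: "\<And>s. u (walk p s) = poly U s" using tr[OF uw(1)] by blast
      obtain W where W: "\<And>s. w (walk p s) = poly W s" using tr[OF uw(2)] by blast
      have "(LINT s:{0..1}|lborel. (f (walk p s) - u (walk p s)) \<bullet> w (walk p s)) =
          (LINT s:{0..1}|lborel. poly P s * poly W s - poly U s * poly W s)"
        using f U W by (intro set_lebesgue_integral_cong) (auto simp: left_diff_distrib)
      also have "\<dots> = (LINT s:{0..1}|lborel. poly P s * poly W s) - (LINT s:{0..1}|lborel. poly U s * poly W s)"
        by (rule set_integral_diff(2); intro set_integrable_unit_interval continuous_intros)
      also have "(LINT s:{0..1}|lborel. poly P s * poly W s) = (LINT s:{0..1}|lborel. f (walk p s) \<bullet> w (walk p s))"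
        using f W by (intro set_lebesgue_integral_cong) auto
      finally show ?thesis unfolding edge_integral_segment by (simp add: U W right_diff_distrib)
    qed
    show "\<forall>z\<in>seg p. u z = 0" if "u \<in> polys l" "?J (\<lambda>z. u z \<bullet> u z) = 0" for u
      using definite[OF that] by blast
    show "?J g = ?J h" if "\<And>z. z \<in> seg p \<Longrightarrow> g z = h z" for g h
      by (rule edge_integral_cong[OF that])
  qed
  then show ?thesis using m unfolding P_space_def by blast
qed

text \<open>The univariate test polynomial \<open>M\<close> extends to a plane polynomial, against
  which both projections have the moments of their functions.\<close>

lemma edge_projection_eq_imp_moments:
  assumes p: "p \<in> V" and f: "\<And>s. 0 \<le> s \<Longrightarrow> s \<le> 1 \<Longrightarrow> f (walk p s) = poly P s"
    and g: "\<And>s. 0 \<le> s \<Longrightarrow> s \<le> 1 \<Longrightarrow> g (walk p s) = poly Q s"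
    and eq: "L2_projector (edge_integral (seg p)) (P_space l (seg p)) f = L2_projector (edge_integral (seg p)) (P_space l (seg p)) g"
    and M: "M \<in> upoly l"
  shows "(LINT s:{0..1}|lborel. poly ((P - Q) * M) s) = 0"
proof -
  let ?J = "edge_integral (seg p)"
  obtain w where w: "w \<in> polys l" "\<And>s. w (walk p s) = poly M s"
    using polys_extend_trace[OF M, of p "next_vertex p"] next_edge(2)[OF p] by metis
  obtain m where m: "L2_projector ?J (P_space l (seg p)) f = restrict m (seg p)"
    "?J (\<lambda>z. m z \<bullet> w z) = ?J (\<lambda>z. f z \<bullet> w z)" using edge_projector[OF p f] w(1) by blast
  obtain n where n: "L2_projector ?J (P_space l (seg p)) g = restrict n (seg p)"
    "?J (\<lambda>z. n z \<bullet> w z) = ?J (\<lambda>z. g z \<bullet> w z)" using edge_projector[OF p g] w(1) by blast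
  have "m z = n z" if "z \<in> seg p" for z
    using eq that unfolding m(1) n(1) by (metis restrict_apply')
  then have "?J (\<lambda>z. m z \<bullet> w z) = ?J (\<lambda>z. n z \<bullet> w z)" by (intro edge_integral_cong) simp
  then have "(LINT s:{0..1}|lborel. f (walk p s) \<bullet> w (walk p s)) = (LINT s:{0..1}|lborel. g (walk p s) \<bullet> w (walk p s))"
    using m(2) n(2) walk_length[OF p] by (simp add: edge_integral_segment)
  moreover have "(LINT s:{0..1}|lborel. f (walk p s) \<bullet> w (walk p s)) = (LINT s:{0..1}|lborel. poly P s * poly M s)"
    using f w(2) by (intro set_lebesgue_integral_cong) auto
  moreover have "(LINT s:{0..1}|lborel. g (walk p s) \<bullet> w (walk p s)) = (LINT s:{0..1}|lborel. poly Q s * poly M s)"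
    using g w(2) by (intro set_lebesgue_integral_cong) auto
  moreover have "(LINT s:{0..1}|lborel. poly ((P - Q) * M) s) =
      (LINT s:{0..1}|lborel. poly P s * poly M s) - (LINT s:{0..1}|lborel. poly Q s * poly M s)"
    unfolding poly_mult poly_diff left_diff_distrib
    by (rule set_integral_diff(2); intro set_integrable_unit_interval continuous_intros)
  ultimately show ?thesis by simp
qed

text \<open>
  A polynomial of degree \<open>l + 2\<close> vanishing at both end points is \<open>s (s - 1) M\<close> with
  \<open>M\<close> of degree \<open>l\<close>, so that \<open>M\<close> is an admissible test function.
\<close>

lemma upoly_zero_if_orthogonal:
  assumes P: "P \<in> upoly (l + 2)" "poly P 0 = 0" "poly P 1 = 0"
    and orth: "\<And>M. M \<in> upoly l \<Longrightarrow> (LINT s:{0..1}|lborel. poly (P * M) s) = 0"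
    and s: "0 \<le> s" "s \<le> 1"
  shows "poly P s = 0"
proof -
  obtain P1 where P1: "P = [:0, 1:] * P1" using P(2) by (auto simp: poly_eq_0_iff_dvd dvd_def)
  then have "poly P1 1 = 0" using P(3) by simp
  then obtain M where M: "P1 = [:-1, 1:] * M" by (auto simp: poly_eq_0_iff_dvd dvd_def)
  have PM: "P = [:0, -1, 1:] * M" by (simp add: P1 M)
  have "M \<in> upoly l"
  proof (cases "M = 0")
    case False
    then have "degree P = degree M + 2" unfolding PM by (subst degree_mult_eq) auto
    moreover have "int (degree P) \<le> l + 2"
    proof (rule ccontr)
      assume "\<not> int (degree P) \<le> l + 2"
      then have "coeff P (degree P) = 0" using P(1) by (simp add: upoly_def)
      moreover have "P \<noteq> 0" using False unfolding PM mult_eq_0_iff by simp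
      ultimately show False by simp
    qed
    ultimately show ?thesis by (intro upoly_degree) simp
  qed (simp add: upoly_def)
  from orth[OF this] have "(LINT s:{0..1}|lborel. poly (P * M) s) = 0" .
  \<comment> \<open>The factor -1 makes the weight \<open>s * (1 - s)\<close> nonnegative on the
    unit interval.\<close>
  then have "(LINT s:{0..1}|lborel. (-1) * poly (P * M) s) = 0" by (simp only: set_integral_mult_right mult_zero_right)
  moreover have "(-1) * poly (P * M) s = (s * (1 - s)) * (poly M s * poly M s)" for s
    by (simp add: PM algebra_simps)
  ultimately have "(LINT s:{0..1}|lborel. (s * (1 - s)) * (poly M s * poly M s)) = 0" by simp
  then have "(s * (1 - s)) * (poly M s * poly M s) = 0"
    using s by (intro continuous_nonneg_integral_zero[of "\<lambda>s. (s * (1 - s)) * (poly M s * poly M s)"])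
      (auto intro!: continuous_intros)
  then show ?thesis by (auto simp: PM algebra_simps)
qed

lemma const_in_Pc_boundary:
  assumes "0 \<le> l"
  shows "(\<lambda>z\<in>frontier F. c) \<in> Pc_boundary l F V"
proof -
  have "restrict (\<lambda>z\<in>frontier F. c) E \<in> P_space l E" if "E \<in> edges F V" for E
  proof -
    have "E \<subseteq> frontier F" using that by (auto simp: edges_def)
    then have "restrict (\<lambda>z\<in>frontier F. c) E = restrict (\<lambda>z. c) E" by (intro restrict_ext) auto
    then show ?thesis using polys_const[OF assms] by (auto simp: P_space_def)
  qed
  then show ?thesis by (simp add: Pc_boundary_def cong: continuous_on_cong)
qed

lemma walk_in_frontier: "p \<in> V \<Longrightarrow> 0 \<le> s \<Longrightarrow> s \<le> 1 \<Longrightarrow> walk p s \<in> frontier F"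
  using walk_in_seg next_edge(3) by blast

lemma trace_const: "0 \<le> l \<Longrightarrow> edge_trace (\<lambda>z\<in>frontier F. c) l (\<lambda>p. [:c:])"
  using walk_in_frontier by (auto simp: edge_trace_def intro!: upoly_degree)

lemma boundary_eqI:
  assumes "qb \<in> extensional (frontier F)" "\<And>p s. p \<in> V \<Longrightarrow> 0 \<le> s \<Longrightarrow> s \<le> 1 \<Longrightarrow> qb (walk p s) = c"
  shows "qb = (\<lambda>z\<in>frontier F. c)"
proof (rule extensionalityI[OF assms(1)])
  fix z assume z: "z \<in> frontier F"
  then obtain p where p: "p \<in> V" "z \<in> seg p" unfolding frontier_eq by blast
  then obtain s where "0 \<le> s" "s \<le> 1" "z = walk p s" using seg_walk by blast
  then show "qb z = (\<lambda>z\<in>frontier F. c) z" using assms(2)[OF p(1)] z by simp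
qed simp

text \<open>On each edge a polynomial of degree \<open>k + 1\<close> is determined by its end values
  and its moments up to degree \<open>k - 1\<close>, which leaves the constant as the only candidate
  for the boundary part.\<close>

lemma interpolator_const:
  assumes q0: "q0 \<in> polys (int k - 1)" "\<And>s. s \<in> polys (int k - 1) \<Longrightarrow> ip q0 s = ip (\<lambda>z. c) s"
  shows "interpolator k F V (\<lambda>z\<in>closure F. c) = (restrict q0 F, \<lambda>z\<in>frontier F. c)"
proof -
  let ?f = "\<lambda>z\<in>closure F. c"
  have 1: "L2_projector (face_integral F) (P_space (int k - 1) F) ?f = restrict q0 F"
    unfolding P_space_def
    using closure_subset[of F] by (intro face_projector_eqI[OF fin_dim_polys continuous_on_polys _ _ q0]) auto
  have fw: "?f (walk p s) = poly [:c:] s" if "p \<in> V" "0 \<le> s" "s \<le> 1" for p s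
    using walk_in_frontier[OF that] by (simp add: frontier_def)
  have 2: "(THE qb. qb \<in> Pc_boundary (int k + 1) F V \<and>
      (\<forall>E\<in>edges F V. L2_projector (edge_integral E) (P_space (int k - 1) E) qb =
         L2_projector (edge_integral E) (P_space (int k - 1) E) ?f) \<and> (\<forall>x\<in>V. qb x = ?f x)) = (\<lambda>z\<in>frontier F. c)"
  proof (rule the_equality, intro conjI ballI)
    show "(\<lambda>z\<in>frontier F. c) \<in> Pc_boundary (int k + 1) F V" by (rule const_in_Pc_boundary) simp
    show "L2_projector (edge_integral E) (P_space (int k - 1) E) (\<lambda>z\<in>frontier F. c) =
        L2_projector (edge_integral E) (P_space (int k - 1) E) ?f" if "E \<in> edges F V" for E
    proof -
      obtain a b where E: "E = closed_segment a b" "E \<subseteq> frontier F" using \<open>E \<in> edges F V\<close> by (auto simp: edges_def)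
      then have "E \<subseteq> closure F" by (auto simp: frontier_def)
      then have "edge_integral E (\<lambda>z. ((\<lambda>z\<in>frontier F. c) z - v z) \<bullet> w z) = edge_integral E (\<lambda>z. (?f z - v z) \<bullet> w z)" for v w :: "point \<Rightarrow> real"
        using E(2) unfolding E(1) by (intro edge_integral_cong) auto
      then show ?thesis unfolding L2_projector_def by simp
    qed
    show "(\<lambda>z\<in>frontier F. c) x = ?f x" if "x \<in> V" for x
      using that V_frontier by (auto simp: frontier_def)
  next
    fix qb assume qb: "qb \<in> Pc_boundary (int k + 1) F V \<and>
      (\<forall>E\<in>edges F V. L2_projector (edge_integral E) (P_space (int k - 1) E) qb =
         L2_projector (edge_integral E) (P_space (int k - 1) E) ?f) \<and> (\<forall>x\<in>V. qb x = ?f x)"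
    obtain Q where Q: "edge_trace qb (int k + 1) Q" using Pc_boundary_trace qb by blast
    have val: "qb x = c" if "x \<in> V" for x
      using qb that V_frontier by (auto simp: frontier_def)
    have "qb (walk p s) = c" if p: "p \<in> V" and s: "0 \<le> s" "s \<le> 1" for p s
    proof -
      have Qp: "Q p \<in> upoly (int k + 1)" "\<And>s. 0 \<le> s \<Longrightarrow> s \<le> 1 \<Longrightarrow> qb (walk p s) = poly (Q p) s"
        using Q p by (auto simp: edge_trace_def)
      have "poly (Q p - [:c:]) s = 0"
      \<comment> \<open>The degrees fit because \<open>k + 1\<close> is \<open>k - 1 + 2\<close>;
        for \<open>k = 0\<close> the test space is zero and the end values suffice.\<close>
      proof (rule upoly_zero_if_orthogonal[where l = "int k - 1", OF _ _ _ _ s])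
        show "Q p - [:c:] \<in> upoly (int k - 1 + 2)"
          using Qp(1) by (auto simp: upoly_def coeff_pCons split: nat.split)
        show "poly (Q p - [:c:]) 0 = 0" "poly (Q p - [:c:]) 1 = 0"
          using Qp(2)[of 0] Qp(2)[of 1] val[OF p] val[OF next_edge(1)[OF p]] by (simp_all add: linepath_eq)
        show "(LINT s:{0..1}|lborel. poly ((Q p - [:c:]) * M) s) = 0" if "M \<in> upoly (int k - 1)" for M
          using edge_projection_eq_imp_moments[OF p Qp(2) fw[OF p] _ that] qb seg_edge[OF p] by blast
      qed
      then show ?thesis using Qp(2)[OF s] by simp
    qed
    then show "qb = (\<lambda>z\<in>frontier F. c)" using qb by (intro boundary_eqI) (auto simp: Pc_boundary_def)
  qed
  show ?thesis unfolding interpolator_def 1 2 ..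
qed

lemma interpolator_const_exists:
  "\<exists>q0\<in>polys (int k - 1). interpolator k F V (\<lambda>z\<in>closure F. c) = (restrict q0 F, \<lambda>z\<in>frontier F. c) \<and>
    (\<forall>s\<in>polys (int k - 1). ip q0 s = ip (\<lambda>z. c) s)"
proof -
  have pc: "continuous_on UNIV w" if "w \<in> polys (int k - 1)" for w using continuous_on_polys[OF that] .
  have "\<exists>q0\<in>polys (int k - 1). \<forall>s\<in>polys (int k - 1). ip q0 s = ip (\<lambda>z. c) s"
    using face_projector[of "polys (int k - 1)", OF fin_dim_polys pc continuous_on_const[of UNIV c] refl] by blast
  then show ?thesis using interpolator_const by blast
qed

text \<open>With a constant trace, \<open>lgrad q0 qb w\<close> becomes the integral of
  \<open>c - q0\<close> against the divergence of \<open>w\<close>.\<close>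

lemma bterm_const:
  assumes "\<And>p s. p \<in> V \<Longrightarrow> 0 \<le> s \<Longrightarrow> s \<le> 1 \<Longrightarrow> qb (walk p s) = c" "w \<in> vpolys l"
  shows "bterm qb w = - ip (\<lambda>z. c) (divergence w)"
proof -
  have "bterm qb w = (\<Sum>p\<in>V. LINT s:{0..1}|lborel. c * (w (walk p s) \<bullet> perp (side p)))"
    unfolding bterm_def using assms(1) by (intro sum.cong set_lebesgue_integral_cong) auto
  also have "\<dots> = - (c * face_integral F (divergence w))"
    unfolding divergence_theorem[OF assms(2)] by (simp add: sum_distrib_left)
  finally show ?thesis by (simp add: ip_def face_integral_scale)
qed

lemma zero_rot_in_P_edges: "snd (zero_rot F V) \<in> P_edges l F V"
proof -
  have "(\<lambda>x\<in>E. 0) \<in> P_space l E" for E using polys_zero by (force simp: P_space_def)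
  then show ?thesis by (simp add: zero_rot_def P_edges_def)
qed

lemma P_space_F: "q \<in> P_space l F \<longleftrightarrow> (\<exists>q0\<in>polys l. q = restrict q0 F)"
  by (auto simp: P_space_def)

section \<open>The kernel of the discrete gradient\<close>

lemma discrete_gradient_const:
  "discrete_gradient k F V t (interpolator k F V (\<lambda>z\<in>closure F. c)) = zero_rot F V"
proof -
  obtain q0 where q0: "q0 \<in> polys (int k - 1)" "interpolator k F V (\<lambda>z\<in>closure F. c) = (restrict q0 F, \<lambda>z\<in>frontier F. c)"
    "\<And>s. s \<in> polys (int k - 1) \<Longrightarrow> ip q0 s = ip (\<lambda>z. c) s" using interpolator_const_exists by blast
  let ?qb = "\<lambda>z\<in>frontier F. c"
  have tr: "edge_trace ?qb (int k + 1) (\<lambda>p. [:c:])" by (rule trace_const) simp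
  have qbw: "?qb (walk p s) = c" if "p \<in> V" "0 \<le> s" "s \<le> 1" for p s using walk_in_frontier[OF that] by simp
  obtain g p w where G: "p \<in> polys (int k)" "w \<in> rperp k"
    "discrete_gradient k F V t (restrict q0 F, ?qb) = ((\<lambda>z\<in>F. rot p z + w z), boundary_gradient F V t ?qb)"
    "\<And>r. r \<in> polys (int k) \<Longrightarrow> ip (rot p) (rot r) = - bterm ?qb (rot r)"
    "\<And>u. u \<in> rperp k \<Longrightarrow> ip w u = lgrad q0 ?qb u"
    using discrete_gradient_char[OF q0(1) tr, of k] by blast
  \<comment> \<open>The divergence of \<open>w\<close> has degree at most \<open>k - 1\<close>,
    where \<open>q0\<close> and \<open>c\<close> have the same moments.\<close>
  have "lgrad q0 ?qb w = 0"
    using bterm_const[of ?qb, OF qbw rperp_vpolys[OF G(2)]] q0(3)[OF divergence_in_polys[OF rperp_vpolys[OF G(2)]]]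
    by (simp add: lgrad_def)
  then have w: "w = (\<lambda>z. 0)" using vpolys_ip_zero[OF rperp_vpolys[OF G(2)]] G(5)[OF G(2)] by simp
  have "bterm ?qb (rot p) = 0"
    using boundary_integration_by_parts[OF tr G(1)] by (simp add: set_lebesgue_integral_def)
  then have rp: "rot p = (\<lambda>z. 0)"
    using vpolys_ip_zero[OF rot_in_vpolys[of p "int k - 1"]] G(4)[OF G(1)] G(1) by simp
  have bg: "boundary_gradient F V t ?qb = snd (zero_rot F V)"
  proof (rule P_edges_eqI[OF boundary_gradient_in_P_edges[OF tr] zero_rot_in_P_edges])
    fix p s assume ps: "p \<in> V" "0 \<le> s" "s \<le> (1 :: real)"
    show "boundary_gradient F V t ?qb (seg p) (walk p s) = snd (zero_rot F V) (seg p) (walk p s)"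
      using boundary_gradient_walk[OF tr ps] walk_in_seg[OF ps(2,3)] seg_edge[OF ps(1)] by (simp add: zero_rot_def)
  qed
  show ?thesis unfolding q0(2) G(3) bg w rp by (simp add: zero_rot_def)
qed

lemma interpolator_const_in_X_grad: "interpolator k F V (\<lambda>z\<in>closure F. c) \<in> X_grad k F V"
proof -
  obtain q0 where q0: "q0 \<in> polys (int k - 1)" "interpolator k F V (\<lambda>z\<in>closure F. c) = (restrict q0 F, \<lambda>z\<in>frontier F. c)"
    using interpolator_const_exists by blast
  then show ?thesis using const_in_Pc_boundary[of "int k + 1" c] by (auto simp: X_grad_def P_space_F)
qed

lemma discrete_gradient_kernel:
  assumes q: "q \<in> X_grad k F V" and zero: "discrete_gradient k F V t q = zero_rot F V"
  shows "\<exists>c. q = interpolator k F V (\<lambda>z\<in>closure F. c)"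
proof -
  obtain q0 qb where q0: "q0 \<in> polys (int k - 1)" "qb \<in> Pc_boundary (int k + 1) F V" "q = (restrict q0 F, qb)"
    using q unfolding X_grad_def P_space_def by blast
  obtain Q where tr: "edge_trace qb (int k + 1) Q" using Pc_boundary_trace[OF q0(2)] by blast
  obtain g p w where G: "g \<in> vpolys (int k)" "p \<in> polys (int k)" "w \<in> rperp k"
    "discrete_gradient k F V t (restrict q0 F, qb) = ((\<lambda>z\<in>F. rot p z + w z), boundary_gradient F V t qb)"
    "\<And>u. u \<in> vpolys (int k) \<Longrightarrow> ip g u = lgrad q0 qb u"
    "\<And>u. u \<in> rperp k \<Longrightarrow> ip w u = lgrad q0 qb u"
    using discrete_gradient_char[OF q0(1) tr, of k] by blast
  have G0: "(\<lambda>z\<in>F. rot p z + w z) = (\<lambda>z\<in>F. 0)" "boundary_gradient F V t qb = (\<lambda>E\<in>edges F V. \<lambda>x\<in>E. 0)"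
    using zero G(4) q0(3) by (simp_all add: zero_rot_def)
  have Q0: "pderiv (Q p) = 0" if p: "p \<in> V" for p
  proof -
    have "poly (pderiv (Q p)) s = 0" if "s \<in> {0..1}" for s
    proof -
      have s: "0 \<le> s" "s \<le> 1" using that by auto
      have "speed p * poly (pderiv (Q p)) s = 0"
        using boundary_gradient_walk[OF tr p s] walk_in_seg[OF s] seg_edge[OF p] unfolding G0(2) by simp
      then show ?thesis using tangent_eq(3)[OF p] by simp
    qed
    then have "{0..1} \<subseteq> {s. poly (pderiv (Q p)) s = 0}" by blast
    moreover have "infinite {0..1 :: real}" by simp
    ultimately show ?thesis using poly_roots_finite finite_subset by blast
  qed
  have along: "qb (walk p s) = qb p" if p: "p \<in> V" and s: "0 \<le> s" "s \<le> 1" for p s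
  proof -
    obtain a where "Q p = [:a:]" using Q0[OF p] pderiv_iszero by blast
    moreover have "qb (walk p s) = poly (Q p) s" "qb (walk p 0) = poly (Q p) 0" using tr p s by (auto simp: edge_trace_def)
    ultimately show ?thesis by (simp add: linepath_eq)
  qed
  obtain p0 where p0: "p0 \<in> V" using V_nonempty by blast
  define c where "c = qb p0"
  \<comment> \<open>Constancy along each edge only carries the value from a vertex to its successor;
    connectedness of the boundary makes the constant global.\<close>
  have Vc: "{p\<in>V. qb p = c} = V"
  proof (rule next_invariant_subset)
    show "{p\<in>V. qb p = c} \<noteq> {}" using p0 unfolding c_def by blast
    show "next_vertex p \<in> {p\<in>V. qb p = c}" if "p \<in> {p\<in>V. qb p = c}" for p
      using that along[of p 1] next_edge(1)[of p] by (simp add: linepath_eq)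
  qed blast
  have const: "qb (walk p s) = c" if "p \<in> V" "0 \<le> s" "s \<le> 1" for p s
  proof -
    have "p \<in> {p\<in>V. qb p = c}" unfolding Vc by (rule that(1))
    then show ?thesis using along[OF that] by simp
  qed
  then have qb: "qb = (\<lambda>z\<in>frontier F. c)" using q0(2) by (intro boundary_eqI) (auto simp: Pc_boundary_def)
  have zr: "0 \<in> rperp k" "rot (\<lambda>z. 0) = (\<lambda>z. 0)"
    using fin_dim_rperp subspace_0 dx_const[of 0] by (auto simp: fin_dim_def fun_eq_iff rot_eq zero_prod_def)
  have "rot p z + w z = rot (\<lambda>z. 0) z + 0 z" if "z \<in> F" for z
    using fun_cong[OF G0(1), of z] that unfolding zr(2) by simp
  from rot_rperp_unique(2)[OF G(2) polys_zero G(3) zr(1) this] have w: "w = 0" .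
  have perp0: "ip g u = 0" if "u \<in> rperp k" for u
    using G(5)[OF rperp_vpolys[OF that]] G(6)[OF that] w by (simp add: ip_def face_integral_def)
  \<comment> \<open>The vanishing of \<open>rot p\<close> covers potentials of degree
    \<open>k\<close> only, while \<open>r\<close> has degree \<open>k + 1\<close>. For
    \<open>rot r\<close>, integration by parts with the constant trace takes over.\<close>
  obtain r u where ru: "r \<in> polys (int k + 1)" "u \<in> rperp k" "g = rot r + u"
    using rot_orthogonal_decomposition[OF G(1)] by blast
  have gc: "lin_on (vpolys (int k)) (ip g)" using G(1) continuous_on_vpolys by (intro lin_on_ip) auto
  have rv: "rot r \<in> vpolys (int k)" by (rule rot_in_vpolys[OF ru(1)])
  have "ip g g = ip g (rot r) + ip g u" using lin_onD(1)[OF gc rv rperp_vpolys[OF ru(2)]] ru(3) by simp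
  also have "\<dots> = ip g (rot r)" using perp0[OF ru(2)] by simp
  also have "\<dots> = - bterm qb (rot r)" using G(5)[OF rv] lgrad_rot[OF ru(1)] by simp
  also have "\<dots> = 0"
    using boundary_integration_by_parts[OF tr ru(1)] Q0 by (simp add: set_lebesgue_integral_def)
  finally have g: "g = (\<lambda>z. 0)" by (rule vpolys_ip_zero[OF G(1)])
  have "ip q0 s = ip (\<lambda>z. c) s" if s: "s \<in> polys (int k - 1)" for s
  proof -
    \<comment> \<open>Any \<open>s\<close> of degree \<open>k - 1\<close> is the divergence of an
      admissible test field; \<open>g = 0\<close> then says that \<open>q0\<close> and
      \<open>c\<close> have the same moment against \<open>s\<close>.\<close>
    obtain S where S: "S \<in> polys (int k)" "dx S = s" using polys_antideriv(1)[OF s] by auto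
    define v where "v = (\<lambda>z. (S z, 0 :: real))"
    have v: "v \<in> vpolys (int k)" using S(1) polys_zero by (simp add: v_def mem_vpolys)
    have "divergence v = s" using divergence_eq[OF v] S(2) dx_const(2)[of 0] by (simp add: v_def fun_eq_iff)
    then show ?thesis
      using G(5)[OF v] bterm_const[of qb c, OF const v] g by (simp add: lgrad_def ip_def[of "\<lambda>z. 0"] face_integral_def)
  qed
  from interpolator_const[OF q0(1) this] show ?thesis using q0(3) qb by (intro exI[of _ c]) simp
qed

text \<open>The first component contributes \<open>- bterm qb (rot r)\<close> to the moments of the
  curl. In the boundary component the factors \<open>speed p\<close> cancel, and integration by
  parts returns the same term with the opposite sign.\<close>

lemma discrete_curl_gradient:
  assumes q: "q \<in> X_grad k F V"
  shows "discrete_gradient k F V t q \<in> X_rot k F V"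
    and "discrete_curl k F V t (discrete_gradient k F V t q) = (\<lambda>z\<in>F. 0)"
proof -
  obtain q0 qb where q0: "q0 \<in> polys (int k - 1)" "qb \<in> Pc_boundary (int k + 1) F V" "q = (restrict q0 F, qb)"
    using q unfolding X_grad_def P_space_def by blast
  obtain Q where tr: "edge_trace qb (int k + 1) Q" using Pc_boundary_trace[OF q0(2)] by blast
  obtain g p w where G: "p \<in> polys (int k)" "w \<in> rperp k"
    "discrete_gradient k F V t (restrict q0 F, qb) = ((\<lambda>z\<in>F. rot p z + w z), boundary_gradient F V t qb)"
    "\<And>r. r \<in> polys (int k) \<Longrightarrow> ip (rot p) (rot r) = - bterm qb (rot r)"
    using discrete_gradient_char[OF q0(1) tr, of k] by blast
  show "discrete_gradient k F V t q \<in> X_rot k F V"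
    unfolding X_rot_iff q0(3) G(3) using G(1,2) boundary_gradient_in_P_edges[OF tr] by auto
  have "discrete_curl k F V t ((\<lambda>z\<in>F. rot p z + w z), boundary_gradient F V t qb) = restrict (\<lambda>z. 0) F"
  proof (rule discrete_curl_eqI[OF G(1,2) polys_zero])
    fix r assume r: "r \<in> polys (int k)"
    have "bcurl (boundary_gradient F V t qb) r =
        (\<Sum>p\<in>V. (LINT s:{0..1}|lborel. poly (smult (speed p) (pderiv (Q p))) s * r (walk p s)) / speed p)"
      by (rule bcurl_eq) (simp add: boundary_gradient_walk[OF tr])
    also have "\<dots> = (\<Sum>p\<in>V. LINT s:{0..1}|lborel. poly (pderiv (Q p)) s * r (walk p s))"
      using tangent_eq(3) by (intro sum.cong) (simp_all add: mult.assoc)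
    also have "\<dots> = bterm qb (rot r)" by (rule boundary_integration_by_parts[OF tr r, symmetric])
    finally show "ip (\<lambda>z. 0) r = ip (rot p) (rot r) + bcurl (boundary_gradient F V t qb) r"
      using G(4)[OF r] by (simp add: ip_def[of "\<lambda>z. 0"] face_integral_def)
  qed
  then show "discrete_curl k F V t (discrete_gradient k F V t q) = (\<lambda>z\<in>F. 0)"
    unfolding q0(3) G(3) .
qed

lemma discrete_curl_kernel:
  assumes v: "v \<in> X_rot k F V" and zero: "discrete_curl k F V t v = (\<lambda>z\<in>F. 0)"
  shows "\<exists>q\<in>X_grad k F V. discrete_gradient k F V t q = v"
proof -
  obtain p w where pw: "p \<in> polys (int k)" "w \<in> rperp k" "fst v = (\<lambda>z\<in>F. rot p z + w z)"
    and vb: "snd v \<in> P_edges (int k) F V" using v unfolding X_rot_iff by blast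
  have veq: "v = ((\<lambda>z\<in>F. rot p z + w z), snd v)" using pw(3) by (cases v) simp
  obtain c where c: "c \<in> polys (int k)" "discrete_curl k F V t ((\<lambda>z\<in>F. rot p z + w z), snd v) = restrict c F"
    "\<And>r. r \<in> polys (int k) \<Longrightarrow> ip c r = ip (rot p) (rot r) + bcurl (snd v) r"
    using discrete_curl_char[OF pw(1,2) vb] by blast
  have "restrict c F = (\<lambda>z\<in>F. 0)" using c(2) zero veq by simp
  then have "c z = 0" if "z \<in> F" for z using that by (metis restrict_apply')
  then have "ip c r = ip (\<lambda>z. 0) r" for r by (intro ip_cong) auto
  then have curl0: "ip (rot p) (rot r) = - bcurl (snd v) r" if "r \<in> polys (int k)" for r
    using c(3)[OF that] by (simp add: ip_def[of "\<lambda>z. 0"] face_integral_def)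
  obtain u where u: "\<And>p. p \<in> V \<Longrightarrow> u p \<in> upoly (int k)"
    "\<And>p s. p \<in> V \<Longrightarrow> 0 \<le> s \<Longrightarrow> s \<le> 1 \<Longrightarrow> snd v (seg p) (walk p s) = poly (u p) s"
    using P_edges_walk[OF vb] by blast
  \<comment> \<open>The boundary gradient multiplies the derivative in the walk parameter by
    \<open>speed p\<close>, so this is the derivative that the sought trace must have.\<close>
  define U where "U = (\<lambda>p. smult (1 / speed p) (u p))"
  have bU: "bcurl (snd v) r = (\<Sum>p\<in>V. LINT s:{0..1}|lborel. poly (U p) s * r (walk p s))" for r
  proof -
    have "bcurl (snd v) r = (\<Sum>p\<in>V. (LINT s:{0..1}|lborel. poly (u p) s * r (walk p s)) / speed p)"
      by (rule bcurl_eq[OF u(2)])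
    then show ?thesis by (simp add: U_def mult.assoc)
  qed
  have "\<forall>p\<in>V. \<exists>A. A \<in> upoly (int k + 1) \<and> pderiv A = U p \<and> poly A 0 = 0"
    using upoly_antideriv[OF upoly_smult[OF u(1)]] unfolding U_def by blast
  from bchoice[OF this] obtain A where A: "\<And>p. p \<in> V \<Longrightarrow> A p \<in> upoly (int k + 1)"
    "\<And>p. p \<in> V \<Longrightarrow> pderiv (A p) = U p" "\<And>p. p \<in> V \<Longrightarrow> poly (A p) 0 = 0" by blast
  have "(\<Sum>p\<in>V. poly (A p) 1) = 0"
  proof -
    have "(\<Sum>p\<in>V. poly (A p) 1) = (\<Sum>p\<in>V. LINT s:{0..1}|lborel. poly (U p) s * 1)"
    proof (rule sum.cong)
      fix p assume "p \<in> V"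
      then show "poly (A p) 1 = (LINT s:{0..1}|lborel. poly (U p) s * 1)"
        using integral_pderiv[of "A p"] A(2,3)[of p] by simp
    qed simp
    also have "\<dots> = - ip (rot p) (rot (\<lambda>z. 1))"
      using curl0[OF polys_const[of "int k" 1]] bU by simp
    also have "\<dots> = 0"
    proof -
      have "rot (\<lambda>z. 1) = (\<lambda>z. 0)" using dx_const[of 1] by (simp add: fun_eq_iff rot_eq zero_prod_def)
      then show ?thesis by (simp add: ip_def face_integral_def)
    qed
    finally show ?thesis .
  qed
  from potential_exists[OF this] obtain \<phi> where \<phi>: "\<And>p. p \<in> V \<Longrightarrow> \<phi> (next_vertex p) - \<phi> p = poly (A p) 1" by blast
  \<comment> \<open>\<open>A p\<close> starts at 0; the potential shifts the edge primitives so that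
    they match at the vertices.\<close>
  define Q where "Q = (\<lambda>p. [:\<phi> p:] + A p)"
  have Qu: "Q p \<in> upoly (int k + 1)" if "p \<in> V" for p
    unfolding Q_def by (intro upoly_add[OF upoly_degree A(1)[OF that]]) simp
  have "\<exists>qb\<in>Pc_boundary (int k + 1) F V. \<forall>p\<in>V. \<forall>s. 0 \<le> s \<longrightarrow> s \<le> 1 \<longrightarrow> qb (walk p s) = poly (Q p) s"
  proof (rule glue_edge_polynomials[OF Qu])
    show "poly (Q p) 0 = \<phi> p" "poly (Q p) 1 = \<phi> (next_vertex p)" if "p \<in> V" for p
      using A(3)[OF that] \<phi>[OF that] by (simp_all add: Q_def algebra_simps)
  qed
  then obtain qb where qb: "qb \<in> Pc_boundary (int k + 1) F V"
    "\<And>p s. p \<in> V \<Longrightarrow> 0 \<le> s \<Longrightarrow> s \<le> 1 \<Longrightarrow> qb (walk p s) = poly (Q p) s" by blast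
  have tr: "edge_trace qb (int k + 1) Q" using Qu qb(2) by (simp add: edge_trace_def)
  have dQ: "pderiv (Q p) = U p" if "p \<in> V" for p using A(2)[OF that] by (simp add: Q_def pderiv_add pderiv_pCons)
  have bt: "bterm qb (rot r) = bcurl (snd v) r" if "r \<in> polys l" for r l
    unfolding boundary_integration_by_parts[OF tr that] bU using dQ by (intro sum.cong) simp_all
  have wc: "continuous_on UNIV x" if "x \<in> rperp k" for x using continuous_on_vpolys[OF rperp_vpolys[OF that]] .
  have dc: "continuous_on UNIV (divergence x)" if "x \<in> rperp k" for x
    using continuous_on_polys[OF divergence_in_polys[OF rperp_vpolys[OF that]]] .
  \<comment> \<open>Obtained by solving \<open>lgrad (divergence x) qb y = ip w y\<close> for the
    product of the divergences, since \<open>w\<close> is the prescribed second component.\<close>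
  define L where "L = (\<lambda>x. - bterm qb x + - ip w x)"
  have sub: "rperp k \<subseteq> vpolys (int k)" using rperp_vpolys by blast
  have linL: "lin_on (rperp k) L"
    unfolding L_def
    by (intro lin_on_add lin_on_minus lin_on_subset[OF lin_on_bterm[OF tr] sub] lin_on_ip wc pw(2))
  have linB: "lin_on (rperp k) (\<lambda>x. ip (divergence y) (divergence x))" if y: "y \<in> rperp k" for y
  proof -
    have "lin_on (polys (int k - 1)) (ip (divergence y))"
      using dc[OF y] continuous_on_polys by (intro lin_on_ip) auto
    then show ?thesis
      using divergence_in_polys[OF rperp_vpolys] divergence_linear[OF rperp_vpolys rperp_vpolys] unfolding lin_on_def by simp
  qed
  have "\<exists>x\<in>rperp k. \<forall>y\<in>rperp k. ip (divergence x) (divergence y) = L y"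
  proof (rule riesz[OF fin_dim_rperp linB ip_commute ip_nonneg linL])
    fix x assume x: "x \<in> rperp k" "ip (divergence x) (divergence x) = 0"
    have d0: "divergence x = (\<lambda>z. 0)"
      by (rule polys_eq_on_F[OF divergence_in_polys[OF rperp_vpolys[OF x(1)]] x(2)])
    have "\<exists>r\<in>polys (int k + 1). \<forall>z. rot r z = (fst (x z), snd (x z))"
      using rperp_vpolys[OF x(1)] divergence_eq[OF rperp_vpolys[OF x(1)]] d0
      by (intro div_free_imp_rot) (auto simp: mem_vpolys)
    then obtain r where r: "r \<in> polys (int k + 1)" "rot r = x" by (auto simp: fun_eq_iff)
    have "ip x x = 0" using x(1) r unfolding rperp_def by blast
    then have "x = (\<lambda>z. 0)" by (rule vpolys_ip_zero[OF rperp_vpolys[OF x(1)]])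
    then have "L x = L (0 *\<^sub>R x)" by (simp add: scaleR_fun_def)
    then show "L x = 0" using lin_onD(2)[OF linL x(1), of 0] by simp
  qed
  then obtain x where x: "x \<in> rperp k" "\<And>y. y \<in> rperp k \<Longrightarrow> ip (divergence x) (divergence y) = L y" by blast
  define q0 where "q0 = divergence x"
  have q0: "q0 \<in> polys (int k - 1)" unfolding q0_def by (rule divergence_in_polys[OF rperp_vpolys[OF x(1)]])
  obtain p' w' where G: "p' \<in> polys (int k)" "w' \<in> rperp k"
    "discrete_gradient k F V t (restrict q0 F, qb) = ((\<lambda>z\<in>F. rot p' z + w' z), boundary_gradient F V t qb)"
    "\<And>r. r \<in> polys (int k) \<Longrightarrow> ip (rot p') (rot r) = - bterm qb (rot r)"
    "\<And>u. u \<in> rperp k \<Longrightarrow> ip w' u = lgrad q0 qb u"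
    using discrete_gradient_char[OF q0 tr, of k] by blast
  have w': "w' = w"
  proof -
    have mom: "ip y w' = ip y w" if y: "y \<in> rperp k" for y
      using G(5)[OF y] x(2)[OF y] by (simp add: lgrad_def q0_def L_def ip_commute[of y])
    have d: "w' - w \<in> rperp k" using fin_dim_rperp G(2) pw(2) by (simp add: fin_dim_def subspace_diff)
    have "lin_on (rperp k) (ip (w' - w))" by (intro lin_on_ip wc[OF d] wc)
    from lin_on_diff[OF this _ G(2) pw(2)] mom[OF d] fin_dim_rperp
    have "ip (w' - w) (w' - w) = 0" by (simp add: fin_dim_def)
    from vpolys_ip_zero[OF rperp_vpolys[OF d] this] show ?thesis by (simp add: fun_eq_iff)
  qed
  have p': "rot p' = rot p"
  proof -
    have d: "p' - p \<in> polys (int k)" using G(1) pw(1) subspace_polys by (simp add: subspace_diff)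
    have rd: "rot (p' - p) = rot p' - rot p" by (rule rot_linear(3)[OF G(1) pw(1)])
    \<comment> \<open>No freedom is left for this component: the choice of the trace already fixes
      its moments, and the vanishing of the curl makes them those of \<open>rot p\<close>.\<close>
    have mom: "ip (rot r) (rot p') = ip (rot r) (rot p)" if r: "r \<in> polys (int k)" for r
      using G(4)[OF r] curl0[OF r] bt[OF r] by (simp add: ip_commute[of "rot r"])
    have "lin_on (rot ` polys (int k)) (ip (rot (p' - p)))"
      using continuous_rot d by (intro lin_on_ip) auto
    from lin_on_diff[OF this subspace_rot, of "rot p'" "rot p"] mom[OF d] G(1) pw(1)
    have "ip (rot (p' - p)) (rot (p' - p)) = 0" unfolding rd by simp
    from vpolys_ip_zero[OF rot_in_vpolys[of "p' - p" "int k - 1"] this] d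
    show ?thesis unfolding rd by (simp add: fun_eq_iff)
  qed
  have "boundary_gradient F V t qb = snd v"
  proof (rule P_edges_eqI[OF boundary_gradient_in_P_edges[OF tr] vb])
    fix p s assume ps: "p \<in> V" "0 \<le> s" "s \<le> (1 :: real)"
    show "boundary_gradient F V t qb (seg p) (walk p s) = snd v (seg p) (walk p s)"
      using boundary_gradient_walk[OF tr ps] u(2)[OF ps] tangent_eq(3)[OF ps(1)] dQ[OF ps(1)] by (simp add: U_def)
  qed
  then have "discrete_gradient k F V t (restrict q0 F, qb) = v" using G(3) w' p' veq by simp
  moreover have "(restrict q0 F, qb) \<in> X_grad k F V" using q0 qb(1) by (auto simp: X_grad_def P_space_F)
  ultimately show ?thesis by blast
qed

section \<open>The range of the discrete curl\<close>

lemma discrete_curl_in_P_space: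
  assumes "v \<in> X_rot k F V"
  shows "discrete_curl k F V t v \<in> P_space (int k) F"
proof -
  obtain p w where pw: "p \<in> polys (int k)" "w \<in> rperp k" "fst v = (\<lambda>z\<in>F. rot p z + w z)"
    and vb: "snd v \<in> P_edges (int k) F V" using assms unfolding X_rot_iff by blast
  have "v = ((\<lambda>z\<in>F. rot p z + w z), snd v)" using pw(3) by (cases v) simp
  then show ?thesis using discrete_curl_char[OF pw(1,2) vb] by (auto simp: P_space_F)
qed

lemma discrete_curl_surjective:
  assumes "d \<in> P_space (int k) F"
  shows "\<exists>v\<in>X_rot k F V. discrete_curl k F V t v = d"
proof -
  obtain c where c: "c \<in> polys (int k)" "d = restrict c F" using assms by (auto simp: P_space_F)
  obtain p0 where p0: "p0 \<in> V" using V_nonempty by blast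
  define \<kappa> where "\<kappa> = face_integral F c"
  \<comment> \<open>The factor \<open>speed p0\<close> cancels the division in \<open>bcurl\<close>,
    so that testing with 1 gives \<open>\<kappa>\<close>, the integral of \<open>c\<close>.\<close>
  define vb where "vb = (\<lambda>E\<in>edges F V. \<lambda>z\<in>E. if E = seg p0 then speed p0 * \<kappa> else 0)"
  have vb: "vb \<in> P_edges (int k) F V"
  proof -
    have "(\<lambda>z\<in>E. a) \<in> P_space (int k) E" for E and a :: real
      using polys_const[of "int k" a] by (auto simp: P_space_def)
    then show ?thesis by (simp add: vb_def P_edges_def)
  qed
  have vb_walk: "vb (seg p) (walk p s) = poly [:if p = p0 then speed p0 * \<kappa> else 0:] s"
    if "p \<in> V" "0 \<le> s" "s \<le> 1" for p s
  proof -
    have "seg p = seg p0 \<longleftrightarrow> p = p0" using inj_on_edge that(1) p0 unfolding inj_on_def by blast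
    then show ?thesis using seg_edge[OF that(1)] walk_in_seg[OF that(2,3)] by (simp add: vb_def)
  qed
  have bc: "bcurl vb r = \<kappa> * (LINT s:{0..1}|lborel. r (walk p0 s))" for r
  proof -
    have "bcurl vb r = (\<Sum>p\<in>V. (LINT s:{0..1}|lborel. poly [:if p = p0 then speed p0 * \<kappa> else 0:] s * r (walk p s)) / speed p)"
      by (rule bcurl_eq[OF vb_walk])
    also have "\<dots> = (\<Sum>p\<in>V. if p = p0 then \<kappa> * (LINT s:{0..1}|lborel. r (walk p0 s)) else 0)"
      using tangent_eq(3)[OF p0] by (intro sum.cong) auto
    also have "\<dots> = \<kappa> * (LINT s:{0..1}|lborel. r (walk p0 s))" using V_finite p0 by simp
    finally show ?thesis .
  qed
  define L where "L = (\<lambda>r. ip c r + - bcurl vb r)"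
  have linL: "lin_on (polys (int k)) L"
    unfolding L_def by (intro lin_on_add lin_on_minus lin_on_ip lin_on_bcurl[OF vb] continuous_on_polys[OF c(1)] continuous_on_polys)
  have linB: "lin_on (polys (int k)) (\<lambda>r. ip (rot y) (rot r))" if y: "y \<in> polys (int k)" for y
  proof -
    have "lin_on (rot ` polys (int k)) (ip (rot y))" using continuous_rot y by (intro lin_on_ip) auto
    then show ?thesis using rot_linear unfolding lin_on_def by simp
  qed
  have "\<exists>p\<in>polys (int k). \<forall>r\<in>polys (int k). ip (rot p) (rot r) = L r"
  \<comment> \<open>The kernel of the form consists of the constants, so solvability amounts to
    \<open>L\<close> vanishing on constants; \<open>\<kappa>\<close> is chosen for this.\<close>
  proof (rule riesz[OF fin_dim_polys linB ip_commute ip_nonneg linL])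
    fix r assume r: "r \<in> polys (int k)" "ip (rot r) (rot r) = 0"
    have "rot r = (\<lambda>z. 0)" using vpolys_ip_zero[OF rot_in_vpolys[of r "int k - 1"] r(2)] r(1) by simp
    then have const: "r z = r 0" for z using rot_zero_imp_const[OF r(1)] by simp
    have "ip c r = ip c (\<lambda>z. r 0)" using const by (intro ip_cong) auto
    also have "\<dots> = \<kappa> * r 0"
      using face_integral_scale[of "r 0" c] by (simp add: ip_def \<kappa>_def mult.commute)
    finally have "ip c r = \<kappa> * r 0" .
    moreover have "(LINT s:{0..1}|lborel. r (walk p0 s)) = r 0"
    proof -
      have "(LINT s:{0..1}|lborel. r (walk p0 s)) = (LINT s:{0..1::real}|lborel. r 0)"
        using const by (intro set_lebesgue_integral_cong) auto
      then show ?thesis by (simp add: set_lebesgue_integral_def)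
    qed
    ultimately show "L r = 0" by (simp add: L_def bc)
  qed
  then obtain p where p: "p \<in> polys (int k)" "\<And>r. r \<in> polys (int k) \<Longrightarrow> ip (rot p) (rot r) = L r" by blast
  have zr: "(\<lambda>z. 0) \<in> rperp k"
    using fin_dim_rperp subspace_0[of "rperp k"] by (simp add: fin_dim_def zero_fun_def)
  have "discrete_curl k F V t ((\<lambda>z\<in>F. rot p z + 0), vb) = restrict c F"
    by (rule discrete_curl_eqI[OF p(1) zr c(1)]) (simp add: p(2) L_def)
  moreover have "((\<lambda>z\<in>F. rot p z + 0), vb) \<in> X_rot k F V"
    unfolding X_rot_iff using p(1) zr vb by (intro conjI bexI[of _ p] bexI[of _ "\<lambda>z. 0"]) simp_all
  ultimately show ?thesis using c(2) by blast
qed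

end

theorem theorem8:
  fixes k :: nat and F V :: "point set" and t :: "point set \<Rightarrow> point"
  assumes "polygon F"
    and "vertex_set F V"
    and "\<forall>E\<in>edges F V. unit_tangent E (t E)"
  shows "range (\<lambda>c. interpolator k F V (\<lambda>z\<in>closure F. c)) =
           {q \<in> X_grad k F V. discrete_gradient k F V t q = zero_rot F V}
       \<and> discrete_gradient k F V t ` X_grad k F V =
           {v \<in> X_rot k F V. discrete_curl k F V t v = (\<lambda>z\<in>F. 0)}
       \<and> discrete_curl k F V t ` X_rot k F V = P_space (int k) F"
proof -
  interpret face_tangents F V t
    by unfold_locales (fact assms)+
  show ?thesis
  proof (intro conjI)
    show "range (\<lambda>c. interpolator k F V (\<lambda>z\<in>closure F. c)) =
        {q \<in> X_grad k F V. discrete_gradient k F V t q = zero_rot F V}"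
      using discrete_gradient_const interpolator_const_in_X_grad discrete_gradient_kernel by blast
    show "discrete_gradient k F V t ` X_grad k F V =
        {v \<in> X_rot k F V. discrete_curl k F V t v = (\<lambda>z\<in>F. 0)}"
      using discrete_curl_gradient discrete_curl_kernel by blast
    show "discrete_curl k F V t ` X_rot k F V = P_space (int k) F"
      using discrete_curl_in_P_space discrete_curl_surjective by blast
  qed
qed

end
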